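(* Let $H$ be a group with Kazhdan's property (T) acting by isometric automorphisms on a metric median algebra $(X,d,\mu)$ which is uniformly rectifiable and of finite rank, and such that $(X,d)$ is complete and connected. Then the action has a fixed point.
   Context: A median algebra is a set $M$ with a ternary operation $\mu$ such that $\mu(x,y,z)=\mu(x,z,y)=\mu(y,z,x)$, $\mu(x,x,y)=x$ and $\mu(\mu(x,y,z),u,v)=\mu(x,\mu(y,u,v),\mu(z,u,v))$ for all $x,y,z,u,v$. The median interval is $I(x,y)=\{z:\mu(x,y,z)=z\}$; a subset is convex if it contains $I(a,b)$ for all its elements $a,b$; a subalgebra is a subset closed under $\mu$. A wall is a partition $M=h\sqcup h^c$ into two non-empty convex subsets; it separates $a,b$ if they lie in different parts; $\mathcal{W}(M)$ is the set of walls and $\mathcal{W}^M(a|b)$ the set of walls separating $a,b$. Every finite median algebra $M$ is the vertex set of a finite $\mathrm{CAT}(0)$ cube complex $\mathscr{C}(M)$ whose edges join $x,y$ exactly when a unique wall of $M$ separates them; the rank of a finite median algebra is the dimension of $\mathscr{C}(M)$, and the rank of a general median algebra is the supremum of ranks of its finite subalgebras. A metric median algebra $(X,d,\mu)$ is a median algebra $(X,\mu)$ with a metric $d$ for which $\mu$ is continuous; an isometric automorphism is an isometry of $(X,d)$ commuting with $\mu$. For a finite subalgebra $M$ and $W\in\mathcal{W}(M)$, let $\lambda^M_{\max}(W)=\max d(a,b)$ over edges $\{a,b\}$ of $\mathscr{C}(M)$ separated by $W$; for $x,y\in X$ set $d^M_\mu(x,y)=\sum_{W\in\mathcal{W}^M(x|y)}\lambda^M_{\max}(W)$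 if $x,y\in M$ and $0$ otherwise, and $d_\mu(x,y)=\sup_M d^M_\mu(x,y)\in[0,\infty]$ over all finite subalgebras $M$. $(X,d,\mu)$ is uniformly rectifiable if there is $L\ge0$ with $d_\mu(x,y)\le L\,d(x,y)$ for all $x,y$. *)

theory Defs
  imports "HOL-Algebra.Group_Action" "HOL-Analysis.Analysis"
begin

definition median_algebra :: "'a set \<Rightarrow> ('a \<Rightarrow> 'a \<Rightarrow> 'a \<Rightarrow> 'a) \<Rightarrow> bool" where
  "median_algebra X \<mu> \<longleftrightarrow>
     (\<forall>x\<in>X. \<forall>y\<in>X. \<forall>z\<in>X. \<mu> x y z \<in> X) \<and>
     (\<forall>x\<in>X. \<forall>y\<in>X. \<forall>z\<in>X. \<mu> x y z = \<mu> x z y \<and> \<mu> x y z = \<mu> y z x) \<and>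
     (\<forall>x\<in>X. \<forall>y\<in>X. \<mu> x x y = x) \<and>
     (\<forall>x\<in>X. \<forall>y\<in>X. \<forall>z\<in>X. \<forall>u\<in>X. \<forall>v\<in>X.
        \<mu> (\<mu> x y z) u v = \<mu> x (\<mu> y u v) (\<mu> z u v))"

definition metric_median_algebra :: "'a::metric_space set \<Rightarrow> ('a \<Rightarrow> 'a \<Rightarrow> 'a \<Rightarrow> 'a) \<Rightarrow> bool" where
  "metric_median_algebra X \<mu> \<longleftrightarrow>
     median_algebra X \<mu> \<and> continuous_on (X \<times> X \<times> X) (\<lambda>(x, y, z). \<mu> x y z)"

definition subalgebra :: "'a set \<Rightarrow> ('a \<Rightarrow> 'a \<Rightarrow> 'a \<Rightarrow> 'a) \<Rightarrow> 'a set \<Rightarrow> bool" where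
  "subalgebra X \<mu> M \<longleftrightarrow> M \<subseteq> X \<and> (\<forall>x\<in>M. \<forall>y\<in>M. \<forall>z\<in>M. \<mu> x y z \<in> M)"

definition finite_subalgebras :: "'a set \<Rightarrow> ('a \<Rightarrow> 'a \<Rightarrow> 'a \<Rightarrow> 'a) \<Rightarrow> 'a set set" where
  "finite_subalgebras X \<mu> = {M. finite M \<and> subalgebra X \<mu> M}"

definition median_interval :: "'a set \<Rightarrow> ('a \<Rightarrow> 'a \<Rightarrow> 'a \<Rightarrow> 'a) \<Rightarrow> 'a \<Rightarrow> 'a \<Rightarrow> 'a set" where
  "median_interval M \<mu> a b = {z\<in>M. \<mu> a b z = z}"

definition median_convex :: "'a set \<Rightarrow> ('a \<Rightarrow> 'a \<Rightarrow> 'a \<Rightarrow> 'a) \<Rightarrow> 'a set \<Rightarrow> bool" where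
  "median_convex M \<mu> h \<longleftrightarrow> (\<forall>a\<in>h. \<forall>b\<in>h. median_interval M \<mu> a b \<subseteq> h)"

definition walls :: "'a set \<Rightarrow> ('a \<Rightarrow> 'a \<Rightarrow> 'a \<Rightarrow> 'a) \<Rightarrow> 'a set set set" where
  "walls M \<mu> = {{h, M - h} | h. h \<subseteq> M \<and> h \<noteq> {} \<and> M - h \<noteq> {} \<and>
                  median_convex M \<mu> h \<and> median_convex M \<mu> (M - h)}"

definition separates :: "'a set set \<Rightarrow> 'a \<Rightarrow> 'a \<Rightarrow> bool" where
  "separates W a b \<longleftrightarrow> (\<exists>h\<in>W. a \<in> h \<and> b \<notin> h)"

definition separating_walls :: "'a set \<Rightarrow> ('a \<Rightarrow> 'a \<Rightarrow> 'a \<Rightarrow> 'a) \<Rightarrow> 'a \<Rightarrow> 'a \<Rightarrow> 'a set set set" where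
  "separating_walls M \<mu> a b = {W \<in> walls M \<mu>. separates W a b}"

text \<open>Edges of the cube complex C(M): exactly one wall of M separates the endpoints.\<close>
definition cc_edge :: "'a set \<Rightarrow> ('a \<Rightarrow> 'a \<Rightarrow> 'a \<Rightarrow> 'a) \<Rightarrow> 'a \<Rightarrow> 'a \<Rightarrow> bool" where
  "cc_edge M \<mu> a b \<longleftrightarrow> a \<in> M \<and> b \<in> M \<and> card (separating_walls M \<mu> a b) = 1"

text \<open>C(M) contains a k-cube: an injective map from the vertices of the standard k-cube
  (subsets of {..<k}) into M whose adjacency is exactly the edge relation of C(M).\<close>
definition has_cube :: "'a set \<Rightarrow> ('a \<Rightarrow> 'a \<Rightarrow> 'a \<Rightarrow> 'a) \<Rightarrow> nat \<Rightarrow> bool" where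
  "has_cube M \<mu> k \<longleftrightarrow> (\<exists>f. inj_on f (Pow {..<k}) \<and> f ` Pow {..<k} \<subseteq> M \<and>
      (\<forall>S\<in>Pow {..<k}. \<forall>T\<in>Pow {..<k}.
          cc_edge M \<mu> (f S) (f T) \<longleftrightarrow> card (S - T \<union> (T - S)) = 1))"

definition finite_rank_of :: "'a set \<Rightarrow> ('a \<Rightarrow> 'a \<Rightarrow> 'a \<Rightarrow> 'a) \<Rightarrow> nat" where
  "finite_rank_of M \<mu> = Max {k. has_cube M \<mu> k}"

definition median_rank :: "'a set \<Rightarrow> ('a \<Rightarrow> 'a \<Rightarrow> 'a \<Rightarrow> 'a) \<Rightarrow> enat" where
  "median_rank X \<mu> = (SUP M\<in>finite_subalgebras X \<mu>. enat (finite_rank_of M \<mu>))"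

definition lambda_max :: "'a::metric_space set \<Rightarrow> ('a \<Rightarrow> 'a \<Rightarrow> 'a \<Rightarrow> 'a) \<Rightarrow> 'a set set \<Rightarrow> real" where
  "lambda_max M \<mu> W = Max {dist a b | a b. cc_edge M \<mu> a b \<and> separates W a b}"

definition d_mu_M :: "'a::metric_space set \<Rightarrow> ('a \<Rightarrow> 'a \<Rightarrow> 'a \<Rightarrow> 'a) \<Rightarrow> 'a \<Rightarrow> 'a \<Rightarrow> real" where
  "d_mu_M M \<mu> x y = (if x \<in> M \<and> y \<in> M
      then (\<Sum>W\<in>separating_walls M \<mu> x y. lambda_max M \<mu> W) else 0)"

definition d_mu :: "'a::metric_space set \<Rightarrow> ('a \<Rightarrow> 'a \<Rightarrow> 'a \<Rightarrow> 'a) \<Rightarrow> 'a \<Rightarrow> 'a \<Rightarrow> ereal" where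
  "d_mu X \<mu> x y = (SUP M\<in>finite_subalgebras X \<mu>. ereal (d_mu_M M \<mu> x y))"

definition uniformly_rectifiable :: "'a::metric_space set \<Rightarrow> ('a \<Rightarrow> 'a \<Rightarrow> 'a \<Rightarrow> 'a) \<Rightarrow> bool" where
  "uniformly_rectifiable X \<mu> \<longleftrightarrow>
     (\<exists>L\<ge>0. \<forall>x\<in>X. \<forall>y\<in>X. d_mu X \<mu> x y \<le> ereal (L * dist x y))"

definition isometric_automorphism :: "'a::metric_space set \<Rightarrow> ('a \<Rightarrow> 'a \<Rightarrow> 'a \<Rightarrow> 'a) \<Rightarrow> ('a \<Rightarrow> 'a) \<Rightarrow> bool" where
  "isometric_automorphism X \<mu> f \<longleftrightarrow> bij_betw f X X \<and>
     (\<forall>x\<in>X. \<forall>y\<in>X. dist (f x) (f y) = dist x y) \<and>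
     (\<forall>x\<in>X. \<forall>y\<in>X. \<forall>z\<in>X. f (\<mu> x y z) = \<mu> (f x) (f y) (f z))"

record 'v chilbert =
  hcarrier :: "'v set"
  hzero :: 'v
  hadd :: "'v \<Rightarrow> 'v \<Rightarrow> 'v"
  hscale :: "complex \<Rightarrow> 'v \<Rightarrow> 'v"
  hinner :: "'v \<Rightarrow> 'v \<Rightarrow> complex"

definition hnorm :: "('v, 'm) chilbert_scheme \<Rightarrow> 'v \<Rightarrow> real" where
  "hnorm V v = sqrt (Re (hinner V v v))"

definition hdiff :: "('v, 'm) chilbert_scheme \<Rightarrow> 'v \<Rightarrow> 'v \<Rightarrow> 'v" where
  "hdiff V u v = hadd V u (hscale V (-1) v)"

definition complex_hilbert_space :: "('v, 'm) chilbert_scheme \<Rightarrow> bool" where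
  "complex_hilbert_space V \<longleftrightarrow>
    (let C = hcarrier V; z = hzero V; add = hadd V; sc = hscale V; ip = hinner V in
     z \<in> C \<and>
     (\<forall>u\<in>C. \<forall>v\<in>C. add u v \<in> C) \<and> (\<forall>a. \<forall>v\<in>C. sc a v \<in> C) \<and>
     (\<forall>u\<in>C. \<forall>v\<in>C. \<forall>w\<in>C. add (add u v) w = add u (add v w)) \<and>
     (\<forall>u\<in>C. \<forall>v\<in>C. add u v = add v u) \<and>
     (\<forall>v\<in>C. add z v = v) \<and>
     (\<forall>v\<in>C. add v (sc (-1) v) = z) \<and>
     (\<forall>v\<in>C. sc 1 v = v) \<and>
     (\<forall>a b. \<forall>v\<in>C. sc a (sc b v) = sc (a * b) v) \<and>
     (\<forall>a b. \<forall>v\<in>C. sc (a + b) v = add (sc a v) (sc b v)) \<and>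
     (\<forall>a. \<forall>u\<in>C. \<forall>v\<in>C. sc a (add u v) = add (sc a u) (sc a v)) \<and>
     (\<forall>u\<in>C. \<forall>v\<in>C. ip u v = cnj (ip v u)) \<and>
     (\<forall>u\<in>C. \<forall>v\<in>C. \<forall>w\<in>C. ip (add u v) w = ip u w + ip v w) \<and>
     (\<forall>a. \<forall>u\<in>C. \<forall>v\<in>C. ip (sc a u) v = a * ip u v) \<and>
     (\<forall>v\<in>C. Re (ip v v) \<ge> 0 \<and> (ip v v = 0 \<longrightarrow> v = z)) \<and>
     (\<forall>s::nat \<Rightarrow> 'v. (\<forall>n. s n \<in> C) \<longrightarrow>
        (\<forall>\<epsilon>>0. \<exists>N. \<forall>m\<ge>N. \<forall>n\<ge>N. hnorm V (hdiff V (s m) (s n)) < \<epsilon>) \<longrightarrow>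
        (\<exists>v\<in>C. \<forall>\<epsilon>>0. \<exists>N. \<forall>n\<ge>N. hnorm V (hdiff V (s n) v) < \<epsilon>)))"

definition unitary_rep :: "('g, 'b) monoid_scheme \<Rightarrow> ('v, 'm) chilbert_scheme \<Rightarrow> ('g \<Rightarrow> 'v \<Rightarrow> 'v) \<Rightarrow> bool" where
  "unitary_rep G V \<pi> \<longleftrightarrow>
     (\<forall>g\<in>carrier G. bij_betw (\<pi> g) (hcarrier V) (hcarrier V) \<and>
        (\<forall>u\<in>hcarrier V. \<forall>v\<in>hcarrier V. hinner V (\<pi> g u) (\<pi> g v) = hinner V u v) \<and>
        (\<forall>u\<in>hcarrier V. \<forall>v\<in>hcarrier V. \<pi> g (hadd V u v) = hadd V (\<pi> g u) (\<pi> g v)) \<and>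
        (\<forall>a. \<forall>u\<in>hcarrier V. \<pi> g (hscale V a u) = hscale V a (\<pi> g u))) \<and>
     (\<forall>g\<in>carrier G. \<forall>h\<in>carrier G. \<forall>v\<in>hcarrier V. \<pi> (g \<otimes>\<^bsub>G\<^esub> h) v = \<pi> g (\<pi> h v)) \<and>
     (\<forall>v\<in>hcarrier V. \<pi> \<one>\<^bsub>G\<^esub> v = v)"

definition almost_invariant_vectors :: "('g, 'b) monoid_scheme \<Rightarrow> ('v, 'm) chilbert_scheme \<Rightarrow> ('g \<Rightarrow> 'v \<Rightarrow> 'v) \<Rightarrow> bool" where
  "almost_invariant_vectors G V \<pi> \<longleftrightarrow>
     (\<forall>Q. Q \<subseteq> carrier G \<and> finite Q \<longrightarrow> (\<forall>\<epsilon>>0. \<exists>v\<in>hcarrier V. hnorm V v = 1 \<and>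
        (\<forall>g\<in>Q. hnorm V (hdiff V (\<pi> g v) v) < \<epsilon>)))"

text \<open>Kazhdan's property (T) for a (discrete) group G: every unitary representation with
  almost invariant vectors has a nonzero invariant vector.  Hilbert spaces are modelled
  inside the fixed carrier type ('g * nat => complex), which is large enough to contain an
  isomorphic copy of every Hilbert space of Hilbert dimension at most |G| * aleph_0; this
  suffices since any representation with almost invariant vectors contains a
  subrepresentation of that dimension with almost invariant vectors.\<close>
definition kazhdan_T :: "('g, 'b) monoid_scheme \<Rightarrow> bool" where
  "kazhdan_T G \<longleftrightarrow> (\<forall>(V :: ('g \<times> nat \<Rightarrow> complex) chilbert) \<pi>.
     complex_hilbert_space V \<and> unitary_rep G V \<pi> \<and> almost_invariant_vectors G V \<pi> \<longrightarrow>
     (\<exists>v\<in>hcarrier V. v \<noteq> hzero V \<and> (\<forall>g\<in>carrier G. \<pi> g v = v)))"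

end

theory Submission
  imports Defs
begin

text \<open>
  The supremum \<open>\<rho>\<close> of the metrics \<open>d\<^sub>\<mu>\<^sup>M\<close> is an invariant median metric that is
  bi-Lipschitz to \<open>d\<close>. As \<open>d\<^sub>\<mu>\<^sup>M\<close> is a weighted sum of wall cuts, \<open>exp (- t \<rho>)\<close> is
  positive definite for \<open>t \<ge> 0\<close>, and property (T) forces the orbits to be bounded.

  Let \<open>near D x y\<close> mean that \<open>f y - f x \<le> D\<close> for all 1-Lipschitz maps \<open>f : X \<rightarrow> \<real>\<close> that
  preserve intervals. The balls of this relation are closed and convex, and by connectedness balls of
  radius \<open>D/2\<close> around points with \<open>near D x y\<close> meet. If \<open>A\<close> is closed, convex,
  invariant and of diameter \<open>D\<close> in this sense, then so is, with diameter \<open>D/2\<close>, the set of points of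
  \<open>A\<close> at distance at most \<open>D/2\<close> from all points of \<open>A\<close>, which is nonempty by Helly's theorem for
  convex sets. Iterating from a bounded orbit leads to a fixed point, because in rank \<open>r\<close> the relation
  controls \<open>\<rho>\<close>: pairwise transverse walls span a cube, so that a weighted version of Mirsky's
  theorem finds in every finite subalgebra a chain of halfspaces that carries at least the fraction
  \<open>1/r\<close> of the distance of two given points, and compactness extends the resulting map to \<open>X\<close>.
\<close>

section \<open>Median algebras\<close>

text \<open>The metric \<open>d\<close> need not be additive along median intervals, whereas gates
  and the gluing of functions rest on additivity; hence the passage to \<rho>. For \<rho> a bounded
  orbit still has no evident centre: it behaves like an l^1 metric, whose balls are not convex, so
  Helly's theorem cannot be applied to them. The relation \<open>near\<close> is its l^infinity
  companion, with balls that are intersections of halfspaces. The price is the comparison with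
  \<rho>, up to a factor 2 r: r is the loss in the passage to a chain, and 2 pays for a supremum
  that no finite subalgebra need attain.

  Property (T) is stated for Hilbert spaces whose vectors are functions on G \<times> nat. A
  reproducing kernel space consists of functions from the outset, so its completion needs neither a
  quotient nor a new type. The second factor nat collects the kernels for t = 1/(n + 1) in one
  space: for a single t the unit vectors at hand are moved by a fixed amount, and only t
  \<rightarrow> 0 makes them almost invariant.\<close>

locale median =
  fixes X :: "'a set" and \<mu> :: "'a \<Rightarrow> 'a \<Rightarrow> 'a \<Rightarrow> 'a"
  assumes median_algebra: "median_algebra X \<mu>"
begin

lemma closed [simp]: "\<lbrakk>x \<in> X; y \<in> X; z \<in> X\<rbrakk> \<Longrightarrow> \<mu> x y z \<in> X"
  using median_algebra unfolding median_algebra_def by blast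

lemma commute_right: "\<lbrakk>x \<in> X; y \<in> X; z \<in> X\<rbrakk> \<Longrightarrow> \<mu> x y z = \<mu> x z y"
  and rotate: "\<lbrakk>x \<in> X; y \<in> X; z \<in> X\<rbrakk> \<Longrightarrow> \<mu> x y z = \<mu> y z x"
  using median_algebra unfolding median_algebra_def by blast+

lemma commute_left: "\<lbrakk>x \<in> X; y \<in> X; z \<in> X\<rbrakk> \<Longrightarrow> \<mu> x y z = \<mu> y x z"
  by (metis commute_right rotate)

lemma idem [simp]:
  assumes "x \<in> X" "y \<in> X"
  shows "\<mu> x x y = x" "\<mu> x y x = x" "\<mu> y x x = x"
proof -
  show *: "\<mu> x x y = x" using median_algebra assms unfolding median_algebra_def by blast
  then show "\<mu> x y x = x" using commute_right assms by metis
  show "\<mu> y x x = x" using * rotate assms by metis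
qed

lemma distrib:
  "\<lbrakk>x \<in> X; y \<in> X; z \<in> X; u \<in> X; v \<in> X\<rbrakk> \<Longrightarrow> \<mu> (\<mu> x y z) u v = \<mu> x (\<mu> y u v) (\<mu> z u v)"
  using median_algebra unfolding median_algebra_def by blast

lemma absorb:
  assumes "a \<in> X" "b \<in> X" "c \<in> X"
  shows "\<mu> a b (\<mu> a b c) = \<mu> a b c"
proof -
  have "\<mu> a b (\<mu> a b c) = \<mu> (\<mu> c a b) a b"
    using assms by (metis closed rotate)
  also have "\<dots> = \<mu> c (\<mu> a a b) (\<mu> b a b)" by (rule distrib) (use assms in auto)
  also have "\<dots> = \<mu> a b c" using assms by (metis idem rotate)
  finally show ?thesis .
qed

text \<open>By \<open>distrib\<close> and symmetry, \<open>\<mu> a b\<close> can be moved into any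
  two of the three arguments. Since it is idempotent by \<open>absorb\<close>, it may be applied
  twice, first to one pair and then to another, which reaches all three. So the projection to an
  interval is a median morphism.\<close>

lemma hom:
  assumes "x \<in> X" "y \<in> X" "z \<in> X" "a \<in> X" "b \<in> X"
  shows "\<mu> a b (\<mu> x y z) = \<mu> (\<mu> a b x) (\<mu> a b y) (\<mu> a b z)"
proof -
  have d: "\<mu> a b (\<mu> u v w) = \<mu> u (\<mu> a b v) (\<mu> a b w)" if "u \<in> X" "v \<in> X" "w \<in> X" for u v w
    using distrib[of u v w a b] that assms by (metis closed rotate)
  have 1: "\<mu> a b (\<mu> x y z) = \<mu> (\<mu> a b y) x (\<mu> a b z)"
    using d[of x y z] commute_left[of x "\<mu> a b y" "\<mu> a b z"] by (simp add: assms)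
  have "\<mu> a b (\<mu> x y z) = \<mu> a b (\<mu> a b (\<mu> x y z))" by (simp add: absorb assms)
  also have "\<dots> = \<mu> a b (\<mu> (\<mu> a b y) x (\<mu> a b z))" by (simp only: 1)
  also have "\<dots> = \<mu> (\<mu> a b y) (\<mu> a b x) (\<mu> a b (\<mu> a b z))"
    by (rule d) (simp_all add: assms)
  also have "\<dots> = \<mu> (\<mu> a b y) (\<mu> a b x) (\<mu> a b z)" by (simp add: absorb assms)
  also have "\<dots> = \<mu> (\<mu> a b x) (\<mu> a b y) (\<mu> a b z)"
    by (rule commute_left) (simp_all add: assms)
  finally show ?thesis .
qed

text \<open>Every \<open>\<mu> a b c\<close> lies in the interval of \<open>a\<close> and
  \<open>b\<close> by \<open>absorb\<close>, so convexity becomes a closure property under medians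
  with one free argument.\<close>

lemma convex_iff:
  "h \<subseteq> X \<Longrightarrow> median_convex X \<mu> h \<longleftrightarrow> (\<forall>a\<in>h. \<forall>b\<in>h. \<forall>c\<in>X. \<mu> a b c \<in> h)"
proof (intro iffI ballI)
  fix a b c assume "h \<subseteq> X" "median_convex X \<mu> h" "a \<in> h" "b \<in> h" "c \<in> X"
  moreover from this have "\<mu> a b c \<in> median_interval X \<mu> a b"
    unfolding median_interval_def by (simp add: absorb subset_iff)
  ultimately show "\<mu> a b c \<in> h" unfolding median_convex_def by blast
next
  assume *: "h \<subseteq> X" "\<forall>a\<in>h. \<forall>b\<in>h. \<forall>c\<in>X. \<mu> a b c \<in> h"
  have "c \<in> h" if "a \<in> h" "b \<in> h" "c \<in> X" "\<mu> a b c = c" for a b c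
    using *(2) that by metis
  then show "median_convex X \<mu> h" unfolding median_convex_def median_interval_def by blast
qed

lemma convexD:
  "\<lbrakk>median_convex X \<mu> h; h \<subseteq> X; a \<in> h; b \<in> h; c \<in> X\<rbrakk> \<Longrightarrow> \<mu> a b c \<in> h"
  "\<lbrakk>median_convex X \<mu> h; h \<subseteq> X; a \<in> h; b \<in> h; c \<in> X\<rbrakk> \<Longrightarrow> \<mu> a c b \<in> h"
  "\<lbrakk>median_convex X \<mu> h; h \<subseteq> X; a \<in> h; b \<in> h; c \<in> X\<rbrakk> \<Longrightarrow> \<mu> c a b \<in> h"
proof -
  assume *: "median_convex X \<mu> h" "h \<subseteq> X" "a \<in> h" "b \<in> h" "c \<in> X"
  then have X: "a \<in> X" "b \<in> X" by auto
  show 1: "\<mu> a b c \<in> h" using * convex_iff[of h] by simp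
  show "\<mu> a c b \<in> h" by (subst commute_right[OF X(1) *(5) X(2)]) (rule 1)
  show "\<mu> c a b \<in> h" by (subst rotate[OF *(5) X]) (rule 1)
qed

lemma convex_Inter:
  "\<lbrakk>\<And>C. C \<in> \<C> \<Longrightarrow> median_convex X \<mu> C\<rbrakk> \<Longrightarrow> median_convex X \<mu> (\<Inter>\<C>)"
  unfolding median_convex_def by blast

lemma convex_Int:
  "\<lbrakk>median_convex X \<mu> A; median_convex X \<mu> B\<rbrakk> \<Longrightarrow> median_convex X \<mu> (A \<inter> B)"
  unfolding median_convex_def by blast

text \<open>Pick a point in each pairwise intersection. Each of the three sets contains two of these
  points, hence their median.\<close>

lemma Helly_three:
  assumes "median_convex X \<mu> A" "median_convex X \<mu> B" "median_convex X \<mu> C"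
    and "A \<subseteq> X" "B \<subseteq> X" "C \<subseteq> X"
    and "A \<inter> B \<noteq> {}" "B \<inter> C \<noteq> {}" "A \<inter> C \<noteq> {}"
  shows "A \<inter> B \<inter> C \<noteq> {}"
proof -
  obtain a b c where "a \<in> A \<inter> B" "b \<in> B \<inter> C" "c \<in> A \<inter> C" using assms by blast
  then have "\<mu> a b c \<in> A \<inter> B \<inter> C" using assms convexD by (meson IntD1 IntD2 IntI subsetD)
  then show ?thesis by blast
qed

lemma Helly_finite:
  assumes "finite \<C>" "\<C> \<noteq> {}"
    and "\<And>C. C \<in> \<C> \<Longrightarrow> median_convex X \<mu> C" "\<And>C. C \<in> \<C> \<Longrightarrow> C \<subseteq> X"
    and "\<And>C D. C \<in> \<C> \<Longrightarrow> D \<in> \<C> \<Longrightarrow> C \<inter> D \<noteq> {}"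
  shows "\<Inter>\<C> \<noteq> {}"
proof -
  \<comment> \<open>The induction is on an upper bound of the cardinality, because intersecting
    every member with \<open>A\<close> may identify some of them. Taking C = D in the last
    hypothesis says that the members are nonempty.\<close>
  have "\<Inter>\<C> \<noteq> {}"
    if "finite \<C>" "\<C> \<noteq> {}" "card \<C> \<le> n" "\<And>C. C \<in> \<C> \<Longrightarrow> median_convex X \<mu> C" "\<And>C. C \<in> \<C> \<Longrightarrow> C \<subseteq> X"
      "\<And>C D. C \<in> \<C> \<Longrightarrow> D \<in> \<C> \<Longrightarrow> C \<inter> D \<noteq> {}" for n \<C>
    using that
  proof (induction n arbitrary: \<C>)
    case 0
    then show ?case by simp
  next
    case (Suc n)
    obtain A where A: "A \<in> \<C>" using Suc.prems by blast
    define \<D> where "\<D> = \<C> - {A}"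
    have \<C>: "\<C> = insert A \<D>" using A \<D>_def by blast
    have card: "card \<D> \<le> n" "finite \<D>" using Suc.prems A by (auto simp: \<D>_def)
    show ?case
    proof (cases "\<D> = {}")
      case True
      then show ?thesis using Suc.prems(6)[of A A] \<C> by auto
    next
      case False
      define \<E> where "\<E> = (\<lambda>C. C \<inter> A) ` \<D>"
      have ne: "C \<inter> A \<inter> (D \<inter> A) \<noteq> {}" if "C \<in> \<D>" "D \<in> \<D>" for C D
      proof -
        have "A \<inter> C \<inter> D \<noteq> {}"
          by (rule Helly_three) (use Suc.prems(4-6) \<C> that in auto)
        then show ?thesis by blast
      qed
      have "\<Inter>\<E> \<noteq> {}"
      proof (rule Suc.IH)
        show "card \<E> \<le> n" using card card_image_le[of \<D>] \<E>_def le_trans by metis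
        show "median_convex X \<mu> C" if "C \<in> \<E>" for C
          using that Suc.prems(4) \<C> convex_Int by (auto simp: \<E>_def)
        show "C \<subseteq> X" if "C \<in> \<E>" for C using that Suc.prems(5) \<C> by (auto simp: \<E>_def)
        show "C \<inter> D \<noteq> {}" if "C \<in> \<E>" "D \<in> \<E>" for C D using that ne by (auto simp: \<E>_def)
      qed (use False card in \<open>auto simp: \<E>_def\<close>)
      then show ?thesis using False by (auto simp: \<E>_def \<C>)
    qed
  qed
  then show ?thesis using assms by blast
qed

end

section \<open>Complete connected median metrics\<close>

text \<open>\<rho> is kept abstract: the fixed point argument uses only additivity on intervals and
  the comparison with \<open>dist\<close>. Limits, closedness and completeness refer to
  \<open>dist\<close>.\<close>

locale complete_median = median X \<mu>
  for X :: "'a::metric_space set" and \<mu> +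
  fixes \<rho> :: "'a \<Rightarrow> 'a \<Rightarrow> real" and L :: real
  assumes sym: "\<lbrakk>x \<in> X; y \<in> X\<rbrakk> \<Longrightarrow> \<rho> x y = \<rho> y x"
    and triangle: "\<lbrakk>x \<in> X; y \<in> X; z \<in> X\<rbrakk> \<Longrightarrow> \<rho> x z \<le> \<rho> x y + \<rho> y z"
    and dist_le: "\<lbrakk>x \<in> X; y \<in> X\<rbrakk> \<Longrightarrow> dist x y \<le> \<rho> x y"
    and le_dist: "\<lbrakk>x \<in> X; y \<in> X\<rbrakk> \<Longrightarrow> \<rho> x y \<le> L * dist x y"
    and between: "\<lbrakk>x \<in> X; y \<in> X; z \<in> X; \<mu> x y z = z\<rbrakk> \<Longrightarrow> \<rho> x y = \<rho> x z + \<rho> z y"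
    and complete: "complete X"
    and connected: "connected X"
    and continuous: "continuous_on (X \<times> X \<times> X) (\<lambda>(x, y, z). \<mu> x y z)"
begin

lemma nonneg: "\<lbrakk>x \<in> X; y \<in> X\<rbrakk> \<Longrightarrow> 0 \<le> \<rho> x y"
  using dist_le[of x y] zero_le_dist[of x y] by linarith

lemma eq_0: "\<lbrakk>x \<in> X; y \<in> X; \<rho> x y \<le> 0\<rbrakk> \<Longrightarrow> x = y"
  using dist_le[of x y] zero_le_dist[of x y] by (metis dist_eq_0_iff order_antisym order_trans)

lemma refl [simp]: "x \<in> X \<Longrightarrow> \<rho> x x = 0"
  using le_dist[of x x] nonneg[of x x] by simp

lemma interval_connected:
  assumes "a \<in> X" "b \<in> X"
  shows "connected (\<mu> a b ` X)"
proof -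
  have "continuous_on X ((\<lambda>(x, y, z). \<mu> x y z) \<circ> (\<lambda>z. (a, b, z)))"
    by (intro continuous_on_compose continuous_intros continuous_on_subset[OF continuous])
      (use assms in auto)
  then have "continuous_on X (\<mu> a b)" by (simp add: o_def)
  then show ?thesis using connected connected_continuous_image by blast
qed

section \<open>Gates: nearest points of closed convex sets\<close>

lemma tendsto_metric:
  assumes "a \<in> X" "p \<in> X" "\<And>n. y n \<in> X" "y \<longlonglongrightarrow> p"
  shows "(\<lambda>n. \<rho> a (y n)) \<longlonglongrightarrow> \<rho> a p"
proof (rule Lim_null_comparison[where g = "\<lambda>n. L * dist (y n) p", THEN LIM_zero_cancel])
  have "\<bar>\<rho> a (y n) - \<rho> a p\<bar> \<le> L * dist (y n) p" for n
    using triangle[of a "y n" p] triangle[of a p "y n"] sym[of "y n" p] le_dist[of "y n" p] assms(1-3)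
    by (auto simp: abs_le_iff)
  then show "\<forall>\<^sub>F n in sequentially. norm (\<rho> a (y n) - \<rho> a p) \<le> L * dist (y n) p" by simp
  show "(\<lambda>n. L * dist (y n) p) \<longlonglongrightarrow> 0"
    by (rule tendsto_mult_right_zero[OF iffD1[OF tendsto_dist_iff assms(4)]])
qed

lemma Cauchy_limit:
  assumes "\<And>n. y n \<in> X" "\<And>m n. \<rho> (y m) (y n) \<le> 1 / real (Suc m) + 1 / real (Suc n)"
  obtains p where "p \<in> X" "y \<longlonglongrightarrow> p"
proof -
  have "Cauchy y"
  proof (rule metric_CauchyI)
    fix e :: real assume "e > 0"
    then obtain N where N: "1 / real (Suc N) < e / 2" using nat_approx_posE[of "e/2"] by auto
    have "dist (y m) (y n) < e" if "m \<ge> N" "n \<ge> N" for m n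
    proof -
      have "1 / real (Suc k) \<le> 1 / real (Suc N)" if "k \<ge> N" for k
        using that by (simp add: frac_le)
      from this[OF that(1)] this[OF that(2)] show ?thesis
        using N dist_le[of "y m" "y n"] assms(1)[of m] assms(1)[of n] assms(2)[of m n] by linarith
    qed
    then show "\<exists>M. \<forall>m\<ge>M. \<forall>n\<ge>M. dist (y m) (y n) < e" by blast
  qed
  then show ?thesis using complete assms(1) that unfolding complete_def by blast
qed

text \<open>For two almost nearest points of \<open>C\<close>, the median with \<open>x\<close> lies
  in \<open>C\<close> and between \<open>x\<close> and each of them. Additivity bounds their
  distance by the sum of their excesses over the infimum, so a minimising sequence is Cauchy. For
  its limit \<open>p\<close> and any \<open>z\<close> in \<open>C\<close>, the point
  \<open>\<mu> x z p\<close> of \<open>C\<close> lies between \<open>x\<close> and \<open>p\<close>,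
  and minimality forces it to be \<open>p\<close>.\<close>

lemma gate_exists:
  assumes "closed C" "C \<subseteq> X" "median_convex X \<mu> C" "C \<noteq> {}" "x \<in> X"
  shows "\<exists>p\<in>C. \<forall>y\<in>C. \<mu> x y p = p"
proof -
  define s where "s = Inf (\<rho> x ` C)"
  have bdd: "bdd_below (\<rho> x ` C)" using nonneg assms by (intro bdd_belowI[of _ 0]) auto
  have s: "s \<le> \<rho> x y" if "y \<in> C" for y unfolding s_def using bdd that by (intro cInf_lower) auto
  have "\<exists>y\<in>C. \<rho> x y < s + 1 / real (Suc n)" for n
    using cInf_lessD[of "\<rho> x ` C" "s + 1 / real (Suc n)"] assms s_def by auto
  then obtain y where y: "\<And>n. y n \<in> C" "\<And>n. \<rho> x (y n) < s + 1 / real (Suc n)" by metis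
  have yX: "y n \<in> X" for n using y assms by auto
  have "\<rho> (y i) (y j) \<le> 1 / real (Suc i) + 1 / real (Suc j)" for i j
  proof -
    define m where "m = \<mu> x (y i) (y j)"
    have mC: "m \<in> C" unfolding m_def
      using convexD(3)[OF assms(3,2) y(1) y(1) assms(5)] .
    then have mX: "m \<in> X" using assms by auto
    have 1: "\<mu> x (y i) m = m" unfolding m_def by (simp add: absorb assms(5) yX)
    have "m = \<mu> x (y j) (y i)" unfolding m_def by (rule commute_right) (simp_all add: yX assms)
    then have 2: "\<mu> x (y j) m = m" by (simp add: absorb assms(5) yX)
    have "\<rho> x (y i) = \<rho> x m + \<rho> m (y i)" "\<rho> x (y j) = \<rho> x m + \<rho> m (y j)"
      using between[OF assms(5) yX mX 1] between[OF assms(5) yX mX 2] .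
    moreover have "\<rho> (y i) (y j) \<le> \<rho> m (y i) + \<rho> m (y j)"
      using triangle[of "y i" m "y j"] sym[of m "y i"] mX yX by simp
    ultimately show ?thesis using y(2)[of i] y(2)[of j] s[OF mC] by linarith
  qed
  then obtain p where p: "p \<in> X" "y \<longlonglongrightarrow> p" using Cauchy_limit yX by blast
  have pC: "p \<in> C" using assms(1) p(2) y(1) closed_sequentially by blast
  have "(\<lambda>n. \<rho> x (y n)) \<longlonglongrightarrow> \<rho> x p" using tendsto_metric[OF assms(5) p(1) yX p(2)] .
  moreover have "(\<lambda>n. s + 1 / real (Suc n)) \<longlonglongrightarrow> s + 0"
    using LIMSEQ_inverse_real_of_nat by (intro tendsto_intros) (simp add: inverse_eq_divide)
  ultimately have ps: "\<rho> x p \<le> s" using LIMSEQ_le[of "\<lambda>n. \<rho> x (y n)" _ "\<lambda>n. s + 1 / real (Suc n)"] y(2)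
    by (simp add: less_imp_le)
  show ?thesis
  proof (intro bexI ballI)
    fix z assume z: "z \<in> C"
    then have zX: "z \<in> X" using assms by auto
    define m where "m = \<mu> x z p"
    have mC: "m \<in> C" unfolding m_def using convexD(3)[OF assms(3,2) z pC assms(5)] .
    then have mX: "m \<in> X" using assms by auto
    have "m = \<mu> x p z" unfolding m_def by (rule commute_right) (simp_all add: p zX assms)
    then have "\<mu> x p m = m" by (simp add: absorb assms(5) p zX)
    then have "\<rho> x p = \<rho> x m + \<rho> m p" by (rule between[OF assms(5) p(1) mX])
    then have "m = p" using eq_0[OF mX p(1)] s[OF mC] ps by linarith
    then show "\<mu> x z p = p" by (simp add: m_def)
  qed (rule pC)
qed

definition gate :: "'a \<Rightarrow> 'a set \<Rightarrow> 'a" where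
  "gate x C = (SOME p. p \<in> C \<and> (\<forall>y\<in>C. \<mu> x y p = p))"

lemma gate:
  assumes "closed C" "C \<subseteq> X" "median_convex X \<mu> C" "C \<noteq> {}" "x \<in> X"
  shows "gate x C \<in> C" and "y \<in> C \<Longrightarrow> \<mu> x y (gate x C) = gate x C"
    and "y \<in> C \<Longrightarrow> \<rho> x y = \<rho> x (gate x C) + \<rho> (gate x C) y"
proof -
  have *: "gate x C \<in> C \<and> (\<forall>y\<in>C. \<mu> x y (gate x C) = gate x C)"
    unfolding gate_def by (rule someI_ex) (use gate_exists[OF assms] in blast)
  then show "gate x C \<in> C" and "y \<in> C \<Longrightarrow> \<mu> x y (gate x C) = gate x C" by auto
  with * assms show "y \<in> C \<Longrightarrow> \<rho> x y = \<rho> x (gate x C) + \<rho> (gate x C) y"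
    by (intro between) auto
qed

section \<open>Helly's theorem for infinite families\<close>

lemma directed_Inter_nonempty:
  assumes ne: "\<G> \<noteq> {}"
    and cl: "\<And>C. C \<in> \<G> \<Longrightarrow> closed C" and sub: "\<And>C. C \<in> \<G> \<Longrightarrow> C \<subseteq> X"
    and conv: "\<And>C. C \<in> \<G> \<Longrightarrow> median_convex X \<mu> C"
    and dir: "\<And>C D. C \<in> \<G> \<Longrightarrow> D \<in> \<G> \<Longrightarrow> C \<inter> D \<in> \<G>"
    and x: "x \<in> X" and bd: "\<And>C. C \<in> \<G> \<Longrightarrow> \<exists>c\<in>C. \<rho> x c \<le> R"
  shows "\<Inter>\<G> \<noteq> {}"
proof -
  define p where "p C = gate x C" for C
  have g: "p C \<in> C" "\<And>y. y \<in> C \<Longrightarrow> \<rho> x y = \<rho> x (p C) + \<rho> (p C) y" if "C \<in> \<G>" for C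
    unfolding p_def using gate[OF cl[OF that] sub[OF that] conv[OF that] _ x] bd[OF that] by auto
  have pX: "p C \<in> X" if "C \<in> \<G>" for C using g(1) sub that by blast
  \<comment> \<open>Completeness replaces compactness: passing to a smaller set moves the gate of
    \<open>x\<close> away from \<open>x\<close>, and \<open>R\<close> bounds how far. Near the
    supremum \<open>s\<close> of these distances the gates can hardly move any more.\<close>
  define s where "s = Sup ((\<lambda>C. \<rho> x (p C)) ` \<G>)"
  have bdd: "bdd_above ((\<lambda>C. \<rho> x (p C)) ` \<G>)"
  proof (intro bdd_aboveI2)
    fix C assume C: "C \<in> \<G>"
    then obtain c where "c \<in> C" "\<rho> x c \<le> R" using bd by blast
    then show "\<rho> x (p C) \<le> R" using g(2)[OF C, of c] nonneg[OF pX[OF C], of c] sub[OF C] by auto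
  qed
  have s: "\<rho> x (p C) \<le> s" if "C \<in> \<G>" for C unfolding s_def using bdd that by (intro cSup_upper) auto
  have "\<exists>C\<in>\<G>. s - 1 / real (Suc n) < \<rho> x (p C)" for n
    using less_cSupD[of "(\<lambda>C. \<rho> x (p C)) ` \<G>" "s - 1 / real (Suc n)"] ne s_def by auto
  then obtain C where C: "\<And>n. C n \<in> \<G>" "\<And>n. s - 1 / real (Suc n) < \<rho> x (p (C n))" by metis
  have near: "\<rho> (p (C n)) (p (C n \<inter> A)) \<le> 1 / real (Suc n)" if "A \<in> \<G>" for n A
  proof -
    have E: "C n \<inter> A \<in> \<G>" using dir C that by auto
    have "p (C n \<inter> A) \<in> C n" using g(1)[OF E] by auto
    then show ?thesis using g(2)[OF C(1)[of n], of "p (C n \<inter> A)"] s[OF E] C(2)[of n] by linarith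
  qed
  have "\<rho> (p (C i)) (p (C j)) \<le> 1 / real (Suc i) + 1 / real (Suc j)" for i j
  proof -
    have "p (C i \<inter> C j) \<in> X" using pX dir C by blast
    then have "\<rho> (p (C i)) (p (C j)) \<le> \<rho> (p (C i)) (p (C i \<inter> C j)) + \<rho> (p (C j)) (p (C j \<inter> C i))"
      using triangle[OF pX[OF C(1)[of i]] _ pX[OF C(1)[of j]]] sym[OF pX[OF C(1)[of j]]]
      by (simp add: Int_commute)
    then show ?thesis using near[OF C(1)[of j], of i] near[OF C(1)[of i], of j] by linarith
  qed
  then obtain q where q: "q \<in> X" "(\<lambda>n. p (C n)) \<longlonglongrightarrow> q"
    using Cauchy_limit[of "\<lambda>n. p (C n)"] pX C by blast
  \<comment> \<open>The gates of \<open>C n \<inter> A\<close> lie in \<open>A\<close> and approach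
    those of \<open>C n\<close>, so they have the same limit \<open>q\<close>.\<close>
  have "q \<in> A" if A: "A \<in> \<G>" for A
  proof -
    have EX: "p (C n \<inter> A) \<in> X" for n using pX dir C A by blast
    have "(\<lambda>n. dist (p (C n)) (p (C n \<inter> A))) \<longlonglongrightarrow> 0"
    proof (rule Lim_null_comparison)
      have "dist (p (C n)) (p (C n \<inter> A)) \<le> 1 / real (Suc n)" for n
        using dist_le[OF pX[OF C(1)[of n]] EX[of n]] near[OF A, of n] by linarith
      then show "\<forall>\<^sub>F n in sequentially. norm (dist (p (C n)) (p (C n \<inter> A))) \<le> 1 / real (Suc n)" by simp
      show "(\<lambda>n. 1 / real (Suc n)) \<longlonglongrightarrow> 0"
        using LIMSEQ_inverse_real_of_nat by (simp add: inverse_eq_divide)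
    qed
    from tendsto_add[OF this iffD1[OF tendsto_dist_iff q(2)]]
    have "(\<lambda>n. dist (p (C n)) (p (C n \<inter> A)) + dist (p (C n)) q) \<longlonglongrightarrow> 0" by simp
    then have "(\<lambda>n. dist (p (C n \<inter> A)) q) \<longlonglongrightarrow> 0"
    proof (rule Lim_null_comparison[rotated])
      show "\<forall>\<^sub>F n in sequentially. norm (dist (p (C n \<inter> A)) q)
        \<le> dist (p (C n)) (p (C n \<inter> A)) + dist (p (C n)) q"
        by (simp add: dist_triangle3)
    qed
    then have "(\<lambda>n. p (C n \<inter> A)) \<longlonglongrightarrow> q" by (rule iffD2[OF tendsto_dist_iff])
    moreover have "p (C n \<inter> A) \<in> A" for n using g(1)[OF dir[OF C(1)[of n] A]] by auto
    ultimately show "q \<in> A" using closed_sequentially[OF cl[OF A], of "\<lambda>n. p (C n \<inter> A)" q] by simp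
  qed
  then show ?thesis by blast
qed

lemma Helly:
  assumes cl: "\<And>C. C \<in> \<C> \<Longrightarrow> closed C" and sub: "\<And>C. C \<in> \<C> \<Longrightarrow> C \<subseteq> X"
    and conv: "\<And>C. C \<in> \<C> \<Longrightarrow> median_convex X \<mu> C"
    and meet: "\<And>C D. C \<in> \<C> \<Longrightarrow> D \<in> \<C> \<Longrightarrow> C \<inter> D \<noteq> {}"
    and B: "B \<in> \<C>" and x: "x \<in> X" and bd: "\<And>b. b \<in> B \<Longrightarrow> \<rho> x b \<le> R"
  shows "\<Inter>\<C> \<noteq> {}"
proof -
  \<comment> \<open>Keeping \<open>B\<close> in every finite intersection provides the common bound
    \<open>R\<close> that the directed case requires.\<close>
  define \<G> where "\<G> = {\<Inter>\<D> | \<D>. finite \<D> \<and> \<D> \<subseteq> \<C> \<and> B \<in> \<D>}"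
  have "\<Inter>\<G> \<noteq> {}"
  proof (rule directed_Inter_nonempty[OF _ _ _ _ _ x])
    show "\<G> \<noteq> {}" unfolding \<G>_def using B by blast
    show "closed C" if "C \<in> \<G>" for C
    proof -
      obtain \<D> where "C = \<Inter>\<D>" "\<D> \<subseteq> \<C>" using \<open>C \<in> \<G>\<close> unfolding \<G>_def by blast
      then show ?thesis using cl by (simp add: closed_Inter subset_iff)
    qed
    show "C \<subseteq> X" if "C \<in> \<G>" for C using that sub[OF B] unfolding \<G>_def by blast
    show "median_convex X \<mu> C" if "C \<in> \<G>" for C
    proof -
      obtain \<D> where "C = \<Inter>\<D>" "\<D> \<subseteq> \<C>" using \<open>C \<in> \<G>\<close> unfolding \<G>_def by blast
      then show ?thesis using convex_Inter[of \<D>] conv by blast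
    qed
    show "C \<inter> D \<in> \<G>" if CD: "C \<in> \<G>" "D \<in> \<G>" for C D
    proof -
      obtain \<D> \<E> where "C = \<Inter>\<D>" "D = \<Inter>\<E>" "finite \<D>" "finite \<E>" "\<D> \<subseteq> \<C>" "\<E> \<subseteq> \<C>" "B \<in> \<D>"
        using CD unfolding \<G>_def by blast
      then have "C \<inter> D = \<Inter>(\<D> \<union> \<E>) \<and> finite (\<D> \<union> \<E>) \<and> \<D> \<union> \<E> \<subseteq> \<C> \<and> B \<in> \<D> \<union> \<E>" by auto
      then show ?thesis unfolding \<G>_def by blast
    qed
    show "\<exists>c\<in>C. \<rho> x c \<le> R" if C: "C \<in> \<G>" for C
    proof -
      obtain \<D> where D: "C = \<Inter>\<D>" "finite \<D>" "\<D> \<subseteq> \<C>" "B \<in> \<D>" using C unfolding \<G>_def by blast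
      have "\<Inter>\<D> \<noteq> {}" by (rule Helly_finite) (use D conv sub meet in blast)+
      then show ?thesis using D bd by blast
    qed
  qed
  moreover have "\<Inter>\<G> \<subseteq> C" if C: "C \<in> \<C>" for C
  proof -
    have "finite {C, B} \<and> {C, B} \<subseteq> \<C> \<and> B \<in> {C, B}" using C B by simp
    then have "\<Inter>{C, B} \<in> \<G>" unfolding \<G>_def by blast
    then show ?thesis by fastforce
  qed
  ultimately show ?thesis by blast
qed

section \<open>Coordinates and the balls that they define\<close>

definition coords :: "('a \<Rightarrow> real) set" where
  "coords = {f. (\<forall>a\<in>X. \<forall>b\<in>X. f b - f a \<le> \<rho> a b) \<and>
     (\<forall>a\<in>X. \<forall>b\<in>X. \<forall>c\<in>X. \<mu> a b c = c \<longrightarrow> f c \<le> max (f a) (f b) \<and> min (f a) (f b) \<le> f c)}"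

text \<open>Members of \<open>coords\<close> are median morphisms to the line: the value at
  \<open>\<mu> a b c\<close> lies between the values at any two of the points, so it is their
  median. As \<open>coords\<close> is closed under negation, the one-sided bound is symmetric. The
  relation says that the supremum of all coordinate differences is at most \<open>D\<close>.\<close>

definition near :: "real \<Rightarrow> 'a \<Rightarrow> 'a \<Rightarrow> bool" where
  "near D x y \<longleftrightarrow> (\<forall>f\<in>coords. f y - f x \<le> D)"

lemma coords_lipschitz: "\<lbrakk>f \<in> coords; a \<in> X; b \<in> X\<rbrakk> \<Longrightarrow> f b - f a \<le> \<rho> a b"
  unfolding coords_def by blast

lemma coords_between:
  "\<lbrakk>f \<in> coords; a \<in> X; b \<in> X; c \<in> X; \<mu> a b c = c\<rbrakk> \<Longrightarrow> f c \<le> max (f a) (f b) \<and> min (f a) (f b) \<le> f c"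
  unfolding coords_def by blast

lemma coords_uminus:
  assumes "f \<in> coords" shows "(\<lambda>x. - f x) \<in> coords"
proof -
  have "- f b - - f a \<le> \<rho> a b" if "a \<in> X" "b \<in> X" for a b
    using coords_lipschitz[OF assms that(2,1)] sym[OF that] by simp
  moreover have "- f c \<le> max (- f a) (- f b) \<and> min (- f a) (- f b) \<le> - f c"
    if "a \<in> X" "b \<in> X" "c \<in> X" "\<mu> a b c = c" for a b c
    using coords_between[OF assms that] by (auto simp: max_def min_def split: if_splits)
  ultimately show ?thesis unfolding coords_def by blast
qed

lemma coords_zero: "(\<lambda>x. 0) \<in> coords"
  unfolding coords_def using nonneg by simp

lemma near_sym: "near D x y \<Longrightarrow> near D y x"
  unfolding near_def
proof
  fix f assume "\<forall>f\<in>coords. f y - f x \<le> D" "f \<in> coords"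
  then show "f x - f y \<le> D" using coords_uminus[of f] by fastforce
qed

lemma near_trans: "\<lbrakk>near D x y; near E y z\<rbrakk> \<Longrightarrow> near (D + E) x z"
  unfolding near_def by fastforce

lemma near_nonneg: "near D x y \<Longrightarrow> 0 \<le> D"
  unfolding near_def using coords_zero by fastforce

lemma near_self: "0 \<le> D \<Longrightarrow> near D x x"
  unfolding near_def by simp

lemma metric_imp_near: "\<lbrakk>x \<in> X; y \<in> X; \<rho> x y \<le> D\<rbrakk> \<Longrightarrow> near D x y"
  unfolding near_def using coords_lipschitz by fastforce

lemma coords_continuous:
  assumes "f \<in> coords" shows "continuous_on X f"
proof (rule lipschitz_on_continuous_on)
  show "(max L 0)-lipschitz_on X f"
  proof (rule lipschitz_onI)
    fix a b assume ab: "a \<in> X" "b \<in> X"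
    have "\<bar>f a - f b\<bar> \<le> \<rho> a b"
      using coords_lipschitz[OF assms ab] coords_lipschitz[OF assms ab(2,1)] sym[OF ab] by linarith
    also have "\<dots> \<le> L * dist a b" by (rule le_dist[OF ab])
    also have "\<dots> \<le> max L 0 * dist a b" by (simp add: mult_right_mono)
    finally show "dist (f a) (f b) \<le> max L 0 * dist a b" by (simp add: dist_real_def)
  qed simp
qed

lemma halfspace_closed: "f \<in> coords \<Longrightarrow> closed {x \<in> X. c \<le> f x}"
  using continuous_closed_preimage[OF coords_continuous complete_imp_closed[OF complete], of f "{c..}"]
  by (simp add: vimage_def Int_def)

lemma halfspace_convex: "f \<in> coords \<Longrightarrow> median_convex X \<mu> {x \<in> X. c \<le> f x}"
  unfolding median_convex_def median_interval_def
proof (intro ballI subsetI)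
  fix a b z assume f: "f \<in> coords" and "a \<in> {x \<in> X. c \<le> f x}" "b \<in> {x \<in> X. c \<le> f x}"
    "z \<in> {z \<in> X. \<mu> a b z = z}"
  then show "z \<in> {x \<in> X. c \<le> f x}" using coords_between[OF f, of a b z] by auto
qed

definition near_ball :: "real \<Rightarrow> 'a \<Rightarrow> 'a set" where
  "near_ball R x = {y \<in> X. near R x y}"

text \<open>Balls are intersections of the halfspaces cut out by coordinates; closedness and
  convexity are read off from this form.\<close>

lemma near_ball_eq: "near_ball R x = X \<inter> (\<Inter>f\<in>coords. {y \<in> X. f x - R \<le> f y})"
proof -
  have "near R x y \<longleftrightarrow> (\<forall>f\<in>coords. f x - R \<le> f y)" for y
    using near_sym[of R x y] near_sym[of R y x] unfolding near_def by fastforce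
  then show ?thesis unfolding near_ball_def using coords_zero by auto
qed

lemma near_ball_closed: "closed (near_ball R x)"
  unfolding near_ball_eq
  by (intro closed_Int closed_INT ballI halfspace_closed complete_imp_closed[OF complete])

lemma near_ball_convex: "median_convex X \<mu> (near_ball R x)"
proof -
  have "median_convex X \<mu> X" unfolding median_convex_def median_interval_def by blast
  moreover have "median_convex X \<mu> (\<Inter>f\<in>coords. {y \<in> X. f x - R \<le> f y})"
    by (rule convex_Inter) (auto intro: halfspace_convex)
  ultimately show ?thesis unfolding near_ball_eq by (rule convex_Int)
qed

lemma near_ball_subset: "near_ball R x \<subseteq> X"
  unfolding near_ball_def by blast

text \<open>The new function follows \<open>g\<close> up to the level \<open>d\<close> and then
  \<open>f\<close> from the level \<open>c\<close> on. Since \<open>f\<close> has reached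
  \<open>c\<close> only where \<open>g\<close> has reached \<open>d\<close>, at most one of the two
  summands varies on either side of the level \<open>c\<close> of \<open>f\<close>, and betweenness
  is inherited.\<close>

lemma coords_glue:
  assumes f: "f \<in> coords" and g: "g \<in> coords"
    and le: "\<And>x. x \<in> X \<Longrightarrow> c \<le> f x \<Longrightarrow> d \<le> g x"
  shows "(\<lambda>x. min (g x) d + max (f x) c) \<in> coords"
proof -
  define F where "F x = min (g x) d + max (f x) c" for x
  have "F b - F a \<le> \<rho> a b" if ab: "a \<in> X" "b \<in> X" for a b
  proof -
    have fl: "f b - f a \<le> \<rho> a b" and gl: "g b - g a \<le> \<rho> a b" and r: "0 \<le> \<rho> a b"
      using coords_lipschitz[OF f ab] coords_lipschitz[OF g ab] nonneg[OF ab] .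
    consider "f a < c" "f b < c" | "f a \<ge> c" "f b \<ge> c" | "f a \<ge> c" "f b < c" | "f a < c" "f b \<ge> c"
      by linarith
    then show ?thesis
    proof cases
      case 1 then show ?thesis using gl r unfolding F_def by (simp add: min_def max_def)
    next
      case 2 then show ?thesis using fl r le[OF ab(1)] le[OF ab(2)] unfolding F_def by simp
    next
      case 3 then show ?thesis using r le[OF ab(1)] unfolding F_def by simp
    next
      \<comment> \<open>Connectedness enters here: some \<open>w\<close> between \<open>a\<close>
        and \<open>b\<close> has \<open>f w = c\<close>. The increase of \<open>g\<close> is charged
        to the part from \<open>a\<close> to \<open>w\<close>, that of \<open>f\<close> to the part
        from \<open>w\<close> to \<open>b\<close>, and \<rho> is additive at
        \<open>w\<close>.\<close>
      case 4
      have "connected (f ` \<mu> a b ` X)"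
      proof (rule connected_continuous_image[OF continuous_on_subset[OF coords_continuous[OF f]]])
        show "\<mu> a b ` X \<subseteq> X" using ab by auto
      qed (rule interval_connected[OF ab])
      moreover have "f a \<in> f ` \<mu> a b ` X" "f b \<in> f ` \<mu> a b ` X"
        using ab by (metis idem(2) imageI) (metis ab idem(3) imageI)
      ultimately have "c \<in> f ` \<mu> a b ` X"
        using 4 connectedD_interval[of "f ` \<mu> a b ` X" "f a" "f b" c] by simp
      then obtain v where v: "v \<in> X" "c = f (\<mu> a b v)" by auto
      define w where "w = \<mu> a b v"
      have w: "w \<in> X" "f w = c" using v ab by (auto simp: w_def)
      have "\<mu> a b w = w" unfolding w_def by (rule absorb[OF ab v(1)])
      then have "\<rho> a b = \<rho> a w + \<rho> w b" by (rule between[OF ab w(1)])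
      moreover have "f b - f w \<le> \<rho> w b" "g w - g a \<le> \<rho> a w" "0 \<le> \<rho> a w"
        using coords_lipschitz[OF f w(1) ab(2)] coords_lipschitz[OF g ab(1) w(1)] nonneg[OF ab(1) w(1)] .
      ultimately show ?thesis using 4 le[OF ab(2)] le[OF w(1)] w(2) unfolding F_def
        by (simp add: min_def max_def)
    qed
  qed
  moreover have "F z \<le> max (F a) (F b) \<and> min (F a) (F b) \<le> F z"
    if "a \<in> X" "b \<in> X" "z \<in> X" "\<mu> a b z = z" for a b z
    using coords_between[OF f that] coords_between[OF g that] le[OF that(1)] le[OF that(2)] le[OF that(3)]
    unfolding F_def by (auto simp: min_def max_def split: if_splits)
  ultimately show ?thesis unfolding coords_def F_def by blast
qed

text \<open>\<open>z\<close> is the gate of \<open>y\<close> in the ball of radius \<open>D / 2\<close> around \<open>x\<close>. A coordinate that is too long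
  between \<open>z\<close> and \<open>y\<close> could be glued to one that is too long between \<open>x\<close> and the halfspace
  it leaves, giving a coordinate longer than \<open>D\<close> between \<open>x\<close> and \<open>y\<close>.\<close>
lemma near_midpoint:
  assumes x: "x \<in> X" and y: "y \<in> X" and D: "near D x y"
  shows "near_ball (D / 2) x \<inter> near_ball (D / 2) y \<noteq> {}"
proof -
  define B where "B = near_ball (D / 2) x"
  have D0: "0 \<le> D" by (rule near_nonneg[OF D])
  have xB: "x \<in> B" unfolding B_def near_ball_def using x D0 near_self[of "D/2"] by simp
  have B: "closed B" "B \<subseteq> X" "median_convex X \<mu> B" "B \<noteq> {}"
    unfolding B_def using near_ball_closed near_ball_subset near_ball_convex xB B_def by auto
  define z where "z = gate y B"
  have zB: "z \<in> B" and zg: "\<And>w. w \<in> B \<Longrightarrow> \<mu> y w z = z"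
    unfolding z_def using gate(1,2)[OF B y] by auto
  have zX: "z \<in> X" using zB B by auto
  have "near (D / 2) z y"
  proof (rule ccontr)
    assume "\<not> near (D / 2) z y"
    then obtain f where f: "f \<in> coords" "f y - f z > D / 2" unfolding near_def by force
    \<comment> \<open>Halfway between \<open>f z\<close> and \<open>f y - D / 2\<close>, so that
      both inequalities of the next line are strict.\<close>
    define c where "c = (f z + f y - D / 2) / 2"
    have c: "f z < c" "f y - c > D / 2" using f(2) unfolding c_def by argo+
    define H where "H = {w \<in> X. c \<le> f w}"
    have yH: "y \<in> H" unfolding H_def using y c D0 by simp
    have H: "closed H" "H \<subseteq> X" "median_convex X \<mu> H" "H \<noteq> {}"
      unfolding H_def using halfspace_closed[OF f(1)] halfspace_convex[OF f(1)] yH H_def by auto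
    define p where "p = gate x H"
    have pH: "p \<in> H" and pg: "\<And>w. w \<in> H \<Longrightarrow> \<mu> x w p = p"
      unfolding p_def using gate(1,2)[OF H x] by auto
    have pX: "p \<in> X" using pH H by auto
    \<comment> \<open>The gate \<open>z\<close> of \<open>y\<close> lies between \<open>y\<close>
      and every point of \<open>B\<close>. If \<open>p\<close> were in \<open>B\<close>, convexity
      of \<open>H\<close> would put \<open>z\<close> into \<open>H\<close>, although
      \<open>f z < c\<close>.\<close>
    have "p \<notin> B"
    proof
      assume pB: "p \<in> B"
      have "z \<in> H" using convexD(1)[OF H(3,2) yH pH zX] zg[OF pB] by simp
      then show False using c unfolding H_def by simp
    qed
    then obtain g where g: "g \<in> coords" "g p - g x > D / 2"
      unfolding B_def near_ball_def near_def using pX by force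
    have gp: "g p \<le> g w" if w: "w \<in> X" "c \<le> f w" for w
    proof -
      have "\<mu> x w p = p" using pg w H_def by simp
      then have "g p \<le> max (g x) (g w)" using coords_between[OF g(1) x w(1) pX] by simp
      then show ?thesis using g(2) D0 by (simp add: max_def split: if_splits)
    qed
    \<comment> \<open>\<open>F x\<close> is \<open>g x + c\<close> and \<open>F y\<close> is
      \<open>g p + f y\<close>, so the difference is the sum of two excesses over
      \<open>D / 2\<close>.\<close>
    define F where "F w = min (g w) (g p) + max (f w) c" for w
    have "F \<in> coords" unfolding F_def by (rule coords_glue[OF f(1) g(1) gp])
    then have "F y - F x \<le> D" using D unfolding near_def by blast
    moreover have "f z \<ge> min (f y) (f x)" using coords_between[OF f(1) y x zX] zg[OF xB] by simp
    then have "f x < c" using f(2) D0 c by (simp add: min_def split: if_splits)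
    moreover have "f y > c" using c D0 by linarith
    moreover have "g p \<le> g y" using gp[OF y] \<open>f y > c\<close> by simp
    moreover have "g x < g p" using g(2) D0 by linarith
    ultimately show False using g(2) c unfolding F_def by simp
  qed
  then show ?thesis using zB near_sym zX unfolding B_def near_ball_def by blast
qed

section \<open>From a bounded orbit to a fixed point\<close>

lemma fixed_point:
  fixes \<Gamma> :: "('a \<Rightarrow> 'a) set"
  assumes maps: "\<And>g x. g \<in> \<Gamma> \<Longrightarrow> x \<in> X \<Longrightarrow> g x \<in> X"
    and iso: "\<And>g x y. g \<in> \<Gamma> \<Longrightarrow> x \<in> X \<Longrightarrow> y \<in> X \<Longrightarrow> \<rho> (g x) (g y) = \<rho> x y"
    and mor: "\<And>g x y z. g \<in> \<Gamma> \<Longrightarrow> x \<in> X \<Longrightarrow> y \<in> X \<Longrightarrow> z \<in> X \<Longrightarrow> g (\<mu> x y z) = \<mu> (g x) (g y) (g z)"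
    and inverse: "\<And>g. g \<in> \<Gamma> \<Longrightarrow> \<exists>h\<in>\<Gamma>. \<forall>x\<in>X. g (h x) = x"
    and compose: "\<And>g h. g \<in> \<Gamma> \<Longrightarrow> h \<in> \<Gamma> \<Longrightarrow> \<exists>k\<in>\<Gamma>. \<forall>x\<in>X. k x = g (h x)"
    and x0: "x0 \<in> X" and bounded: "\<And>g. g \<in> \<Gamma> \<Longrightarrow> \<rho> (g x0) x0 \<le> R"
    and coords: "\<And>x y. x \<in> X \<Longrightarrow> y \<in> X \<Longrightarrow> \<exists>f\<in>coords. \<rho> x y \<le> C * (f y - f x)" and C: "0 \<le> C"
  shows "\<exists>x\<in>X. \<forall>g\<in>\<Gamma>. g x = x"
proof (cases "\<Gamma> = {}")
  case True
  then show ?thesis using x0 by blast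
next
  case False
  then obtain g0 where g0: "g0 \<in> \<Gamma>" by blast
  have R0: "0 \<le> R" using bounded[OF g0] nonneg[OF maps[OF g0 x0] x0] by linarith
  \<comment> \<open>The hypothesis \<open>coords\<close>, which finite rank will supply, converts
    nearness back into \<rho>.\<close>
  have near_le: "\<rho> x y \<le> C * D" if "x \<in> X" "y \<in> X" "near D x y" for x y D
  proof -
    obtain f where "f \<in> coords" "\<rho> x y \<le> C * (f y - f x)" using coords \<open>x \<in> X\<close> \<open>y \<in> X\<close> by blast
    moreover have "C * (f y - f x) \<le> C * D"
      using \<open>near D x y\<close> \<open>f \<in> coords\<close> C unfolding near_def by (intro mult_left_mono) auto
    ultimately show ?thesis by linarith
  qed
  have near_g: "near D (g x) (g y)" if g: "g \<in> \<Gamma>" and xy: "x \<in> X" "y \<in> X" "near D x y" for g x y D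
    unfolding near_def
  proof
    fix f assume f: "f \<in> coords"
    have "(\<lambda>x. f (g x)) \<in> coords"
    proof -
      have "f (g b) - f (g a) \<le> \<rho> a b" if "a \<in> X" "b \<in> X" for a b
        using coords_lipschitz[OF f maps[OF g that(1)] maps[OF g that(2)]] iso[OF g that] by simp
      moreover have "f (g c) \<le> max (f (g a)) (f (g b)) \<and> min (f (g a)) (f (g b)) \<le> f (g c)"
        if "a \<in> X" "b \<in> X" "c \<in> X" "\<mu> a b c = c" for a b c
        using coords_between[OF f maps[OF g that(1)] maps[OF g that(2)] maps[OF g that(3)]]
          mor[OF g that(1-3)] that(4) by simp
      ultimately show ?thesis unfolding coords_def by blast
    qed
    from bspec[OF xy(3)[unfolded near_def] this] show "f (g y) - f (g x) \<le> D" by simp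
  qed
  \<comment> \<open>The common part of the balls around the whole orbit is closed and convex and
    contains \<open>x0\<close>; its points are pairwise near up to \<open>2 * R\<close>. Each step
    of \<open>A\<close> uses half of the preceding constant as radius.\<close>
  define A0 where "A0 = (\<Inter>g\<in>\<Gamma>. near_ball R (g x0))"
  define A where "A = rec_nat A0 (\<lambda>n S. S \<inter> (\<Inter>a\<in>S. near_ball (2 * R / 2 ^ Suc n) a))"
  have A_0: "A 0 = A0" and A_Suc: "\<And>n. A (Suc n) = A n \<inter> (\<Inter>a\<in>A n. near_ball (2 * R / 2 ^ Suc n) a)"
    unfolding A_def by simp_all
  have A0_bd: "\<rho> x0 b \<le> C * (2 * R)" if b: "b \<in> A0" for b
  proof -
    have bb: "b \<in> near_ball R (g0 x0)" using b g0 unfolding A0_def by blast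
    then have bX: "b \<in> X" and nb: "near R (g0 x0) b" unfolding near_ball_def by auto
    have "near R x0 (g0 x0)"
      by (rule near_sym[OF metric_imp_near[OF maps[OF g0 x0] x0 bounded[OF g0]]])
    from near_trans[OF this nb] show ?thesis using near_le[OF x0 bX, of "2 * R"] by simp
  qed
  have P: "A n \<subseteq> X \<and> closed (A n) \<and> median_convex X \<mu> (A n) \<and> A n \<noteq> {} \<and> A n \<subseteq> A0 \<and>
      (\<forall>g\<in>\<Gamma>. g ` A n \<subseteq> A n) \<and> (\<forall>a\<in>A n. \<forall>b\<in>A n. near (2 * R / 2 ^ n) a b)" for n
  proof (induction n)
    case 0
    have "A0 \<subseteq> X" using g0 near_ball_subset unfolding A0_def by blast
    moreover have "closed A0" unfolding A0_def by (intro closed_INT ballI near_ball_closed)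
    moreover have "median_convex X \<mu> A0" unfolding A0_def
      by (rule convex_Inter) (auto intro: near_ball_convex)
    moreover have "near R (g x0) x0" if "g \<in> \<Gamma>" for g
      by (rule metric_imp_near[OF maps[OF that x0] x0 bounded[OF that]])
    then have "x0 \<in> A0" unfolding A0_def near_ball_def using x0 by simp
    \<comment> \<open>Here \<open>h x0 = g (k x0)\<close> with \<open>k\<close> standing for the
      inverse of \<open>g\<close> after \<open>h\<close>; nearness of \<open>k x0\<close> and
      \<open>y\<close> is carried over by \<open>g\<close>.\<close>
    moreover have "g y \<in> near_ball R (h x0)" if g: "g \<in> \<Gamma>" and h: "h \<in> \<Gamma>" and y: "y \<in> A0" for g h y
    proof -
      obtain g' where g': "g' \<in> \<Gamma>" "\<forall>x\<in>X. g (g' x) = x" using inverse[OF g] by blast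
      obtain k where k: "k \<in> \<Gamma>" "\<forall>x\<in>X. k x = g' (h x)" using compose[OF g'(1) h] by blast
      have "y \<in> near_ball R (k x0)" using y k unfolding A0_def by blast
      then have yX: "y \<in> X" and "near R (k x0) y" unfolding near_ball_def by auto
      then have "near R (g (k x0)) (g y)" by (intro near_g[OF g maps[OF k(1) x0]])
      moreover have "g (k x0) = h x0" using k(2) x0 g'(2) maps[OF h x0] by simp
      ultimately show ?thesis unfolding near_ball_def using maps[OF g yX] by simp
    qed
    then have "g ` A0 \<subseteq> A0" if "g \<in> \<Gamma>" for g using that unfolding A0_def by blast
    moreover have "near (2 * R) a b" if "a \<in> A0" "b \<in> A0" for a b
    proof -
      have "near R (g0 x0) a" "near R (g0 x0) b" using that g0 unfolding A0_def near_ball_def by auto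
      then show ?thesis using near_trans[OF near_sym, of R "g0 x0" a R b] by simp
    qed
    ultimately show ?case unfolding A_0 by auto
  next
    case (Suc n)
    define r where "r = 2 * R / 2 ^ Suc n"
    have r: "2 * R / 2 ^ n / 2 = r" unfolding r_def by simp
    have r0: "0 \<le> r" unfolding r_def using R0 by simp
    have AS: "A (Suc n) = A n \<inter> (\<Inter>a\<in>A n. near_ball r a)" unfolding r_def by (rule A_Suc)
    have IH: "A n \<subseteq> X" "closed (A n)" "median_convex X \<mu> (A n)" "A n \<noteq> {}" "A n \<subseteq> A0"
      "\<And>g. g \<in> \<Gamma> \<Longrightarrow> g ` A n \<subseteq> A n" "\<And>a b. a \<in> A n \<Longrightarrow> b \<in> A n \<Longrightarrow> near (2 * R / 2 ^ n) a b"
      using Suc.IH by auto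
    have self: "a \<in> near_ball r a" if "a \<in> A n" for a
      using that IH(1) near_self[OF r0] unfolding near_ball_def by blast
    \<comment> \<open>Two balls with centres in \<open>A n\<close> meet by
      \<open>near_midpoint\<close>, and \<open>A n\<close> meets each of them in its centre.
      Including \<open>A n\<close> in the family makes one member bounded and places the common
      point in \<open>A n\<close>.\<close>
    have "\<Inter>(insert (A n) (near_ball r ` A n)) \<noteq> {}"
    proof (rule Helly[where B = "A n" and x = x0])
      fix S T assume S: "S \<in> insert (A n) (near_ball r ` A n)" and T: "T \<in> insert (A n) (near_ball r ` A n)"
      have "near_ball r a \<inter> near_ball r b \<noteq> {}" if ab: "a \<in> A n" "b \<in> A n" for a b
        using near_midpoint[OF _ _ IH(7)[OF ab]] ab IH(1) unfolding r by blast
      then show "S \<inter> T \<noteq> {}" using S T self IH(4) by blast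
    next
      fix b assume "b \<in> A n"
      then show "\<rho> x0 b \<le> C * (2 * R)" using A0_bd IH(5) by blast
    qed (use IH(1-4) near_ball_closed near_ball_convex subsetD[OF near_ball_subset] x0 in auto)
    then have "A (Suc n) \<noteq> {}" unfolding AS by simp
    moreover have "A (Suc n) \<subseteq> X" "A (Suc n) \<subseteq> A0" using IH AS by auto
    moreover have "closed (A (Suc n))"
      unfolding AS by (intro closed_Int closed_INT ballI near_ball_closed IH)
    moreover have "median_convex X \<mu> (A (Suc n))" unfolding AS
      by (intro convex_Int IH(3) convex_Inter) (auto intro: near_ball_convex)
    moreover have "near r a b" if "a \<in> A (Suc n)" "b \<in> A (Suc n)" for a b
      using that unfolding AS near_ball_def by blast
    moreover have "g y \<in> A (Suc n)" if g: "g \<in> \<Gamma>" and y: "y \<in> A (Suc n)" for g y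
    proof -
      obtain g' where g': "g' \<in> \<Gamma>" "\<forall>x\<in>X. g (g' x) = x" using inverse[OF g] by blast
      have yn: "y \<in> A n" "y \<in> X" using y AS IH(1) by auto
      have "near r a (g y)" if a: "a \<in> A n" for a
      proof -
        have a': "g' a \<in> A n" using IH(6)[OF g'(1)] a by blast
        then have "near r (g' a) y" using y unfolding AS near_ball_def by blast
        then have "near r (g (g' a)) (g y)" using near_g[OF g _ yn(2)] a' IH(1) by blast
        then show ?thesis using g'(2) a IH(1) by (metis subsetD)
      qed
      then show ?thesis using IH(6)[OF g] yn maps[OF g yn(2)] unfolding AS near_ball_def by blast
    qed
    ultimately show ?case unfolding r_def by blast
  qed
  have anti: "A n \<subseteq> A m" if "m \<le> n" for m n
    by (rule lift_Suc_antimono_le[of A, OF _ that]) (use A_Suc in blast)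
  have "\<Inter>(range A) \<noteq> {}"
  proof (rule Helly[where B = "A 0" and x = x0 and R = "C * (2 * R)"])
    fix S T assume "S \<in> range A" "T \<in> range A"
    then obtain m n where "S = A m" "T = A n" by blast
    then show "S \<inter> T \<noteq> {}" using P[of "max m n"] anti[of m "max m n"] anti[of n "max m n"] by fastforce
  qed (use P x0 A0_bd A_0 subsetD[OF conjunct1[OF P]] in auto)
  then obtain a where a: "\<And>n. a \<in> A n" by blast
  have aX: "a \<in> X" using a[of 0] P[of 0] by blast
  have "g a = a" if g: "g \<in> \<Gamma>" for g
  proof -
    have "\<rho> (g a) a \<le> C * (2 * R / 2 ^ n)" for n
      using P[of n] a[of n] g near_le[OF maps[OF g aX] aX, of "2 * R / 2 ^ n"] by blast
    moreover have "(\<lambda>n. C * (2 * R / 2 ^ n)) \<longlonglongrightarrow> C * (2 * R * 0)"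
      unfolding divide_inverse power_inverse[symmetric]
      by (intro tendsto_intros LIMSEQ_realpow_zero) auto
    ultimately have "\<rho> (g a) a \<le> 0" using LIMSEQ_le_const[of _ "C * (2 * R * 0)"] by simp
    then show ?thesis using eq_0[OF maps[OF g aX] aX] by blast
  qed
  then show ?thesis using aX by blast
qed

end

section \<open>Halfspaces of finite median algebras\<close>

definition halfspaces :: "'a set \<Rightarrow> ('a \<Rightarrow> 'a \<Rightarrow> 'a \<Rightarrow> 'a) \<Rightarrow> 'a set set" where
  "halfspaces M \<mu> = {h. h \<subseteq> M \<and> h \<noteq> {} \<and> M - h \<noteq> {} \<and> median_convex M \<mu> h \<and> median_convex M \<mu> (M - h)}"

text \<open>Every wall separating \<open>a\<close> from \<open>b\<close> is represented by its part
  containing \<open>b\<close>, which turns sums over walls into sums over sets.\<close>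

definition sides :: "'a set \<Rightarrow> ('a \<Rightarrow> 'a \<Rightarrow> 'a \<Rightarrow> 'a) \<Rightarrow> 'a \<Rightarrow> 'a \<Rightarrow> 'a set set" where
  "sides M \<mu> a b = {h \<in> halfspaces M \<mu>. a \<notin> h \<and> b \<in> h}"

definition weight :: "'a::metric_space set \<Rightarrow> ('a \<Rightarrow> 'a \<Rightarrow> 'a \<Rightarrow> 'a) \<Rightarrow> 'a set \<Rightarrow> real" where
  "weight M \<mu> h = lambda_max M \<mu> {h, M - h}"

lemma halfspaces_subset: "h \<in> halfspaces M \<mu> \<Longrightarrow> h \<subseteq> M"
  unfolding halfspaces_def by blast

lemma halfspaces_compl: "h \<in> halfspaces M \<mu> \<Longrightarrow> M - h \<in> halfspaces M \<mu>"
  unfolding halfspaces_def by (auto simp: double_diff)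

lemma walls_eq: "walls M \<mu> = (\<lambda>h. {h, M - h}) ` halfspaces M \<mu>"
  unfolding walls_def halfspaces_def by blast

lemma separating_walls_eq:
  assumes "a \<in> M" "b \<in> M"
  shows "separating_walls M \<mu> a b = (\<lambda>h. {h, M - h}) ` sides M \<mu> a b"
proof
  show "separating_walls M \<mu> a b \<subseteq> (\<lambda>h. {h, M - h}) ` sides M \<mu> a b"
  proof
    fix W assume "W \<in> separating_walls M \<mu> a b"
    then obtain h where h: "h \<in> halfspaces M \<mu>" "W = {h, M - h}" "separates W a b"
      unfolding separating_walls_def walls_eq by blast
    then have hM: "h \<subseteq> M" by (simp add: halfspaces_subset)
    show "W \<in> (\<lambda>h. {h, M - h}) ` sides M \<mu> a b"
    proof (cases "b \<in> h")
      case True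
      then have "h \<in> sides M \<mu> a b" using h assms unfolding sides_def separates_def by auto
      then show ?thesis using h(2) by blast
    next
      case False
      then have "M - h \<in> sides M \<mu> a b"
        using h assms halfspaces_compl[OF h(1)] unfolding sides_def separates_def by auto
      moreover have "W = {M - h, M - (M - h)}" using h(2) hM by (auto simp: double_diff)
      ultimately show ?thesis by blast
    qed
  qed
  show "(\<lambda>h. {h, M - h}) ` sides M \<mu> a b \<subseteq> separating_walls M \<mu> a b"
  proof (rule image_subsetI)
    fix h assume "h \<in> sides M \<mu> a b"
    then have h: "h \<in> halfspaces M \<mu>" "a \<notin> h" "b \<in> h" unfolding sides_def by auto
    then have "{h, M - h} \<in> walls M \<mu>" unfolding walls_eq by (intro imageI)
    moreover have "separates {h, M - h} a b" using h assms unfolding separates_def by simp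
    ultimately show "{h, M - h} \<in> separating_walls M \<mu> a b" unfolding separating_walls_def by simp
  qed
qed

lemma inj_on_wall: "b \<in> M \<Longrightarrow> inj_on (\<lambda>h. {h, M - h}) (sides M \<mu> a b)"
proof (rule inj_onI)
  fix h k assume "b \<in> M" "h \<in> sides M \<mu> a b" "k \<in> sides M \<mu> a b" and eq: "{h, M - h} = {k, M - k}"
  then have "b \<in> h" "b \<in> k" unfolding sides_def by auto
  then show "h = k" using eq by (auto simp: doubleton_eq_iff)
qed

lemma cc_edge_iff: "cc_edge M \<mu> a b \<longleftrightarrow> a \<in> M \<and> b \<in> M \<and> card (sides M \<mu> a b) = 1"
  unfolding cc_edge_def using separating_walls_eq[of a M b \<mu>] card_image[OF inj_on_wall[of b M \<mu> a]] by auto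

lemma d_mu_M_eq:
  "\<lbrakk>x \<in> M; y \<in> M\<rbrakk> \<Longrightarrow> d_mu_M M \<mu> x y = (\<Sum>h\<in>sides M \<mu> x y. weight M \<mu> h)"
  unfolding d_mu_M_def weight_def by (simp add: separating_walls_eq sum.reindex[OF inj_on_wall])

lemma sides_swap:
  assumes "a \<in> M" "b \<in> M"
  shows "sides M \<mu> b a = (\<lambda>h. M - h) ` sides M \<mu> a b"
proof -
  have *: "(\<lambda>h. M - h) ` sides M \<mu> a b \<subseteq> sides M \<mu> b a" if "a \<in> M" "b \<in> M" for a b
    using that halfspaces_compl unfolding sides_def by auto
  moreover have "sides M \<mu> b a \<subseteq> (\<lambda>h. M - h) ` sides M \<mu> a b"
  proof
    fix h assume h: "h \<in> sides M \<mu> b a"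
    then have "M - h \<in> sides M \<mu> a b" using *[OF assms(2,1)] by blast
    moreover have "h = M - (M - h)" using h halfspaces_subset unfolding sides_def by blast
    ultimately show "h \<in> (\<lambda>h. M - h) ` sides M \<mu> a b" by blast
  qed
  ultimately show ?thesis using assms by blast
qed

lemma weight_compl: "h \<in> halfspaces M \<mu> \<Longrightarrow> weight M \<mu> (M - h) = weight M \<mu> h"
  unfolding weight_def using halfspaces_subset[of h M \<mu>] by (simp add: double_diff insert_commute)

lemma inj_on_compl: "inj_on (\<lambda>h. M - h) (sides M \<mu> a b)"
proof (rule inj_onI)
  fix h k assume "h \<in> sides M \<mu> a b" "k \<in> sides M \<mu> a b" and eq: "M - h = M - k"
  then have "h \<subseteq> M" "k \<subseteq> M" using halfspaces_subset[of h M \<mu>] halfspaces_subset[of k M \<mu>]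
    unfolding sides_def by auto
  then show "h = k" using eq by blast
qed

lemma d_mu_M_sym:
  assumes "a \<in> M" "b \<in> M"
  shows "d_mu_M M \<mu> b a = d_mu_M M \<mu> a b"
proof -
  have "(\<Sum>h\<in>sides M \<mu> a b. weight M \<mu> (M - h)) = (\<Sum>h\<in>sides M \<mu> a b. weight M \<mu> h)"
    by (rule sum.cong) (auto simp: weight_compl sides_def)
  moreover have "d_mu_M M \<mu> b a = (\<Sum>h\<in>sides M \<mu> a b. weight M \<mu> (M - h))"
    unfolding d_mu_M_eq[OF assms(2,1)] sides_swap[OF assms] by (simp add: sum.reindex[OF inj_on_compl])
  ultimately show ?thesis by (simp add: d_mu_M_eq[OF assms])
qed

text \<open>Traces of convex sets on a subset are convex for the restricted median. This compares
  the walls of nested subalgebras.\<close>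

lemma sides_restrict:
  assumes "k \<in> sides N \<mu> a b" "M \<subseteq> N" "a \<in> M" "b \<in> M"
  shows "k \<inter> M \<in> sides M \<mu> a b"
proof -
  have k: "k \<in> halfspaces N \<mu>" "a \<notin> k" "b \<in> k" using assms unfolding sides_def by auto
  have ci: "median_convex M \<mu> (C \<inter> M)" if "median_convex N \<mu> C" for C
    using that assms(2) unfolding median_convex_def median_interval_def by blast
  have "M - k \<inter> M = (N - k) \<inter> M" using assms(2) by blast
  then have "median_convex M \<mu> (k \<inter> M)" "median_convex M \<mu> (M - k \<inter> M)"
    using ci[of k] ci[of "N - k"] k(1) unfolding halfspaces_def by auto
  then show ?thesis using k assms(3,4) unfolding sides_def halfspaces_def by blast
qed

context median
begin

text \<open>Both parts of a wall are convex, and one of them contains at least two of the three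
  points. Thus membership in a halfspace is a median morphism to the two-point algebra.\<close>

lemma halfspace_majority:
  assumes h: "h \<in> halfspaces X \<mu>" and X: "a \<in> X" "b \<in> X" "c \<in> X"
  shows "\<mu> a b c \<in> h \<longleftrightarrow> a \<in> h \<and> b \<in> h \<or> a \<in> h \<and> c \<in> h \<or> b \<in> h \<and> c \<in> h"
proof -
  have *: "\<mu> a b c \<in> k"
    if k: "k \<subseteq> X" "median_convex X \<mu> k" and "a \<in> k \<and> b \<in> k \<or> a \<in> k \<and> c \<in> k \<or> b \<in> k \<and> c \<in> k" for k
    using that(3) convexD(1)[OF k(2,1) _ _ X(3)] convexD(2)[OF k(2,1) _ _ X(2)]
      convexD(3)[OF k(2,1) _ _ X(1)] by blast
  have "X - h \<subseteq> X" "h \<subseteq> X" "median_convex X \<mu> h" "median_convex X \<mu> (X - h)"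
    using h unfolding halfspaces_def by auto
  then show ?thesis using *[of h] *[of "X - h"] X by auto
qed

lemma sides_between:
  assumes "a \<in> X" "b \<in> X" "c \<in> X" "\<mu> a b c = c"
  shows "sides X \<mu> a b = sides X \<mu> a c \<union> sides X \<mu> c b" "sides X \<mu> a c \<inter> sides X \<mu> c b = {}"
proof -
  have "c \<in> h \<longleftrightarrow> a \<in> h \<and> b \<in> h \<or> a \<in> h \<and> c \<in> h \<or> b \<in> h \<and> c \<in> h" if "h \<in> halfspaces X \<mu>" for h
    using halfspace_majority[OF that assms(1-3)] assms(4) by simp
  then show "sides X \<mu> a b = sides X \<mu> a c \<union> sides X \<mu> c b"
    unfolding sides_def by blast
  show "sides X \<mu> a c \<inter> sides X \<mu> c b = {}" unfolding sides_def by blast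
qed

section \<open>Separation of points by halfspaces\<close>

lemma interval_trans:
  assumes "a \<in> X" "c \<in> X" "z \<in> X" "w \<in> X" "\<mu> a c z = z" "\<mu> a z w = w"
  shows "\<mu> a c w = w"
proof -
  have w: "\<mu> w a z = w" using assms(6) rotate[OF assms(4,1,3)] by simp
  have "\<mu> a c w = \<mu> (\<mu> w a z) a c" using w rotate[OF assms(4,1,2)] by simp
  also have "\<dots> = \<mu> w (\<mu> a a c) (\<mu> z a c)" by (rule distrib) (use assms in auto)
  also have "\<mu> z a c = z" using assms(5) rotate[OF assms(3,1,2)] by simp
  also have "\<mu> a a c = a" using assms by simp
  finally show ?thesis using w by simp
qed

text \<open>Choose \<open>c\<close> with the smallest interval to \<open>a\<close>. A third point of
  that interval would have a strictly smaller one, as it does not see \<open>c\<close>.\<close>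

lemma adjacent_exists:
  assumes "finite X" "a \<in> X" "b \<in> X" "a \<noteq> b"
  obtains c where "c \<in> X" "c \<noteq> a" "\<mu> a b c = c" "\<And>z. z \<in> X \<Longrightarrow> \<mu> a c z = z \<Longrightarrow> z = a \<or> z = c"
proof -
  define I where "I c = {z \<in> X. \<mu> a c z = z}" for c
  define P where "P c \<longleftrightarrow> c \<in> X \<and> c \<noteq> a \<and> \<mu> a b c = c" for c
  have "P b" unfolding P_def using assms by simp
  then obtain c where c: "P c" "\<And>c'. P c' \<Longrightarrow> card (I c) \<le> card (I c')"
    using ex_has_least_nat[of P b "\<lambda>c. card (I c)"] by blast
  have cX: "c \<in> X" "\<mu> a b c = c" using c(1) unfolding P_def by auto
  show thesis
  proof (rule that[of c])
    fix z assume z: "z \<in> X" "\<mu> a c z = z"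
    show "z = a \<or> z = c"
    proof (rule ccontr)
      assume ne: "\<not> (z = a \<or> z = c)"
      have "\<mu> a b z = z" by (rule interval_trans[OF assms(2,3) cX(1) z(1) cX(2) z(2)])
      then have "P z" using z ne unfolding P_def by simp
      have "I z \<subseteq> I c" unfolding I_def using interval_trans[OF assms(2) cX(1) z(1) _ z(2)] by blast
      moreover have "c \<in> I c" "c \<notin> I z"
        using cX assms(2) ne z commute_right[OF assms(2) cX(1) z(1)] unfolding I_def by auto
      ultimately have "I z \<subset> I c" by blast
      moreover have "finite (I c)" using assms(1) unfolding I_def by simp
      ultimately have "card (I z) < card (I c)" by (intro psubset_card_mono)
      then show False using c(2)[OF \<open>P z\<close>] by simp
    qed
  qed (use c(1) P_def in auto)
qed

text \<open>For \<open>c\<close> adjacent to \<open>a\<close>, the map \<open>\<mu> a c\<close> only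
  takes the values \<open>a\<close> and \<open>c\<close>. It is a median morphism by
  \<open>hom\<close>, so its two fibres are convex and form a wall; \<open>b\<close> lies over
  \<open>c\<close>.\<close>

lemma sides_nonempty:
  assumes "finite X" "a \<in> X" "b \<in> X" "a \<noteq> b"
  shows "sides X \<mu> a b \<noteq> {}"
proof -
  obtain c where c: "c \<in> X" "c \<noteq> a" "\<mu> a b c = c" "\<And>z. z \<in> X \<Longrightarrow> \<mu> a c z = z \<Longrightarrow> z = a \<or> z = c"
    using adjacent_exists[OF assms] by blast
  define h where "h = {u \<in> X. \<mu> a c u = c}"
  have two: "\<mu> a c u = a \<or> \<mu> a c u = c" if "u \<in> X" for u
    using c(4)[of "\<mu> a c u"] that c(1) assms(2) absorb by simp
  have conv: "median_convex X \<mu> {u \<in> X. \<mu> a c u = e}" if "e \<in> X" for e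
  proof -
    have "\<mu> a c (\<mu> u v w) = e" if "u \<in> X" "\<mu> a c u = e" "v \<in> X" "\<mu> a c v = e" "w \<in> X" for u v w
      using hom[OF that(1,3,5) assms(2) c(1)] that \<open>e \<in> X\<close> c(1) assms(2) by simp
    then show ?thesis by (subst convex_iff) auto
  qed
  have "X - h = {u \<in> X. \<mu> a c u = a}" unfolding h_def using two c(2) by auto
  moreover have "a \<in> X - h" "c \<in> h" unfolding h_def using assms(2) c by auto
  ultimately have "h \<in> halfspaces X \<mu>"
    using conv[OF assms(2)] conv[OF c(1)] unfolding halfspaces_def by (auto simp: h_def)
  moreover have "b \<in> h" unfolding h_def using assms c(1,3) commute_right[OF assms(2,3) c(1)] by simp
  ultimately have "h \<in> sides X \<mu> a b" using \<open>a \<in> X - h\<close> unfolding sides_def by simp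
  then show ?thesis by blast
qed

text \<open>Project a point of the symmetric difference to the interval of \<open>a\<close> and
  \<open>b\<close>. As \<open>a\<close> lies in neither set and \<open>b\<close> in both, majority
  leaves its memberships unchanged. This is the tool for cutting a pair into two pairs with fewer
  walls in between.\<close>

lemma sides_split:
  assumes h: "h \<in> sides X \<mu> a b" and k: "k \<in> sides X \<mu> a b" and ne: "h \<noteq> k" and X: "a \<in> X" "b \<in> X"
  obtains c where "c \<in> X" "\<mu> a b c = c" "c \<in> h \<and> c \<notin> k \<or> c \<in> k \<and> c \<notin> h"
proof -
  have hk: "h \<in> halfspaces X \<mu>" "k \<in> halfspaces X \<mu>" "a \<notin> h" "b \<in> h" "a \<notin> k" "b \<in> k"
    using h k unfolding sides_def by auto
  then obtain u where u: "u \<in> X" "u \<in> h \<and> u \<notin> k \<or> u \<in> k \<and> u \<notin> h"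
    using ne halfspaces_subset[of h X \<mu>] halfspaces_subset[of k X \<mu>] by blast
  show ?thesis
  proof (rule that[of "\<mu> a b u"])
    show "\<mu> a b (\<mu> a b u) = \<mu> a b u" by (rule absorb[OF X u(1)])
    show "\<mu> a b u \<in> h \<and> \<mu> a b u \<notin> k \<or> \<mu> a b u \<in> k \<and> \<mu> a b u \<notin> h"
      using halfspace_majority[OF hk(1) X u(1)] halfspace_majority[OF hk(2) X u(1)] hk u by blast
  qed (use X u in simp)
qed

end

section \<open>Edges, weights and the wall metric of a finite median algebra\<close>

locale finite_median = median M \<mu> for M :: "'a::metric_space set" and \<mu> +
  assumes finite: "finite M"
begin

lemma finite_halfspaces: "finite (halfspaces M \<mu>)"
  using finite by (rule finite_subset[rotated, OF finite_Pow_iff[THEN iffD2]]) (auto simp: halfspaces_def)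

lemma finite_sides: "finite (sides M \<mu> a b)"
  unfolding sides_def using finite_halfspaces by simp

text \<open>A pair across the wall with the fewest separating walls is an edge: a second wall would
  allow a cut, and one of the two shorter pairs is still separated by \<open>h\<close>. Hence the
  maximum defining the weight is taken over a nonempty set.\<close>

lemma edge_exists:
  assumes h: "h \<in> halfspaces M \<mu>"
  shows "\<exists>a\<in>M. \<exists>b\<in>M. sides M \<mu> a b = {h}"
proof -
  define P where "P p \<longleftrightarrow> fst p \<in> M \<and> snd p \<in> M \<and> h \<in> sides M \<mu> (fst p) (snd p)" for p
  define f where "f p = card (sides M \<mu> (fst p) (snd p))" for p
  obtain x y where "x \<in> M - h" "y \<in> h" using h unfolding halfspaces_def by blast
  then have "P (x, y)" using h halfspaces_subset[OF h] unfolding P_def sides_def by auto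
  then obtain p where p: "P p" "\<And>q. P q \<Longrightarrow> f p \<le> f q"
    using ex_has_least_nat[of P "(x, y)" f] by blast
  define a b where "a = fst p" and "b = snd p"
  have ab: "a \<in> M" "b \<in> M" "h \<in> sides M \<mu> a b" using p(1) unfolding P_def a_def b_def by auto
  have "k = h" if k: "k \<in> sides M \<mu> a b" for k
  proof (rule ccontr)
    assume "k \<noteq> h"
    then obtain c where c: "c \<in> M" "\<mu> a b c = c" "c \<in> h \<and> c \<notin> k \<or> c \<in> k \<and> c \<notin> h"
      using sides_split[OF ab(3) k _ ab(1,2)] by blast
    note sb = sides_between[OF ab(1,2) c(1,2)]
    have "\<exists>q. P q \<and> sides M \<mu> (fst q) (snd q) \<subset> sides M \<mu> a b"
    proof (cases "c \<in> h")
      case True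
      then have "h \<in> sides M \<mu> a c" "k \<notin> sides M \<mu> a c" using ab c unfolding sides_def by auto
      then have "P (a, c) \<and> sides M \<mu> a c \<subset> sides M \<mu> a b" using ab c k sb unfolding P_def by auto
      then show ?thesis by (intro exI[of _ "(a, c)"]) simp
    next
      case False
      then have "h \<in> sides M \<mu> c b" "k \<notin> sides M \<mu> c b" using ab c unfolding sides_def by auto
      then have "P (c, b) \<and> sides M \<mu> c b \<subset> sides M \<mu> a b" using ab c k sb unfolding P_def by auto
      then show ?thesis by (intro exI[of _ "(c, b)"]) simp
    qed
    then obtain q where "P q" "sides M \<mu> (fst q) (snd q) \<subset> sides M \<mu> a b" by blast
    then have "f q < f p" unfolding f_def a_def b_def by (intro psubset_card_mono finite_sides)
    then show False using p(2)[OF \<open>P q\<close>] by simp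
  qed
  then have "sides M \<mu> a b = {h}" using ab by blast
  then show ?thesis using ab by blast
qed

text \<open>An edge may cross the wall in either direction; reversing it keeps its length and
  changes \<open>{M - h}\<close> into \<open>{h}\<close>, so oriented edges suffice.\<close>

lemma weight_eq:
  assumes h: "h \<in> halfspaces M \<mu>"
  shows "weight M \<mu> h = Max {dist a b | a b. a \<in> M \<and> b \<in> M \<and> sides M \<mu> a b = {h}}"
proof -
  have hM: "h \<subseteq> M" by (rule halfspaces_subset[OF h])
  have dd: "M - (M - h) = h" using hM by (rule double_diff) simp
  have swap: "sides M \<mu> b a = {h}" if "a \<in> M" "b \<in> M" "sides M \<mu> a b = {M - h}" for a b
    using sides_swap[OF that(1,2)] that(3) dd by simp
  have iff: "cc_edge M \<mu> a b \<and> separates {h, M - h} a b \<longleftrightarrow>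
      a \<in> M \<and> b \<in> M \<and> (sides M \<mu> a b = {h} \<or> sides M \<mu> a b = {M - h})" for a b
  proof
    assume *: "cc_edge M \<mu> a b \<and> separates {h, M - h} a b"
    then have ab: "a \<in> M" "b \<in> M" and c1: "card (sides M \<mu> a b) = 1" unfolding cc_edge_iff by auto
    then obtain k where k: "sides M \<mu> a b = {k}" by (metis card_1_singletonE)
    have "h \<in> sides M \<mu> a b \<or> M - h \<in> sides M \<mu> a b"
      using * ab h halfspaces_compl[OF h] unfolding separates_def sides_def by auto
    then show "a \<in> M \<and> b \<in> M \<and> (sides M \<mu> a b = {h} \<or> sides M \<mu> a b = {M - h})" using ab k by auto
  next
    assume *: "a \<in> M \<and> b \<in> M \<and> (sides M \<mu> a b = {h} \<or> sides M \<mu> a b = {M - h})"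
    then have "h \<in> sides M \<mu> a b \<or> M - h \<in> sides M \<mu> a b" by auto
    then have "separates {h, M - h} a b" using * unfolding separates_def sides_def by auto
    then show "cc_edge M \<mu> a b \<and> separates {h, M - h} a b" using * unfolding cc_edge_iff by auto
  qed
  have "{dist a b | a b. cc_edge M \<mu> a b \<and> separates {h, M - h} a b}
      = {dist a b | a b. a \<in> M \<and> b \<in> M \<and> sides M \<mu> a b = {h}}" (is "?L = ?R")
  proof
    show "?L \<subseteq> ?R"
    proof
      fix r assume "r \<in> ?L"
      then obtain a b where ab: "r = dist a b" "a \<in> M" "b \<in> M" "sides M \<mu> a b = {h} \<or> sides M \<mu> a b = {M - h}"
        unfolding iff by blast
      from ab(4) show "r \<in> ?R"
      proof
        assume "sides M \<mu> a b = {h}"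
        then show ?thesis using ab(1-3) by blast
      next
        assume "sides M \<mu> a b = {M - h}"
        then have "sides M \<mu> b a = {h}" by (rule swap[OF ab(2,3)])
        moreover have "r = dist b a" using ab(1) by (simp add: dist_commute)
        ultimately show ?thesis using ab(2,3) by blast
      qed
    qed
    show "?R \<subseteq> ?L" unfolding iff by auto
  qed
  then show ?thesis unfolding weight_def lambda_max_def by simp
qed

lemma finite_edge_lengths: "finite {dist a b | a b. a \<in> M \<and> b \<in> M \<and> sides M \<mu> a b = {h}}"
  by (rule finite_subset[of _ "(\<lambda>(a, b). dist a b) ` (M \<times> M)"]) (use finite in auto)

lemma weight_attained:
  assumes h: "h \<in> halfspaces M \<mu>"
  shows "\<exists>a\<in>M. \<exists>b\<in>M. sides M \<mu> a b = {h} \<and> weight M \<mu> h = dist a b"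
proof -
  have "{dist a b | a b. a \<in> M \<and> b \<in> M \<and> sides M \<mu> a b = {h}} \<noteq> {}"
    using edge_exists[OF h] by blast
  from Max_in[OF finite_edge_lengths this] show ?thesis unfolding weight_eq[OF h] by blast
qed

lemma weight_ge:
  assumes "a \<in> M" "b \<in> M" "sides M \<mu> a b = {h}"
  shows "dist a b \<le> weight M \<mu> h"
proof -
  have "h \<in> halfspaces M \<mu>" using assms(3) unfolding sides_def by auto
  then have eq: "weight M \<mu> h = Max {dist a b | a b. a \<in> M \<and> b \<in> M \<and> sides M \<mu> a b = {h}}"
    by (rule weight_eq)
  have "dist a b \<in> {dist a b | a b. a \<in> M \<and> b \<in> M \<and> sides M \<mu> a b = {h}}"
    using assms by blast
  from Max_ge[OF finite_edge_lengths this] show ?thesis unfolding eq .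
qed

lemma weight_nonneg: "h \<in> halfspaces M \<mu> \<Longrightarrow> 0 \<le> weight M \<mu> h"
  using weight_attained[of h] zero_le_dist by metis

text \<open>Cut the pair at points of its interval until only edges remain. Wall sums are additive
  under such cuts, \<open>dist\<close> is subadditive, and the length of an edge is at most the
  weight of its wall.\<close>

lemma dist_le_d_mu_M:
  assumes "a \<in> M" "b \<in> M"
  shows "dist a b \<le> d_mu_M M \<mu> a b"
proof -
  have "dist a b \<le> (\<Sum>h\<in>sides M \<mu> a b. weight M \<mu> h)" if "a \<in> M" "b \<in> M" "card (sides M \<mu> a b) = n" for n a b
    using that
  proof (induction n arbitrary: a b rule: less_induct)
    case (less n)
    consider "n = 0" | "n = 1" | "n \<ge> 2" by linarith
    then show ?case
    proof cases
      case 1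
      then have "sides M \<mu> a b = {}" using less.prems(3) finite_sides by simp
      then show ?thesis using sides_nonempty[OF finite less.prems(1,2)] by (cases "a = b") auto
    next
      case 2
      then obtain h where "sides M \<mu> a b = {h}" using less.prems(3) by (metis card_1_singletonE)
      then show ?thesis using weight_ge[OF less.prems(1,2)] by simp
    next
      case 3
      then obtain h k where hk: "h \<in> sides M \<mu> a b" "k \<in> sides M \<mu> a b" "h \<noteq> k"
        using less.prems(3) by (metis card_le_Suc0_iff_eq finite_sides not_less_eq_eq numeral_2_eq_2)
      then obtain c where c: "c \<in> M" "\<mu> a b c = c" "c \<in> h \<and> c \<notin> k \<or> c \<in> k \<and> c \<notin> h"
        using sides_split[OF hk less.prems(1,2)] by blast
      note sb = sides_between[OF less.prems(1,2) c(1,2)]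
      have "h \<in> sides M \<mu> a c \<and> h \<notin> sides M \<mu> c b \<and> k \<in> sides M \<mu> c b \<and> k \<notin> sides M \<mu> a c \<or>
          k \<in> sides M \<mu> a c \<and> k \<notin> sides M \<mu> c b \<and> h \<in> sides M \<mu> c b \<and> h \<notin> sides M \<mu> a c"
        using hk c(3) unfolding sides_def by auto
      then have "sides M \<mu> a c \<subset> sides M \<mu> a b" "sides M \<mu> c b \<subset> sides M \<mu> a b" using sb by auto
      then have "card (sides M \<mu> a c) < n" "card (sides M \<mu> c b) < n"
        using less.prems(3) finite_sides psubset_card_mono by metis+
      then have "dist a c \<le> (\<Sum>h\<in>sides M \<mu> a c. weight M \<mu> h)" "dist c b \<le> (\<Sum>h\<in>sides M \<mu> c b. weight M \<mu> h)"
        using less.IH less.prems c(1) by auto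
      moreover have "(\<Sum>h\<in>sides M \<mu> a b. weight M \<mu> h)
          = (\<Sum>h\<in>sides M \<mu> a c. weight M \<mu> h) + (\<Sum>h\<in>sides M \<mu> c b. weight M \<mu> h)"
        unfolding sb(1) by (rule sum.union_disjoint[OF finite_sides finite_sides sb(2)])
      ultimately show ?thesis using dist_triangle[of a b c] by linarith
    qed
  qed
  then show ?thesis using assms by (simp add: d_mu_M_eq)
qed

lemma d_mu_M_between:
  assumes "a \<in> M" "b \<in> M" "c \<in> M" "\<mu> a b c = c"
  shows "d_mu_M M \<mu> a b = d_mu_M M \<mu> a c + d_mu_M M \<mu> c b"
  using sides_between[OF assms] assms
  by (simp add: d_mu_M_eq sum.union_disjoint finite_sides)

lemma d_mu_M_triangle:
  assumes "a \<in> M" "b \<in> M" "c \<in> M"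
  shows "d_mu_M M \<mu> a b \<le> d_mu_M M \<mu> a c + d_mu_M M \<mu> c b"
proof -
  have "sides M \<mu> a b \<subseteq> sides M \<mu> a c \<union> sides M \<mu> c b" unfolding sides_def by blast
  moreover have nn: "0 \<le> weight M \<mu> h" if "h \<in> sides M \<mu> x y" for h x y
    using that weight_nonneg unfolding sides_def by blast
  ultimately have "(\<Sum>h\<in>sides M \<mu> a b. weight M \<mu> h) \<le> (\<Sum>h\<in>sides M \<mu> a c \<union> sides M \<mu> c b. weight M \<mu> h)"
    by (intro sum_mono2) (auto simp: finite_sides)
  also have "\<dots> = (\<Sum>h\<in>sides M \<mu> a c. weight M \<mu> h) + (\<Sum>h\<in>sides M \<mu> c b. weight M \<mu> h)"
    by (rule sum.union_disjoint[OF finite_sides finite_sides]) (auto simp: sides_def)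
  finally show ?thesis using assms by (simp add: d_mu_M_eq)
qed

text \<open>Let an edge of \<open>M\<close> realise the weight of \<open>h\<close>. All walls of
  \<open>N\<close> separating its ends have trace \<open>h\<close> on \<open>M\<close>, and by
  \<open>dist_le_d_mu_M\<close> their weights add up to at least the length of the edge. Grouping
  the walls of \<open>N\<close> by their traces gives the claim.\<close>

lemma d_mu_M_mono:
  assumes "finite_median N \<mu>" "M \<subseteq> N" "x \<in> M" "y \<in> M"
  shows "d_mu_M M \<mu> x y \<le> d_mu_M N \<mu> x y"
proof -
  interpret N: finite_median N \<mu> by fact
  define T where "T h = {k \<in> sides N \<mu> x y. k \<inter> M = h}" for h
  have "weight M \<mu> h \<le> sum (weight N \<mu>) (T h)" if h: "h \<in> sides M \<mu> x y" for h
  proof -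
    have "h \<in> halfspaces M \<mu>" using h unfolding sides_def by blast
    then obtain a b where ab: "a \<in> M" "b \<in> M" "sides M \<mu> a b = {h}" "weight M \<mu> h = dist a b"
      using weight_attained by blast
    then have abN: "a \<in> N" "b \<in> N" using assms(2) by auto
    have "dist a b \<le> sum (weight N \<mu>) (sides N \<mu> a b)"
      using N.dist_le_d_mu_M[OF abN] abN by (simp add: d_mu_M_eq)
    also have "\<dots> \<le> sum (weight N \<mu>) (T h)"
    proof (rule sum_mono2)
      show "finite (T h)" unfolding T_def using N.finite_sides by simp
      show "sides N \<mu> a b \<subseteq> T h"
      proof
        fix k assume k: "k \<in> sides N \<mu> a b"
        then have "k \<inter> M = h" using sides_restrict[OF k assms(2) ab(1,2)] ab(3) by simp
        moreover have "x \<notin> h" "y \<in> h" using h unfolding sides_def by auto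
        ultimately show "k \<in> T h" using k assms(3,4) unfolding T_def sides_def by auto
      qed
      show "0 \<le> weight N \<mu> k" if "k \<in> T h - sides N \<mu> a b" for k
        using that N.weight_nonneg unfolding T_def sides_def by blast
    qed
    finally show ?thesis using ab(4) by simp
  qed
  then have "(\<Sum>h\<in>sides M \<mu> x y. weight M \<mu> h) \<le> (\<Sum>h\<in>sides M \<mu> x y. sum (weight N \<mu>) (T h))"
    by (rule sum_mono)
  also have "\<dots> = sum (weight N \<mu>) (sides N \<mu> x y)"
    unfolding T_def
    by (rule sum.group) (use sides_restrict[OF _ assms(2-4)] finite_sides N.finite_sides in auto)
  finally show ?thesis using assms by (simp add: d_mu_M_eq subset_iff)
qed

end

section \<open>Finite subalgebras and the rectified metric\<close>

context median
begin

lemma median_subalgebra: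
  assumes "subalgebra X \<mu> M"
  shows "median M \<mu>"
proof
  have M: "M \<subseteq> X" "\<And>x y z. x \<in> M \<Longrightarrow> y \<in> M \<Longrightarrow> z \<in> M \<Longrightarrow> \<mu> x y z \<in> M"
    using assms unfolding subalgebra_def by auto
  then have X: "x \<in> X" if "x \<in> M" for x using that by blast
  show "median_algebra M \<mu>"
    unfolding median_algebra_def
  proof (intro conjI ballI)
    fix x y z u v assume "x \<in> M" "y \<in> M" "z \<in> M"
    then show "\<mu> x y z \<in> M" by (rule M(2))
    show "\<mu> x y z = \<mu> x z y" by (intro commute_right X) fact+
    show "\<mu> x y z = \<mu> y z x" by (intro rotate X) fact+
    assume "u \<in> M" "v \<in> M"
    show "\<mu> (\<mu> x y z) u v = \<mu> x (\<mu> y u v) (\<mu> z u v)" by (intro distrib X) fact+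
  next
    fix x y assume "x \<in> M" "y \<in> M"
    then show "\<mu> x x y = x" by (simp add: X)
  qed
qed

text \<open>\<open>\<mu> p\<close> is the meet of a semilattice. Medians distribute over these meets, and so the meet
  closure of a subalgebra together with \<open>p\<close> is a subalgebra.\<close>
inductive_set meets :: "'a \<Rightarrow> 'a set \<Rightarrow> 'a set" for p M where
  base: "u \<in> M \<Longrightarrow> u \<in> meets p M"
| meet: "u \<in> meets p M \<Longrightarrow> v \<in> meets p M \<Longrightarrow> \<mu> p u v \<in> meets p M"

lemma meets_subset: "p \<in> X \<Longrightarrow> M \<subseteq> X \<Longrightarrow> meets p M \<subseteq> X"
proof
  fix u assume pM: "p \<in> X" "M \<subseteq> X" and "u \<in> meets p M"
  from this(3) show "u \<in> X" by induction (use pM in auto)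
qed

lemma meet_commute: "\<lbrakk>p \<in> X; u \<in> X; v \<in> X\<rbrakk> \<Longrightarrow> \<mu> p u v = \<mu> p v u"
  by (rule commute_right)

lemma meet_assoc:
  assumes "p \<in> X" "u \<in> X" "v \<in> X" "w \<in> X"
  shows "\<mu> p (\<mu> p u v) w = \<mu> p u (\<mu> p v w)"
proof -
  have 1: "\<mu> p u v = \<mu> u p v" "\<mu> v p w = \<mu> p v w" by (rule commute_left; use assms in simp)+
  have "\<mu> p (\<mu> u p v) w = \<mu> (\<mu> u p v) p w" by (rule commute_left) (use assms in auto)
  also have "\<dots> = \<mu> u (\<mu> p p w) (\<mu> v p w)" by (rule distrib) (use assms in auto)
  also have "\<mu> p p w = p" using assms by simp
  also have "\<mu> u p (\<mu> v p w) = \<mu> p u (\<mu> v p w)" by (rule commute_left) (use assms in auto)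
  finally show ?thesis unfolding 1 .
qed

text \<open>Meets are associative, commutative and idempotent, so \<open>a\<close> need occur at
  most once in a meet. Adding one generator therefore keeps the closure finite.\<close>

lemma meets_insert:
  assumes p: "p \<in> X" and F: "F \<subseteq> X" and a: "a \<in> X"
  shows "meets p (insert a F) \<subseteq> meets p F \<union> {a} \<union> \<mu> p a ` meets p F" (is "_ \<subseteq> ?R")
proof
  have S: "s \<in> X" if "s \<in> meets p F" for s using meets_subset[OF p F] that by blast
  have 1: "\<mu> p s a \<in> ?R" "\<mu> p a s \<in> ?R" if "s \<in> meets p F" for s
    using that meet_commute[OF p S[OF that] a] by auto
  have 2: "\<mu> p a (\<mu> p a s) \<in> ?R" "\<mu> p (\<mu> p a s) a \<in> ?R" if s: "s \<in> meets p F" for s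
  proof -
    have "\<mu> p a (\<mu> p a s) = \<mu> p a s" by (rule absorb[OF p a S[OF s]])
    moreover have "\<mu> p (\<mu> p a s) a = \<mu> p a (\<mu> p a s)" by (rule meet_commute) (use p a S[OF s] in auto)
    ultimately show "\<mu> p a (\<mu> p a s) \<in> ?R" "\<mu> p (\<mu> p a s) a \<in> ?R" using s by auto
  qed
  have 3: "\<mu> p (\<mu> p a s) t \<in> ?R" "\<mu> p t (\<mu> p a s) \<in> ?R" "\<mu> p (\<mu> p a s) (\<mu> p a t) \<in> ?R"
    if st: "s \<in> meets p F" "t \<in> meets p F" for s t
  proof -
    have X: "s \<in> X" "t \<in> X" using S st by auto
    have e: "\<mu> p (\<mu> p a s) t = \<mu> p a (\<mu> p s t)" by (rule meet_assoc[OF p a X])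
    have e': "\<mu> p t (\<mu> p a s) = \<mu> p (\<mu> p a s) t" by (rule meet_commute) (use p a X in auto)
    have "\<mu> p (\<mu> p a s) (\<mu> p a t) = \<mu> p a (\<mu> p s (\<mu> p a t))" by (rule meet_assoc) (use p a X in auto)
    also have "\<mu> p s (\<mu> p a t) = \<mu> p (\<mu> p s a) t" by (rule meet_assoc[symmetric, OF p X(1) a X(2)])
    also have "\<mu> p s a = \<mu> p a s" by (rule meet_commute[OF p X(1) a])
    also have "\<mu> p a (\<mu> p (\<mu> p a s) t) = \<mu> p a (\<mu> p a (\<mu> p s t))" by (simp only: e)
    also have "\<dots> = \<mu> p a (\<mu> p s t)" by (rule absorb) (use p a X in auto)
    finally have e'': "\<mu> p (\<mu> p a s) (\<mu> p a t) = \<mu> p a (\<mu> p s t)" .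
    have "\<mu> p s t \<in> meets p F" by (rule meets.meet[OF st])
    then show "\<mu> p (\<mu> p a s) t \<in> ?R" "\<mu> p t (\<mu> p a s) \<in> ?R" "\<mu> p (\<mu> p a s) (\<mu> p a t) \<in> ?R"
      unfolding e' e e'' by auto
  qed
  fix u assume "u \<in> meets p (insert a F)"
  then show "u \<in> ?R"
  proof induction
    case (base u)
    then show ?case using meets.base by blast
  next
    case (meet u v)
    from meet.IH(1) consider (S) "u \<in> meets p F" | (a) "u = a" | (m) s where "s \<in> meets p F" "u = \<mu> p a s" by blast
    then show ?case
    proof cases
      case S
      from meet.IH(2) show ?thesis using S 1[OF S] 3(2)[OF _ S] meets.meet[OF S] by blast
    next
      case a
      have "\<mu> p a a = a" using p assms(3) by simp
      with meet.IH(2) show ?thesis unfolding a using 1 2 by auto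
    next
      case m
      from meet.IH(2) show ?thesis unfolding m(2) using 2(2)[OF m(1)] 3(1,3)[OF m(1)] by blast
    qed
  qed
qed

lemma finite_meets:
  assumes "finite F" "p \<in> X" "F \<subseteq> X"
  shows "finite (meets p F)"
  using assms(1,3)
proof (induction F rule: finite_induct)
  case empty
  have "u \<notin> meets p {}" for u
  proof
    assume "u \<in> meets p {}"
    then show False by induction auto
  qed
  then show ?case by (metis finite.emptyI equals0I)
next
  case (insert a F)
  then show ?case using meets_insert[of p F a] assms(2) by (simp add: finite_subset)
qed

text \<open>Distributivity breaks up a meet in one argument while the others stay fixed. Three
  inductions release the arguments from \<open>M\<close> one after the other.\<close>

lemma meets_median:
  assumes M: "subalgebra X \<mu> M" and p: "p \<in> X"
    and "s \<in> meets p M" "t \<in> meets p M" "r \<in> meets p M"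
  shows "\<mu> s t r \<in> meets p M"
proof -
  have MX: "M \<subseteq> X" and Mc: "\<And>x y z. x \<in> M \<Longrightarrow> y \<in> M \<Longrightarrow> z \<in> M \<Longrightarrow> \<mu> x y z \<in> M"
    using M unfolding subalgebra_def by auto
  have S: "s \<in> X" if "s \<in> meets p M" for s using meets_subset[OF p MX] that by blast
  have d: "\<mu> (\<mu> p u u') v w \<in> meets p M"
    if "u \<in> X" "u' \<in> X" "v \<in> X" "w \<in> X" "\<mu> u v w \<in> meets p M" "\<mu> u' v w \<in> meets p M" for u u' v w
    using distrib[OF p that(1-4)] meets.meet[OF that(5,6)] by simp
  have 1: "\<mu> s v w \<in> meets p M" if "s \<in> meets p M" "v \<in> M" "w \<in> M" for s v w
    using that(1)
  proof induction
    case (base u)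
    then show ?case using Mc that by (blast intro: meets.base)
  next
    case (meet u u')
    then show ?case using d[of u u' v w] S that MX by blast
  qed
  have 2: "\<mu> t s w \<in> meets p M" if "t \<in> meets p M" "s \<in> meets p M" "w \<in> M" for s t w
    using that(1)
  proof induction
    case (base u)
    have "\<mu> u s w = \<mu> s u w" by (rule commute_left) (use base MX S that in auto)
    then show ?case using 1[OF that(2) base that(3)] by simp
  next
    case (meet u u')
    then show ?case using d[of u u' s w] S that MX by blast
  qed
  have "\<mu> r s t \<in> meets p M"
    using assms(5)
  proof induction
    case (base u)
    have "\<mu> u s t = \<mu> s t u" by (rule rotate) (use base MX S assms in auto)
    then show ?case using 2[OF assms(3,4) base] by simp
  next
    case (meet u u')
    then show ?case using d[of u u' s t] S assms by blast
  qed
  moreover have "\<mu> r s t = \<mu> s t r" by (rule rotate) (use S assms in auto)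
  ultimately show ?thesis by simp
qed

text \<open>The only medians not covered by \<open>meets_median\<close> involve \<open>p\<close>
  itself, and these are meets or trivial. By iteration every finite set lies in a finite
  subalgebra.\<close>

lemma extend_subalgebra:
  assumes M: "M \<in> finite_subalgebras X \<mu>" and p: "p \<in> X"
  shows "\<exists>N\<in>finite_subalgebras X \<mu>. insert p M \<subseteq> N"
proof
  have sM: "subalgebra X \<mu> M" and fM: "finite M" and MX: "M \<subseteq> X"
    using M unfolding finite_subalgebras_def subalgebra_def by auto
  have S: "s \<in> X" if "s \<in> meets p M" for s using meets_subset[OF p MX] that by blast
  let ?N = "insert p (meets p M)"
  show "insert p M \<subseteq> ?N" using meets.base by blast
  have pst: "\<mu> p s t \<in> ?N" if st: "s \<in> ?N" "t \<in> ?N" for s t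
  proof -
    consider "s = p" | "t = p" | "s \<in> meets p M" "t \<in> meets p M" using st by blast
    then show ?thesis
    proof cases
      case 1
      then show ?thesis using st p S by auto
    next
      case 2
      then show ?thesis using st p S by auto
    next
      case 3
      then show ?thesis using meets.meet by blast
    qed
  qed
  have NX: "s \<in> X" if "s \<in> ?N" for s using that S p by blast
  have "\<mu> s t r \<in> ?N" if str: "s \<in> ?N" "t \<in> ?N" "r \<in> ?N" for s t r
  proof -
    consider "s = p" | "t = p" | "r = p" | "s \<in> meets p M" "t \<in> meets p M" "r \<in> meets p M" using str by blast
    then show ?thesis
    proof cases
      case 1
      then show ?thesis using pst str by blast
    next
      case 2
      then show ?thesis using pst[OF str(1,3)] commute_left[OF NX NX NX, OF str] by simp
    next
      case 3
      then show ?thesis using pst[OF str(1,2)] rotate[OF p NX[OF str(1)] NX[OF str(2)]] by simp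
    next
      case 4
      then show ?thesis using meets_median[OF sM p] by blast
    qed
  qed
  then have "subalgebra X \<mu> ?N" using NX unfolding subalgebra_def by blast
  then show "?N \<in> finite_subalgebras X \<mu>" using finite_meets[OF fM p MX] unfolding finite_subalgebras_def by simp
qed

lemma finite_subalgebra_exists:
  assumes "finite A" "A \<subseteq> X"
  shows "\<exists>M\<in>finite_subalgebras X \<mu>. A \<subseteq> M"
  using assms
proof (induction A rule: finite_induct)
  case empty
  have "{} \<in> finite_subalgebras X \<mu>" unfolding finite_subalgebras_def subalgebra_def by simp
  then show ?case by blast
next
  case (insert a A)
  then obtain M where "M \<in> finite_subalgebras X \<mu>" "A \<subseteq> M" by auto
  then show ?case using extend_subalgebra[of M a] insert.prems by (meson insert_subset order_trans)
qed

end

section \<open>Transport of the wall metric along isometric isomorphisms\<close>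

context finite_median
begin

lemma d_mu_M_image:
  assumes im: "finite_median (g ` M) \<mu>" and inj: "inj_on g M"
    and mor: "\<And>x y z. x \<in> M \<Longrightarrow> y \<in> M \<Longrightarrow> z \<in> M \<Longrightarrow> g (\<mu> x y z) = \<mu> (g x) (g y) (g z)"
    and iso: "\<And>x y. x \<in> M \<Longrightarrow> y \<in> M \<Longrightarrow> dist (g x) (g y) = dist x y"
    and xy: "x \<in> M" "y \<in> M"
  shows "d_mu_M (g ` M) \<mu> (g x) (g y) = d_mu_M M \<mu> x y"
proof -
  interpret I: finite_median "g ` M" \<mu> by (rule im)
  have mem: "g u \<in> g ` h \<longleftrightarrow> u \<in> h" if "u \<in> M" "h \<subseteq> M" for u h
    using inj that by (meson inj_on_image_mem_iff)
  have conv: "median_convex (g ` M) \<mu> (g ` h) \<longleftrightarrow> median_convex M \<mu> h" if h: "h \<subseteq> M" for h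
  proof -
    have e: "\<mu> (g a) (g b) (g w) = g w \<longleftrightarrow> \<mu> a b w = w" if "a \<in> M" "b \<in> M" "w \<in> M" for a b w
      using mor[OF that, symmetric] inj_on_eq_iff[OF inj] that by simp
    have "median_convex (g ` M) \<mu> (g ` h) \<longleftrightarrow> (\<forall>a\<in>h. \<forall>b\<in>h. \<forall>w\<in>M. \<mu> (g a) (g b) (g w) = g w \<longrightarrow> g w \<in> g ` h)"
      unfolding median_convex_def median_interval_def by blast
    also have "\<dots> \<longleftrightarrow> (\<forall>a\<in>h. \<forall>b\<in>h. \<forall>w\<in>M. \<mu> a b w = w \<longrightarrow> w \<in> h)"
      using h by (intro ball_cong refl) (simp add: e mem subset_iff)
    also have "\<dots> \<longleftrightarrow> median_convex M \<mu> h" unfolding median_convex_def median_interval_def by blast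
    finally show ?thesis .
  qed
  have half: "g ` h \<in> halfspaces (g ` M) \<mu> \<longleftrightarrow> h \<in> halfspaces M \<mu>" if h: "h \<subseteq> M" for h
  proof -
    have e: "g ` M - g ` h = g ` (M - h)" using inj h by (simp add: inj_on_image_set_diff)
    have "g ` h \<subseteq> g ` M" using h by blast
    then show ?thesis
      unfolding halfspaces_def mem_Collect_eq e using h by (simp add: conv)
  qed
  have sides: "sides (g ` M) \<mu> (g a) (g b) = (`) g ` sides M \<mu> a b" if ab: "a \<in> M" "b \<in> M" for a b
  proof
    show "(`) g ` sides M \<mu> a b \<subseteq> sides (g ` M) \<mu> (g a) (g b)"
    proof (rule image_subsetI)
      fix h assume h: "h \<in> sides M \<mu> a b"
      then have "h \<subseteq> M" using halfspaces_subset unfolding sides_def by blast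
      then show "g ` h \<in> sides (g ` M) \<mu> (g a) (g b)" using h half[of h] mem[of a h] mem[of b h] ab
        unfolding sides_def by auto
    qed
    show "sides (g ` M) \<mu> (g a) (g b) \<subseteq> (`) g ` sides M \<mu> a b"
    proof
      fix k assume k: "k \<in> sides (g ` M) \<mu> (g a) (g b)"
      then have "k \<subseteq> g ` M" using halfspaces_subset unfolding sides_def by blast
      then obtain h where h: "h \<subseteq> M" "k = g ` h" by (meson subset_image_iff)
      then have "h \<in> sides M \<mu> a b" using k half[of h] mem[of a h] mem[of b h] ab unfolding sides_def by auto
      then show "k \<in> (`) g ` sides M \<mu> a b" using h by blast
    qed
  qed
  have inj2: "inj_on ((`) g) (Pow M)" using inj by (rule inj_on_image_Pow)
  have sidesPow: "sides M \<mu> a b \<subseteq> Pow M" for a b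
    using halfspaces_subset unfolding sides_def by blast
  have w: "weight (g ` M) \<mu> (g ` h) = weight M \<mu> h" if h: "h \<in> halfspaces M \<mu>" for h
  proof -
    have hM: "h \<subseteq> M" by (rule halfspaces_subset[OF h])
    have e: "sides (g ` M) \<mu> (g a) (g b) = {g ` h} \<longleftrightarrow> sides M \<mu> a b = {h}" if "a \<in> M" "b \<in> M" for a b
      unfolding sides[OF that] using inj_on_image_eq_iff[OF inj2 sidesPow, of "{h}" a b] hM by simp
    have "{dist a b | a b. a \<in> g ` M \<and> b \<in> g ` M \<and> sides (g ` M) \<mu> a b = {g ` h}}
        = {dist (g a) (g b) | a b. a \<in> M \<and> b \<in> M \<and> sides (g ` M) \<mu> (g a) (g b) = {g ` h}}" by blast
    also have "\<dots> = {dist a b | a b. a \<in> M \<and> b \<in> M \<and> sides M \<mu> a b = {h}}"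
    proof (intro Collect_cong ex_cong1)
      fix r a b
      show "(r = dist (g a) (g b) \<and> a \<in> M \<and> b \<in> M \<and> sides (g ` M) \<mu> (g a) (g b) = {g ` h}) \<longleftrightarrow>
          (r = dist a b \<and> a \<in> M \<and> b \<in> M \<and> sides M \<mu> a b = {h})"
      proof (cases "a \<in> M \<and> b \<in> M")
        case True
        then have "a \<in> M" "b \<in> M" by auto
        then show ?thesis by (simp only: e iso)
      next
        case False
        then show ?thesis by blast
      qed
    qed
    finally show ?thesis using weight_eq[OF h] I.weight_eq[of "g ` h"] half[OF hM] h by simp
  qed
  have "d_mu_M (g ` M) \<mu> (g x) (g y) = (\<Sum>h\<in>(`) g ` sides M \<mu> x y. weight (g ` M) \<mu> h)"
    using xy by (simp add: d_mu_M_eq sides)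
  also have "\<dots> = (\<Sum>h\<in>sides M \<mu> x y. weight (g ` M) \<mu> (g ` h))"
    by (rule sum.reindex_cong[OF inj_on_subset[OF inj2 sidesPow]]) auto
  also have "\<dots> = d_mu_M M \<mu> x y" using xy w by (simp add: d_mu_M_eq sides_def)
  finally show ?thesis .
qed

end

section \<open>The supremum of the wall metrics\<close>

locale rectifiable = median X \<mu> for X :: "'a::metric_space set" and \<mu> +
  fixes L :: real
  assumes bound: "\<lbrakk>x \<in> X; y \<in> X\<rbrakk> \<Longrightarrow> d_mu X \<mu> x y \<le> ereal (L * dist x y)"
begin

lemma finite_median_subalgebra: "M \<in> finite_subalgebras X \<mu> \<Longrightarrow> finite_median M \<mu>"
  unfolding finite_subalgebras_def finite_median_def finite_median_axioms_def
  using median_subalgebra by blast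

text \<open>A real counterpart of \<open>d_mu\<close>. The supremum is meaningful on
  \<open>X\<close> because uniform rectifiability bounds the family, see
  \<open>d_mu_M_bound\<close>.\<close>

definition \<rho> :: "'a \<Rightarrow> 'a \<Rightarrow> real" where
  "\<rho> x y = (SUP M\<in>finite_subalgebras X \<mu>. d_mu_M M \<mu> x y)"

lemma d_mu_M_bound:
  assumes "x \<in> X" "y \<in> X" "M \<in> finite_subalgebras X \<mu>"
  shows "d_mu_M M \<mu> x y \<le> L * dist x y"
proof -
  have "ereal (d_mu_M M \<mu> x y) \<le> d_mu X \<mu> x y" unfolding d_mu_def using assms(3) by (rule SUP_upper)
  then show ?thesis using bound[OF assms(1,2)] by (meson ereal_less_eq(3) order_trans)
qed

lemma \<rho>_ge:
  assumes "x \<in> X" "y \<in> X" "M \<in> finite_subalgebras X \<mu>"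
  shows "d_mu_M M \<mu> x y \<le> \<rho> x y"
proof -
  have "bdd_above ((\<lambda>M. d_mu_M M \<mu> x y) ` finite_subalgebras X \<mu>)"
    by (rule bdd_aboveI2[where M = "L * dist x y"]) (rule d_mu_M_bound[OF assms(1,2)])
  then show ?thesis unfolding \<rho>_def by (rule cSUP_upper[OF assms(3)])
qed

lemma \<rho>_le_dist: "\<lbrakk>x \<in> X; y \<in> X\<rbrakk> \<Longrightarrow> \<rho> x y \<le> L * dist x y"
  unfolding \<rho>_def using finite_subalgebra_exists[of "{}"] by (intro cSUP_least d_mu_M_bound) auto

lemma d_mu_M_subset:
  assumes "M \<in> finite_subalgebras X \<mu>" "N \<in> finite_subalgebras X \<mu>" "M \<subseteq> N" "x \<in> N" "y \<in> N"
  shows "d_mu_M M \<mu> x y \<le> d_mu_M N \<mu> x y"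
proof (cases "x \<in> M \<and> y \<in> M")
  case True
  then show ?thesis
    using finite_median.d_mu_M_mono[OF finite_median_subalgebra[OF assms(1)] finite_median_subalgebra[OF assms(2)] assms(3)]
    by blast
next
  case False
  interpret N: finite_median N \<mu> by (rule finite_median_subalgebra[OF assms(2)])
  show ?thesis using False order_trans[OF zero_le_dist N.dist_le_d_mu_M[OF assms(4,5)]] unfolding d_mu_M_def[of M] by auto
qed

text \<open>Finite subalgebras are directed and the wall metrics grow with them, so one subalgebra
  serves finitely many pairs at once. In this way properties of the wall metrics pass to
  \<rho>.\<close>

lemma \<rho>_approx:
  assumes A: "finite A" "A \<subseteq> X" and e: "e > 0"
  shows "\<exists>M\<in>finite_subalgebras X \<mu>. A \<subseteq> M \<and> (\<forall>x\<in>A. \<forall>y\<in>A. \<rho> x y - e < d_mu_M M \<mu> x y)"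
proof -
  have "\<exists>M\<in>finite_subalgebras X \<mu>. \<rho> x y - e < d_mu_M M \<mu> x y" for x y
    using less_cSupD[of "(\<lambda>M. d_mu_M M \<mu> x y) ` finite_subalgebras X \<mu>" "\<rho> x y - e"]
      finite_subalgebra_exists[of "{}"] e unfolding \<rho>_def by auto
  then obtain M where M: "\<And>x y. M x y \<in> finite_subalgebras X \<mu>" "\<And>x y. \<rho> x y - e < d_mu_M (M x y) \<mu> x y"
    by metis
  have MX: "M x y \<subseteq> X" "finite (M x y)" for x y
    using M(1)[of x y] unfolding finite_subalgebras_def subalgebra_def by auto
  have "finite (A \<union> (\<Union>x\<in>A. \<Union>y\<in>A. M x y))" "A \<union> (\<Union>x\<in>A. \<Union>y\<in>A. M x y) \<subseteq> X" using A MX by auto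
  then obtain N where N: "N \<in> finite_subalgebras X \<mu>" "A \<union> (\<Union>x\<in>A. \<Union>y\<in>A. M x y) \<subseteq> N"
    by (meson finite_subalgebra_exists)
  have "\<rho> x y - e < d_mu_M N \<mu> x y" if "x \<in> A" "y \<in> A" for x y
  proof -
    have "M x y \<subseteq> N" "x \<in> N" "y \<in> N" using N(2) that by auto
    from d_mu_M_subset[OF M(1) N(1) this] show ?thesis using M(2)[of x y] by linarith
  qed
  then show ?thesis using N by blast
qed

lemma \<rho>_sym: "\<lbrakk>x \<in> X; y \<in> X\<rbrakk> \<Longrightarrow> \<rho> x y = \<rho> y x"
proof -
  have "d_mu_M M \<mu> x y = d_mu_M M \<mu> y x" for M
  proof (cases "x \<in> M \<and> y \<in> M")
    case True
    then show ?thesis using d_mu_M_sym[of y M x] by simp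
  next
    case False
    then show ?thesis unfolding d_mu_M_def by auto
  qed
  then show ?thesis unfolding \<rho>_def by simp
qed

lemma dist_le_\<rho>:
  assumes "x \<in> X" "y \<in> X"
  shows "dist x y \<le> \<rho> x y"
proof -
  obtain M where M: "M \<in> finite_subalgebras X \<mu>" "{x, y} \<subseteq> M" using finite_subalgebra_exists[of "{x, y}"] assms by auto
  interpret M: finite_median M \<mu> by (rule finite_median_subalgebra[OF M(1)])
  show ?thesis using M.dist_le_d_mu_M[of x y] \<rho>_ge[OF assms M(1)] M(2) by auto
qed

lemma \<rho>_triangle:
  assumes "x \<in> X" "y \<in> X" "z \<in> X"
  shows "\<rho> x z \<le> \<rho> x y + \<rho> y z"
proof (rule field_le_epsilon)
  fix e :: real assume "e > 0"
  then obtain M where M: "M \<in> finite_subalgebras X \<mu>" "{x, y, z} \<subseteq> M" "\<rho> x z - e < d_mu_M M \<mu> x z"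
    using \<rho>_approx[of "{x, y, z}" e] assms by auto
  interpret M: finite_median M \<mu> by (rule finite_median_subalgebra[OF M(1)])
  have "d_mu_M M \<mu> x z \<le> d_mu_M M \<mu> x y + d_mu_M M \<mu> y z" by (rule M.d_mu_M_triangle) (use M in auto)
  then show "\<rho> x z \<le> \<rho> x y + \<rho> y z + e"
    using M(3) \<rho>_ge[OF assms(1,2) M(1)] \<rho>_ge[OF assms(2,3) M(1)] by linarith
qed

lemma \<rho>_between:
  assumes "x \<in> X" "y \<in> X" "z \<in> X" "\<mu> x y z = z"
  shows "\<rho> x y = \<rho> x z + \<rho> z y"
proof (rule antisym)
  show "\<rho> x z + \<rho> z y \<le> \<rho> x y"
  proof (rule field_le_epsilon)
    fix e :: real assume "e > 0"
    then obtain M where M: "M \<in> finite_subalgebras X \<mu>" "{x, y, z} \<subseteq> M"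
      "\<rho> x z - e / 2 < d_mu_M M \<mu> x z" "\<rho> z y - e / 2 < d_mu_M M \<mu> z y"
      using \<rho>_approx[of "{x, y, z}" "e / 2"] assms by auto
    interpret M: finite_median M \<mu> by (rule finite_median_subalgebra[OF M(1)])
    have "d_mu_M M \<mu> x y = d_mu_M M \<mu> x z + d_mu_M M \<mu> z y" by (rule M.d_mu_M_between) (use M assms in auto)
    then show "\<rho> x z + \<rho> z y \<le> \<rho> x y + e" using M(3,4) \<rho>_ge[OF assms(1,2) M(1)] by argo
  qed
qed (rule \<rho>_triangle[OF assms(1,3,2)])

lemma \<rho>_automorphism:
  assumes g: "isometric_automorphism X \<mu> g" and xy: "x \<in> X" "y \<in> X"
  shows "\<rho> (g x) (g y) = \<rho> x y"
proof -
  have bij: "bij_betw g X X" and iso: "\<And>x y. x \<in> X \<Longrightarrow> y \<in> X \<Longrightarrow> dist (g x) (g y) = dist x y"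
    and mor: "\<And>x y z. x \<in> X \<Longrightarrow> y \<in> X \<Longrightarrow> z \<in> X \<Longrightarrow> g (\<mu> x y z) = \<mu> (g x) (g y) (g z)"
    using g unfolding isometric_automorphism_def by auto
  have inj: "inj_on g X" and gX: "g ` X = X" using bij unfolding bij_betw_def by auto
  have sub: "g ` M \<in> finite_subalgebras X \<mu>" if "M \<in> finite_subalgebras X \<mu>" for M
  proof -
    have M: "finite M" "M \<subseteq> X" "\<And>x y z. x \<in> M \<Longrightarrow> y \<in> M \<Longrightarrow> z \<in> M \<Longrightarrow> \<mu> x y z \<in> M"
      using that unfolding finite_subalgebras_def subalgebra_def by auto
    have "\<mu> (g x) (g y) (g z) \<in> g ` M" if "x \<in> M" "y \<in> M" "z \<in> M" for x y z
      using mor[of x y z] M(3)[OF that] M(2) that by (metis imageI subsetD)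
    moreover have "g ` M \<subseteq> X" using M(2) gX by blast
    ultimately show ?thesis using M(1) unfolding finite_subalgebras_def subalgebra_def by simp
  qed
  have le: "\<rho> x y \<le> \<rho> (g x) (g y)"
  proof (rule field_le_epsilon)
    fix e :: real assume "e > 0"
    then obtain M where M: "M \<in> finite_subalgebras X \<mu>" "{x, y} \<subseteq> M" "\<rho> x y - e < d_mu_M M \<mu> x y"
      using \<rho>_approx[of "{x, y}" e] xy by auto
    have MX: "M \<subseteq> X" using M(1) unfolding finite_subalgebras_def subalgebra_def by auto
    interpret M: finite_median M \<mu> by (rule finite_median_subalgebra[OF M(1)])
    have "d_mu_M (g ` M) \<mu> (g x) (g y) = d_mu_M M \<mu> x y"
      by (rule M.d_mu_M_image[OF finite_median_subalgebra[OF sub[OF M(1)]] inj_on_subset[OF inj MX]])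
        (use MX M mor iso in \<open>auto simp: subset_iff\<close>)
    moreover have "g x \<in> X" "g y \<in> X" using xy gX by auto
    ultimately show "\<rho> x y \<le> \<rho> (g x) (g y) + e" using M(3) \<rho>_ge[OF _ _ sub[OF M(1)], of "g x" "g y"] by simp
  qed
  show ?thesis
  proof (rule antisym[OF _ le], rule field_le_epsilon)
    fix e :: real assume "e > 0"
    moreover have "{g x, g y} \<subseteq> X" using xy gX by auto
    ultimately obtain N where N: "N \<in> finite_subalgebras X \<mu>" "{g x, g y} \<subseteq> N"
        "\<rho> (g x) (g y) - e < d_mu_M N \<mu> (g x) (g y)"
      using \<rho>_approx[of "{g x, g y}" e] by auto
    \<comment> \<open>The preimage of \<open>N\<close> is used, so that the reverse inequality needs
      only \<open>g\<close> and not its inverse map.\<close>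
    define M where "M = {u \<in> X. g u \<in> N}"
    have NX: "N \<subseteq> X" "finite N" "\<And>x y z. x \<in> N \<Longrightarrow> y \<in> N \<Longrightarrow> z \<in> N \<Longrightarrow> \<mu> x y z \<in> N"
      using N(1) unfolding finite_subalgebras_def subalgebra_def by auto
    have "N \<subseteq> g ` X" using NX(1) gX by simp
    then have gM: "g ` M = N" unfolding M_def by blast
    have MX: "M \<subseteq> X" unfolding M_def by blast
    have "finite M" using NX(2) gM inj_on_subset[OF inj MX] finite_image_iff by metis
    then have M: "M \<in> finite_subalgebras X \<mu>"
      using NX(3) mor MX unfolding finite_subalgebras_def subalgebra_def M_def by auto
    interpret M: finite_median M \<mu> by (rule finite_median_subalgebra[OF M])
    have "d_mu_M (g ` M) \<mu> (g x) (g y) = d_mu_M M \<mu> x y"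
      by (rule M.d_mu_M_image[OF finite_median_subalgebra[OF sub[OF M]] inj_on_subset[OF inj MX]])
        (use MX N xy mor iso in \<open>auto simp: subset_iff M_def\<close>)
    then show "\<rho> (g x) (g y) \<le> \<rho> x y + e" using N(3) \<rho>_ge[OF xy M] unfolding gM by simp
  qed
qed

end

section \<open>Finite rank\<close>

text \<open>Each \<open>h\<close> is placed on an interval \<open>S h\<close> of length \<open>w h\<close> ending at the largest weight \<open>P h\<close>
  of a chain below \<open>h\<close>. Comparable elements get disjoint intervals, so that no point is covered more than
  \<open>r\<close> times.\<close>
lemma heavy_chain:
  fixes H :: "'a set set" and w :: "'a set \<Rightarrow> real"
  assumes fin: "finite H" and w: "\<And>h. h \<in> H \<Longrightarrow> 0 \<le> w h"
    and anti: "\<And>A. A \<subseteq> H \<Longrightarrow> (\<And>h k. h \<in> A \<Longrightarrow> k \<in> A \<Longrightarrow> h \<noteq> k \<Longrightarrow> \<not> h \<subseteq> k) \<Longrightarrow> card A \<le> r"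
  shows "\<exists>C\<subseteq>H. (\<forall>h\<in>C. \<forall>k\<in>C. h \<subseteq> k \<or> k \<subseteq> h) \<and> sum w H \<le> real r * sum w C"
proof -
  define Ch where "Ch = {C. C \<subseteq> H \<and> (\<forall>h\<in>C. \<forall>k\<in>C. h \<subseteq> k \<or> k \<subseteq> h)}"
  have finCh: "finite Ch" unfolding Ch_def using fin by (intro finite_subset[OF _ finite_Pow_iff[THEN iffD2, OF fin]]) auto
  define B where "B h = {C \<in> Ch. \<forall>c\<in>C. c \<subseteq> h}" for h
  define P where "P h = Max (sum w ` B h)" for h
  have finB: "finite (sum w ` B h)" for h unfolding B_def using finCh by simp
  have emp: "{} \<in> Ch" unfolding Ch_def by simp
  have "\<exists>C\<in>Ch. \<forall>D\<in>Ch. sum w D \<le> sum w C"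
  proof -
    have "Max (sum w ` Ch) \<in> sum w ` Ch" using finCh emp by (intro Max_in) auto
    then obtain C where "C \<in> Ch" "Max (sum w ` Ch) = sum w C" by blast
    moreover have "sum w D \<le> Max (sum w ` Ch)" if "D \<in> Ch" for D using finCh that by (intro Max_ge) auto
    ultimately show ?thesis by metis
  qed
  then obtain C where C: "C \<in> Ch" "\<And>D. D \<in> Ch \<Longrightarrow> sum w D \<le> sum w C" by blast
  have P_att: "\<exists>D\<in>B h. P h = sum w D" for h
  proof -
    have "{} \<in> B h" unfolding B_def using emp by simp
    then have "P h \<in> sum w ` B h" unfolding P_def by (intro Max_in finB) auto
    then show ?thesis by blast
  qed
  have P_ge: "sum w D \<le> P h" if "D \<in> B h" for D h
    unfolding P_def using finB that by (intro Max_ge) auto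
  have P_le: "P h \<le> sum w C" for h using P_att[of h] C(2) unfolding B_def by auto
  have P_w: "w h \<le> P h" if "h \<in> H" for h
    using P_ge[of "{h}" h] that unfolding B_def Ch_def by simp
  \<comment> \<open>A heaviest chain below \<open>h\<close> remains a chain after adding
    \<open>k\<close>.\<close>
  have P_step: "P h + w k \<le> P k" if "h \<in> H" "k \<in> H" "h \<subset> k" for h k
  proof -
    obtain D where D: "D \<in> B h" "P h = sum w D" using P_att by blast
    have Dk: "c \<subset> k" if "c \<in> D" for c using D(1) \<open>h \<subset> k\<close> that unfolding B_def by blast
    have DCh: "D \<subseteq> H" "\<forall>h\<in>D. \<forall>k\<in>D. h \<subseteq> k \<or> k \<subseteq> h" using D(1) unfolding B_def Ch_def by auto
    have "insert k D \<in> B k" unfolding B_def Ch_def using Dk DCh \<open>k \<in> H\<close> by blast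
    moreover have "k \<notin> D" using D(1) that unfolding B_def by auto
    moreover have "finite D" using D(1) fin finite_subset unfolding B_def Ch_def by auto
    ultimately show ?thesis using P_ge[of "insert k D" k] D(2) by simp
  qed
  define S where "S h = {P h - w h..<P h}" for h
  have Sint: "integrable lborel (indicator (S h) :: real \<Rightarrow> real)" for h
    unfolding S_def by (cases "0 \<le> w h") auto
  \<comment> \<open>The total weight is the integral of the number of intervals covering a point.
    This number is at most \<open>r\<close>, and all intervals lie in \<open>{0..<sum w C}\<close>
    because \<open>w h \<le> P h \<le> sum w C\<close>.\<close>
  have "sum w H = (\<Sum>h\<in>H. \<integral>t. indicator (S h) t \<partial>lborel)"
    by (rule sum.cong) (auto simp: S_def w)
  also have "\<dots> = (\<integral>t. (\<Sum>h\<in>H. indicator (S h) t) \<partial>lborel)"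
    by (rule Bochner_Integration.integral_sum[symmetric]) (rule Sint)
  also have "\<dots> \<le> (\<integral>t. real r * indicator {0..<sum w C} t \<partial>lborel)"
  proof (rule integral_mono)
    show "integrable lborel (\<lambda>t. \<Sum>h\<in>H. indicator (S h) t :: real)"
      by (intro Bochner_Integration.integrable_sum Sint)
    show "integrable lborel (\<lambda>t. real r * indicator {0..<sum w C} t :: real)"
      by (cases "0 \<le> sum w C") auto
    fix t :: real
    let ?A = "{h \<in> H. t \<in> S h}"
    have card: "(\<Sum>h\<in>H. indicator (S h) t :: real) = real (card ?A)"
      using fin by (simp add: indicator_def sum.If_cases Int_def)
    show "(\<Sum>h\<in>H. indicator (S h) t) \<le> real r * indicator {0..<sum w C} t"
    proof (cases "?A = {}")
      case True
      then show ?thesis unfolding card True by (simp add: indicator_def)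
    next
      case False
      then obtain h where "h \<in> H" "t \<in> S h" by blast
      then have "t \<in> {0..<sum w C}" using P_le[of h] P_w[of h] unfolding S_def by auto
      moreover have "card ?A \<le> r"
      proof (rule anti)
        fix h k assume "h \<in> ?A" "k \<in> ?A" "h \<noteq> k"
        then show "\<not> h \<subseteq> k" using P_step[of h k] unfolding S_def by fastforce
      qed blast
      ultimately show ?thesis unfolding card by simp
    qed
  qed
  also have "\<dots> = real r * sum w C"
  proof -
    have "0 \<le> sum w C" using C w unfolding Ch_def by (intro sum_nonneg) auto
    then show ?thesis by simp
  qed
  finally have "sum w H \<le> real r * sum w C" .
  moreover have "C \<subseteq> H" "\<forall>h\<in>C. \<forall>k\<in>C. h \<subseteq> k \<or> k \<subseteq> h" using C(1) unfolding Ch_def by auto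
  ultimately show ?thesis by (intro exI[of _ C] conjI)
qed

context finite_median
begin

text \<open>The coordinate of a point is the total weight of the members of a heavy chain that
  contain it; between \<open>x\<close> and \<open>y\<close> it grows by the weight of the whole
  chain.\<close>

lemma chain_coordinate:
  assumes xy: "x \<in> M" "y \<in> M"
    and anti: "\<And>A. A \<subseteq> sides M \<mu> x y \<Longrightarrow> (\<And>h k. h \<in> A \<Longrightarrow> k \<in> A \<Longrightarrow> h \<noteq> k \<Longrightarrow> \<not> h \<subseteq> k) \<Longrightarrow> card A \<le> r"
  shows "\<exists>f :: 'a \<Rightarrow> real. (\<forall>a\<in>M. \<forall>b\<in>M. f b - f a \<le> d_mu_M M \<mu> a b) \<and>
     (\<forall>a\<in>M. \<forall>b\<in>M. \<forall>c\<in>M. \<mu> a b c = c \<longrightarrow> f c \<le> max (f a) (f b) \<and> min (f a) (f b) \<le> f c) \<and>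
     d_mu_M M \<mu> x y \<le> real r * (f y - f x)"
proof -
  define w where "w = weight M \<mu>"
  have wn: "0 \<le> w h" if "h \<in> sides M \<mu> a b" for h a b
    using that weight_nonneg unfolding w_def sides_def by blast
  obtain C where C: "C \<subseteq> sides M \<mu> x y" "\<And>h k. h \<in> C \<Longrightarrow> k \<in> C \<Longrightarrow> h \<subseteq> k \<or> k \<subseteq> h"
    "sum w (sides M \<mu> x y) \<le> real r * sum w C"
  proof -
    have "\<exists>C\<subseteq>sides M \<mu> x y. (\<forall>h\<in>C. \<forall>k\<in>C. h \<subseteq> k \<or> k \<subseteq> h) \<and> sum w (sides M \<mu> x y) \<le> real r * sum w C"
      by (rule heavy_chain[OF finite_sides wn anti])
    then show thesis using that by auto
  qed
  have finC: "finite C" using C(1) finite_sides finite_subset by blast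
  have wC: "0 \<le> w h" if "h \<in> C" for h using wn C(1) that by blast
  define f where "f u = sum w {h \<in> C. u \<in> h}" for u
  have mono: "f u \<le> f v" if "{h \<in> C. u \<in> h} \<subseteq> {h \<in> C. v \<in> h}" for u v
    unfolding f_def by (rule sum_mono2) (use finC wC that in auto)
  have "f b - f a \<le> d_mu_M M \<mu> a b" if ab: "a \<in> M" "b \<in> M" for a b
  proof -
    have "f b \<le> sum w ({h \<in> C. a \<in> h} \<union> {h \<in> C. a \<notin> h \<and> b \<in> h})"
      unfolding f_def by (rule sum_mono2) (use finC wC in auto)
    also have "\<dots> = f a + sum w {h \<in> C. a \<notin> h \<and> b \<in> h}"
      unfolding f_def by (rule sum.union_disjoint) (use finC in auto)
    also have "sum w {h \<in> C. a \<notin> h \<and> b \<in> h} \<le> sum w (sides M \<mu> a b)"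
      by (rule sum_mono2[OF finite_sides]) (use C(1) wn in \<open>auto simp: sides_def\<close>)
    also have "\<dots> = d_mu_M M \<mu> a b" using ab by (simp add: d_mu_M_eq w_def)
    finally show ?thesis by simp
  qed
  moreover have "f c \<le> max (f a) (f b) \<and> min (f a) (f b) \<le> f c"
    if abc: "a \<in> M" "b \<in> M" "c \<in> M" "\<mu> a b c = c" for a b c
  proof -
    have maj: "c \<in> h \<longleftrightarrow> a \<in> h \<and> b \<in> h \<or> a \<in> h \<and> c \<in> h \<or> b \<in> h \<and> c \<in> h" if "h \<in> C" for h
      using halfspace_majority[of h a b c] C(1) that abc unfolding sides_def by auto
    \<comment> \<open>If \<open>h\<close> and \<open>k\<close> contain \<open>c\<close> while
      \<open>a\<close> is outside \<open>h\<close> and \<open>b\<close> outside \<open>k\<close>,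
      majority puts \<open>b\<close> into \<open>h\<close> and \<open>a\<close> into
      \<open>k\<close>, so neither contains the other.\<close>
    have "{h \<in> C. c \<in> h} \<subseteq> {h \<in> C. a \<in> h} \<or> {h \<in> C. c \<in> h} \<subseteq> {h \<in> C. b \<in> h}"
    proof (rule ccontr)
      assume "\<not> ?thesis"
      then obtain h k where "h \<in> C" "k \<in> C" "c \<in> h" "a \<notin> h" "c \<in> k" "b \<notin> k" by blast
      then show False using maj[of h] maj[of k] C(2)[of h k] by blast
    qed
    moreover have "{h \<in> C. a \<in> h} \<subseteq> {h \<in> C. c \<in> h} \<or> {h \<in> C. b \<in> h} \<subseteq> {h \<in> C. c \<in> h}"
    proof (rule ccontr)
      assume "\<not> ?thesis"
      then obtain h k where "h \<in> C" "k \<in> C" "a \<in> h" "c \<notin> h" "b \<in> k" "c \<notin> k" by blast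
      then show False using maj[of h] maj[of k] C(2)[of h k] by blast
    qed
    ultimately show ?thesis using mono[of c a] mono[of c b] mono[of a c] mono[of b c] by linarith
  qed
  moreover have "d_mu_M M \<mu> x y \<le> real r * (f y - f x)"
  proof -
    have e: "{h \<in> C. y \<in> h} = C" "{h \<in> C. x \<in> h} = {}" using C(1) unfolding sides_def by auto
    have "f y - f x = sum w C" unfolding f_def e by simp
    then show ?thesis using C(3) xy by (simp add: d_mu_M_eq w_def)
  qed
  ultimately show ?thesis by blast
qed

section \<open>Interval lattices and the cubes that they contain\<close>

lemma interval_point_eqI:
  assumes X: "x \<in> M" "y \<in> M" "u \<in> M" "v \<in> M" and I: "\<mu> x y u = u" "\<mu> x y v = v"
    and eq: "\<And>h. h \<in> sides M \<mu> x y \<Longrightarrow> u \<in> h \<longleftrightarrow> v \<in> h"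
  shows "u = v"
proof (rule ccontr)
  assume "u \<noteq> v"
  then obtain h where h: "h \<in> halfspaces M \<mu>" "u \<notin> h" "v \<in> h"
    using sides_nonempty[OF finite X(3,4)] unfolding sides_def by blast
  have "u \<in> h \<longleftrightarrow> x \<in> h \<and> y \<in> h \<or> x \<in> h \<and> u \<in> h \<or> y \<in> h \<and> u \<in> h"
    using halfspace_majority[OF h(1) X(1,2,3)] I(1) by simp
  moreover have "v \<in> h \<longleftrightarrow> x \<in> h \<and> y \<in> h \<or> x \<in> h \<and> v \<in> h \<or> y \<in> h \<and> v \<in> h"
    using halfspace_majority[OF h(1) X(1,2,4)] I(2) by simp
  \<comment> \<open>Both points are between \<open>x\<close> and \<open>y\<close>, so a halfspace
    containing neither or both of \<open>x\<close> and \<open>y\<close> cannot tell them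
    apart.\<close>
  ultimately consider "x \<notin> h" "y \<in> h" | "x \<in> h" "y \<notin> h" using h by blast
  then show False
  proof cases
    case 1
    then show ?thesis using eq[of h] h unfolding sides_def by blast
  next
    case 2
    then have "M - h \<in> sides M \<mu> x y" using halfspaces_compl[OF h(1)] X unfolding sides_def by blast
    then show ?thesis using eq[of "M - h"] h X by blast
  qed
qed

text \<open>Since \<open>x\<close> lies in no member of \<open>sides M \<mu> x y\<close> and
  \<open>y\<close> in all of them, \<open>\<mu> x\<close> acts on memberships as conjunction and
  \<open>\<mu> y\<close>, in the dual lemma below, as disjunction. The empty meet is
  \<open>y\<close>, the empty join \<open>x\<close>.\<close>

lemma meet_exists:
  assumes "x \<in> M" "y \<in> M" "finite J" "\<And>i. i \<in> J \<Longrightarrow> v i \<in> M"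
  shows "\<exists>u\<in>M. \<forall>h\<in>sides M \<mu> x y. u \<in> h \<longleftrightarrow> (\<forall>i\<in>J. v i \<in> h)"
  using assms(3,4)
proof (induction J rule: finite_induct)
  case empty
  then show ?case using assms(2) unfolding sides_def by auto
next
  case (insert j J)
  then obtain u where u: "u \<in> M" "\<And>h. h \<in> sides M \<mu> x y \<Longrightarrow> u \<in> h \<longleftrightarrow> (\<forall>i\<in>J. v i \<in> h)" by auto
  have v: "v j \<in> M" using insert by auto
  have "\<mu> x (v j) u \<in> h \<longleftrightarrow> (\<forall>i\<in>insert j J. v i \<in> h)" if h: "h \<in> sides M \<mu> x y" for h
    using halfspace_majority[of h x "v j" u] assms(1) u(1) v u(2)[OF h] h unfolding sides_def by auto
  then show ?case using closed[OF assms(1) v u(1)] by blast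
qed

lemma join_exists:
  assumes "x \<in> M" "y \<in> M" "finite J" "\<And>i. i \<in> J \<Longrightarrow> v i \<in> M"
  shows "\<exists>u\<in>M. \<forall>h\<in>sides M \<mu> x y. u \<in> h \<longleftrightarrow> (\<exists>i\<in>J. v i \<in> h)"
  using assms(3,4)
proof (induction J rule: finite_induct)
  case empty
  then show ?case using assms(1) unfolding sides_def by auto
next
  case (insert j J)
  then obtain u where u: "u \<in> M" "\<And>h. h \<in> sides M \<mu> x y \<Longrightarrow> u \<in> h \<longleftrightarrow> (\<exists>i\<in>J. v i \<in> h)" by auto
  have v: "v j \<in> M" using insert by auto
  have "\<mu> y (v j) u \<in> h \<longleftrightarrow> (\<exists>i\<in>insert j J. v i \<in> h)" if h: "h \<in> sides M \<mu> x y" for h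
    using halfspace_majority[of h y "v j" u] assms(2) u(1) v u(2)[OF h] h unfolding sides_def by auto
  then show ?case using closed[OF assms(2) v u(1)] by blast
qed

text \<open>A median morphism from the subsets of \<open>{..<k}\<close> under majority, together
  with halfspaces of \<open>M\<close> that read off the coordinates and so make it
  injective.\<close>

definition cube_map :: "nat \<Rightarrow> (nat set \<Rightarrow> 'a) \<Rightarrow> (nat \<Rightarrow> 'a set) \<Rightarrow> bool" where
  "cube_map k f \<beta> \<longleftrightarrow> (\<forall>S\<subseteq>{..<k}. f S \<in> M) \<and>
     (\<forall>i<k. \<beta> i \<in> halfspaces M \<mu>) \<and> (\<forall>S\<subseteq>{..<k}. \<forall>i<k. f S \<in> \<beta> i \<longleftrightarrow> i \<in> S) \<and>
     (\<forall>S\<subseteq>{..<k}. \<forall>T\<subseteq>{..<k}. \<forall>U\<subseteq>{..<k}. \<mu> (f S) (f T) (f U) = f (S \<inter> T \<union> S \<inter> U \<union> T \<inter> U))"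

text \<open>Pairwise incomparable halfspaces between \<open>x\<close> and \<open>y\<close> are prime filters of the distributive lattice
  \<open>I(x, y)\<close>. The point \<open>e i\<close> lies in the \<open>i\<close>-th of them only; joining everything with \<open>a\<close>, the join of
  all meets \<open>e i \<and> e j\<close>, makes the \<open>e i\<close> pairwise disjoint.\<close>
lemma antichain_cube_map:
  assumes xy: "x \<in> M" "y \<in> M" and A: "A \<subseteq> sides M \<mu> x y"
    and anti: "\<And>h k. h \<in> A \<Longrightarrow> k \<in> A \<Longrightarrow> h \<noteq> k \<Longrightarrow> \<not> h \<subseteq> k"
  shows "\<exists>f \<beta>. cube_map (card A) f \<beta>"
proof -
  define k where "k = card A"
  have "finite A" using A finite_sides finite_subset by blast
  then obtain \<beta> where "bij_betw \<beta> {0..<k} A" unfolding k_def using ex_bij_betw_nat_finite by blast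
  then have \<beta>A: "\<And>i. i < k \<Longrightarrow> \<beta> i \<in> A" and \<beta>inj: "\<And>i j. i < k \<Longrightarrow> j < k \<Longrightarrow> \<beta> i = \<beta> j \<Longrightarrow> i = j"
    unfolding bij_betw_def inj_on_def by auto
  have \<beta>H: "\<beta> i \<in> sides M \<mu> x y" if "i < k" for i using \<beta>A[OF that] A by blast
  have "\<exists>u. u \<in> M \<and> u \<in> \<beta> i \<and> u \<notin> \<beta> j" if "i < k" "j < k" "i \<noteq> j" for i j
  proof -
    have "\<beta> i \<noteq> \<beta> j" using \<beta>inj[OF that(1,2)] that(3) by auto
    then have "\<not> \<beta> i \<subseteq> \<beta> j" by (rule anti[OF \<beta>A[OF that(1)] \<beta>A[OF that(2)]])
    moreover have "\<beta> i \<subseteq> M" using \<beta>H[OF that(1)] halfspaces_subset unfolding sides_def by blast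
    ultimately show ?thesis by blast
  qed
  then obtain u where u: "\<And>i j. i < k \<Longrightarrow> j < k \<Longrightarrow> i \<noteq> j \<Longrightarrow> u i j \<in> M \<and> u i j \<in> \<beta> i \<and> u i j \<notin> \<beta> j" by metis
  \<comment> \<open>The witnesses \<open>u i j\<close> lie in \<open>\<beta> i\<close> but not in
    \<open>\<beta> j\<close>; the meet over all \<open>j\<close> lies in \<open>\<beta> i\<close>
    and in no other member of the antichain.\<close>
  have "\<exists>e\<in>M. \<forall>h\<in>sides M \<mu> x y. e \<in> h \<longleftrightarrow> (\<forall>j\<in>{..<k} - {i}. u i j \<in> h)" if "i < k" for i
    by (rule meet_exists[OF xy]) (use u that in auto)
  then obtain e where e: "\<And>i. i < k \<Longrightarrow> e i \<in> M"
    "\<And>i h. i < k \<Longrightarrow> h \<in> sides M \<mu> x y \<Longrightarrow> e i \<in> h \<longleftrightarrow> (\<forall>j\<in>{..<k} - {i}. u i j \<in> h)" by metis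
  have e\<beta>: "e i \<in> \<beta> l \<longleftrightarrow> i = l" if "i < k" "l < k" for i l
    using e(2)[OF that(1) \<beta>H[OF that(2)]] u that by (metis DiffE DiffI insertI1 lessThan_iff singletonD)
  define m where "m p = \<mu> x (e (fst p)) (e (snd p))" for p
  define J where "J = {p \<in> {..<k} \<times> {..<k}. fst p \<noteq> snd p}"
  have mM: "m p \<in> M" if "p \<in> J" for p using that e(1) xy unfolding m_def J_def by auto
  have mh: "m p \<in> h \<longleftrightarrow> e (fst p) \<in> h \<and> e (snd p) \<in> h" if "p \<in> J" "h \<in> sides M \<mu> x y" for p h
    using halfspace_majority[of h x "e (fst p)" "e (snd p)"] that e(1) xy unfolding m_def J_def sides_def by auto
  have "finite J" unfolding J_def by simp
  then have "\<exists>a\<in>M. \<forall>h\<in>sides M \<mu> x y. a \<in> h \<longleftrightarrow> (\<exists>p\<in>J. m p \<in> h)" by (rule join_exists[OF xy _ mM])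
  then obtain a where a': "a \<in> M" "\<forall>h\<in>sides M \<mu> x y. a \<in> h \<longleftrightarrow> (\<exists>p\<in>J. m p \<in> h)" by (rule bexE)
  note a = a'(1) bspec[OF a'(2)]
  \<comment> \<open>A set containing \<open>e i\<close> and \<open>e j\<close> contains their meet
    and hence \<open>a\<close>. So a set that misses \<open>a\<close> sees at most one of the
    \<open>e i\<close>.\<close>
  have uniq: "i = j" if "h \<in> sides M \<mu> x y" "a \<notin> h" "i < k" "j < k" "e i \<in> h" "e j \<in> h" for h i j
  proof (rule ccontr)
    assume "i \<noteq> j"
    then have "(i, j) \<in> J" using that unfolding J_def by simp
    then show False using a(2)[OF that(1)] mh[of "(i, j)" h] that by auto
  qed
  have a\<beta>: "a \<notin> \<beta> l" if l: "l < k" for l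
  proof
    assume "a \<in> \<beta> l"
    then obtain p where p: "p \<in> J" "m p \<in> \<beta> l" using a(2)[OF \<beta>H[OF l]] by blast
    then have "e (fst p) \<in> \<beta> l" "e (snd p) \<in> \<beta> l" using mh[OF p(1) \<beta>H[OF l]] by auto
    then show False using e\<beta>[of _ l] p(1) l unfolding J_def by auto
  qed
  have "\<exists>v\<in>M. \<mu> x y v = v \<and> (\<forall>h\<in>sides M \<mu> x y. v \<in> h \<longleftrightarrow> (\<exists>w\<in>insert a (e ` S). w \<in> h))" if S: "S \<subseteq> {..<k}" for S
  proof -
    have "finite (insert a (e ` S))" "\<And>w. w \<in> insert a (e ` S) \<Longrightarrow> w \<in> M"
      using S finite_subset a(1) e(1) by auto
    then have "\<exists>v\<in>M. \<forall>h\<in>sides M \<mu> x y. v \<in> h \<longleftrightarrow> (\<exists>w\<in>insert a (e ` S). w \<in> h)" by (rule join_exists[OF xy])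
    then obtain v where v': "v \<in> M" "\<forall>h\<in>sides M \<mu> x y. v \<in> h \<longleftrightarrow> (\<exists>w\<in>insert a (e ` S). w \<in> h)" by (rule bexE)
    note v = v'(1) bspec[OF v'(2)]
    \<comment> \<open>Projecting the join to the interval changes no membership and makes
      \<open>interval_point_eqI\<close> applicable.\<close>
    have "\<mu> x y v \<in> h \<longleftrightarrow> v \<in> h" if "h \<in> sides M \<mu> x y" for h
      using halfspace_majority[of h x y v] that xy v(1) unfolding sides_def by auto
    then have "\<forall>h\<in>sides M \<mu> x y. \<mu> x y v \<in> h \<longleftrightarrow> (\<exists>w\<in>insert a (e ` S). w \<in> h)" using v(2) by simp
    then show ?thesis using absorb[OF xy v(1)] closed[OF xy v(1)] by (intro bexI[of _ "\<mu> x y v"] conjI)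
  qed
  then obtain f where f: "\<And>S. S \<subseteq> {..<k} \<Longrightarrow> f S \<in> M" "\<And>S. S \<subseteq> {..<k} \<Longrightarrow> \<mu> x y (f S) = f S"
    "\<And>S h. S \<subseteq> {..<k} \<Longrightarrow> h \<in> sides M \<mu> x y \<Longrightarrow> f S \<in> h \<longleftrightarrow> (\<exists>w\<in>insert a (e ` S). w \<in> h)" by metis
  have f': "f S \<in> h \<longleftrightarrow> a \<in> h \<or> (\<exists>i\<in>S. e i \<in> h)" if "S \<subseteq> {..<k}" "h \<in> sides M \<mu> x y" for S h
    using f(3)[OF that] by blast
  have f\<beta>: "f S \<in> \<beta> i \<longleftrightarrow> i \<in> S" if "S \<subseteq> {..<k}" "i < k" for S i
    using f'[OF that(1) \<beta>H[OF that(2)]] a\<beta>[OF that(2)] e\<beta>[OF _ that(2)] that(1) by auto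
  have "\<mu> (f S) (f T) (f U) = f (S \<inter> T \<union> S \<inter> U \<union> T \<inter> U)"
    if STU: "S \<subseteq> {..<k}" "T \<subseteq> {..<k}" "U \<subseteq> {..<k}" for S T U
  proof (rule interval_point_eqI[OF xy])
    let ?V = "S \<inter> T \<union> S \<inter> U \<union> T \<inter> U"
    have V: "?V \<subseteq> {..<k}" using STU by blast
    note fM = f(1)[OF STU(1)] f(1)[OF STU(2)] f(1)[OF STU(3)]
    show "\<mu> (f S) (f T) (f U) \<in> M" using fM by simp
    show "f ?V \<in> M" "\<mu> x y (f ?V) = f ?V" using f V by auto
    show "\<mu> x y (\<mu> (f S) (f T) (f U)) = \<mu> (f S) (f T) (f U)"
      unfolding hom[OF fM xy] f(2)[OF STU(1)] f(2)[OF STU(2)] f(2)[OF STU(3)] by simp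
    fix h assume h: "h \<in> sides M \<mu> x y"
    then have hh: "h \<in> halfspaces M \<mu>" unfolding sides_def by blast
    note maj = halfspace_majority[OF hh fM]
    note fs = f'[OF STU(1) h] f'[OF STU(2) h] f'[OF STU(3) h] f'[OF V h]
    show "\<mu> (f S) (f T) (f U) \<in> h \<longleftrightarrow> f ?V \<in> h"
    proof (cases "a \<in> h")
      case True
      then show ?thesis unfolding maj fs by blast
    next
      case False
      have "i = j" if "i \<in> S \<union> T \<union> U" "j \<in> S \<union> T \<union> U" "e i \<in> h" "e j \<in> h" for i j
        using uniq[OF h False _ _ that(3,4)] that(1,2) STU by blast
      then show ?thesis unfolding maj fs using False by blast
    qed
  qed
  moreover have "\<beta> i \<in> halfspaces M \<mu>" if "i < k" for i using \<beta>H[OF that] unfolding sides_def by simp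
  ultimately have "cube_map k f \<beta>"
    unfolding cube_map_def by (intro conjI allI impI f(1) f\<beta>)
  then show ?thesis unfolding k_def by blast
qed

end

context finite_median
begin

text \<open>In \<open>M\<close> an edge of the cube may be crossed by many walls. Within the image
  \<open>Q\<close> alone, the walls are those given by the coordinates, so edges are exactly the
  pairs differing in one coordinate.\<close>

lemma cube_map_has_cube:
  assumes cm: "cube_map k f \<beta>"
  defines "Q \<equiv> f ` Pow {..<k}"
  shows "subalgebra M \<mu> Q" "has_cube Q \<mu> k"
proof -
  note cm' = cm[unfolded cube_map_def]
  note fM = conjunct1[OF cm', rule_format]
    and \<beta> = conjunct1[OF conjunct2[OF cm'], rule_format]
    and f\<beta> = conjunct1[OF conjunct2[OF conjunct2[OF cm']], rule_format]
    and maj = conjunct2[OF conjunct2[OF conjunct2[OF cm']], rule_format]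
  have QM: "Q \<subseteq> M" unfolding Q_def using fM by blast
  have "\<mu> u v w \<in> Q" if uvw: "u \<in> Q" "v \<in> Q" "w \<in> Q" for u v w
  proof -
    obtain S T U where STU: "S \<subseteq> {..<k}" "T \<subseteq> {..<k}" "U \<subseteq> {..<k}" "u = f S" "v = f T" "w = f U"
      using uvw unfolding Q_def by blast
    then have "S \<inter> T \<union> S \<inter> U \<union> T \<inter> U \<in> Pow {..<k}" by blast
    then show ?thesis unfolding STU(4-6) maj[OF STU(1-3)] Q_def by (rule imageI)
  qed
  then show sub: "subalgebra M \<mu> Q" using QM unfolding subalgebra_def by blast
  interpret Q: median Q \<mu> by (rule median_subalgebra[OF sub])
  interpret Q: finite_median Q \<mu> by unfold_locales (simp add: Q_def)
  have inj: "S = T" if "S \<subseteq> {..<k}" "T \<subseteq> {..<k}" "f S = f T" for S T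
    using f\<beta> that by (metis (no_types, lifting) lessThan_iff subsetD subsetI subset_antisym)
  have fQ: "f S \<in> Q" if "S \<subseteq> {..<k}" for S using that unfolding Q_def by blast
  \<comment> \<open>The trace on \<open>Q\<close> of \<open>\<beta> i\<close> or of its complement,
    whichever contains \<open>f T\<close>.\<close>
  define \<eta> where "\<eta> i T = {u \<in> Q. u \<in> \<beta> i \<longleftrightarrow> i \<in> T}" for i T
  have \<eta>: "\<eta> i T \<in> sides Q \<mu> (f S) (f T)"
    if ST: "S \<subseteq> {..<k}" "T \<subseteq> {..<k}" and i: "i \<in> S - T \<union> (T - S)" for i S T
  proof -
    have ik: "i < k" using ST i by auto
    show ?thesis
    proof (cases "i \<in> T")
      case True
      then have "\<beta> i \<in> sides M \<mu> (f S) (f T)" using \<beta>[OF ik] f\<beta>[OF _ ik] ST i unfolding sides_def by auto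
      from sides_restrict[OF this QM fQ[OF ST(1)] fQ[OF ST(2)]]
      show ?thesis using True unfolding \<eta>_def by (simp add: Int_def conj_commute)
    next
      case False
      then have "\<beta> i \<in> sides M \<mu> (f T) (f S)" using \<beta>[OF ik] f\<beta>[OF _ ik] ST i unfolding sides_def by auto
      from sides_restrict[OF this QM fQ[OF ST(2)] fQ[OF ST(1)]]
      have "Q - \<beta> i \<inter> Q \<in> sides Q \<mu> (f S) (f T)" unfolding sides_swap[OF fQ[OF ST(2)] fQ[OF ST(1)]] by blast
      moreover have "Q - \<beta> i \<inter> Q = \<eta> i T" using False unfolding \<eta>_def by blast
      ultimately show ?thesis by simp
    qed
  qed
  have edge: "card (sides Q \<mu> (f S) (f T)) = 1 \<longleftrightarrow> card (S - T \<union> (T - S)) = 1"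
    if ST: "S \<subseteq> {..<k}" "T \<subseteq> {..<k}" for S T
  proof
    assume "card (sides Q \<mu> (f S) (f T)) = 1"
    then obtain h where h: "sides Q \<mu> (f S) (f T) = {h}" by (metis card_1_singletonE)
    have "i = j" if ij: "i \<in> S - T \<union> (T - S)" "j \<in> S - T \<union> (T - S)" for i j
    proof (rule ccontr)
      assume ne: "i \<noteq> j"
      have eq: "\<eta> i T = \<eta> j T" using \<eta>[OF ST ij(1)] \<eta>[OF ST ij(2)] h by simp
      have ik: "i < k" "j < k" using ij ST by auto
      \<comment> \<open>\<open>T\<close> with the \<open>i\<close>-th coordinate flipped; it leaves
        \<open>\<eta> i T\<close> but not \<open>\<eta> j T\<close>.\<close>
      define U where "U = (if i \<in> T then T - {i} else insert i T)"
      have U: "U \<subseteq> {..<k}" using ST ik unfolding U_def by auto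
      have "f U \<notin> \<eta> i T" "f U \<in> \<eta> j T"
        using f\<beta>[OF U ik(1)] f\<beta>[OF U ik(2)] fQ[OF U] ne unfolding \<eta>_def U_def by (auto split: if_splits)
      then show False using eq by blast
    qed
    moreover have "S - T \<union> (T - S) \<noteq> {}"
    proof
      assume "S - T \<union> (T - S) = {}"
      then have "S = T" by blast
      then show False using h unfolding sides_def by blast
    qed
    ultimately obtain i where "S - T \<union> (T - S) = {i}" by blast
    then show "card (S - T \<union> (T - S)) = 1" by simp
  next
    assume "card (S - T \<union> (T - S)) = 1"
    then obtain i where i: "S - T \<union> (T - S) = {i}" by (metis card_1_singletonE)
    have ik: "i < k" using i ST by blast
    have "h = \<eta> i T" if h: "h \<in> sides Q \<mu> (f S) (f T)" for h
    proof -
      have hh: "h \<in> halfspaces Q \<mu>" "f S \<notin> h" "f T \<in> h" "h \<subseteq> Q"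
        using h halfspaces_subset unfolding sides_def by auto
      have "f U \<in> h \<longleftrightarrow> f U \<in> \<eta> i T" if U: "U \<subseteq> {..<k}" for U
      proof -
        \<comment> \<open>As \<open>h\<close> contains \<open>f T\<close> but not
          \<open>f S\<close>, the median with \<open>f U\<close> lies in \<open>h\<close> iff
          \<open>f U\<close> does. This median is \<open>f T\<close> or \<open>f S\<close>,
          depending on the \<open>i\<close>-th coordinate of \<open>U\<close>.\<close>
        note m = Q.halfspace_majority[OF hh(1) fQ[OF ST(1)] fQ[OF ST(2)] fQ[OF U]]
        have \<eta>U: "f U \<in> \<eta> i T \<longleftrightarrow> (i \<in> U \<longleftrightarrow> i \<in> T)" using fQ[OF U] f\<beta>[OF U ik] unfolding \<eta>_def by simp
        have agree: "j \<in> S \<longleftrightarrow> j \<in> T" if "j \<noteq> i" for j using i that by blast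
        have iST: "i \<in> S \<longleftrightarrow> i \<notin> T" using i by blast
        show ?thesis
        proof (cases "i \<in> U \<longleftrightarrow> i \<in> T")
          case True
          have "j \<in> S \<inter> T \<union> S \<inter> U \<union> T \<inter> U \<longleftrightarrow> j \<in> T" for j
            using True agree[of j] iST by (cases "j = i") auto
          then have "S \<inter> T \<union> S \<inter> U \<union> T \<inter> U = T" by (simp only: set_eq_iff) simp
          then show ?thesis using m maj[OF ST U] hh True \<eta>U by simp
        next
          case False
          have "j \<in> S \<inter> T \<union> S \<inter> U \<union> T \<inter> U \<longleftrightarrow> j \<in> S" for j
            using False agree[of j] iST by (cases "j = i") auto
          then have "S \<inter> T \<union> S \<inter> U \<union> T \<inter> U = S" by (simp only: set_eq_iff) simp
          then show ?thesis using m maj[OF ST U] hh False \<eta>U by simp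
        qed
      qed
      then have "u \<in> h \<longleftrightarrow> u \<in> \<eta> i T" if "u \<in> Q" for u using that unfolding Q_def by blast
      moreover have "\<eta> i T \<subseteq> Q" unfolding \<eta>_def by blast
      ultimately show ?thesis using hh(4) by blast
    qed
    moreover have "\<eta> i T \<in> sides Q \<mu> (f S) (f T)" using \<eta>[OF ST, of i] i by blast
    ultimately have "sides Q \<mu> (f S) (f T) = {\<eta> i T}" by blast
    then show "card (sides Q \<mu> (f S) (f T)) = 1" by simp
  qed
  show "has_cube Q \<mu> k"
    unfolding has_cube_def
  proof (intro exI[of _ f] conjI ballI)
    show "inj_on f (Pow {..<k})" using inj by (auto intro!: inj_onI)
    show "f ` Pow {..<k} \<subseteq> Q" unfolding Q_def by simp
    fix S T assume "S \<in> Pow {..<k}" "T \<in> Pow {..<k}"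
    then show "cc_edge Q \<mu> (f S) (f T) \<longleftrightarrow> card (S - T \<union> (T - S)) = 1"
      unfolding cc_edge_iff using edge fQ by auto
  qed
qed

end

section \<open>From the rank bound to coordinates on the whole space\<close>

lemma has_cube_le_rank:
  assumes "M \<in> finite_subalgebras X \<mu>" "has_cube M \<mu> k"
  shows "enat k \<le> median_rank X \<mu>"
proof -
  have fin: "finite M" using assms(1) unfolding finite_subalgebras_def by simp
  \<comment> \<open>A cube of dimension \<open>j\<close> has 2 ^ j vertices in \<open>M\<close>;
    this finiteness gives the \<open>Max\<close> in \<open>finite_rank_of\<close> its
    meaning.\<close>
  have "{k. has_cube M \<mu> k} \<subseteq> {..card M}"
  proof
    fix j assume "j \<in> {k. has_cube M \<mu> k}"
    then obtain f :: "nat set \<Rightarrow> 'a" where "inj_on f (Pow {..<j})" "f ` Pow {..<j} \<subseteq> M" unfolding has_cube_def by auto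
    then have "card (Pow {..<j}) \<le> card M" using fin by (rule card_inj_on_le)
    then have "2 ^ j \<le> card M" by (simp add: card_Pow)
    moreover have "j < 2 ^ j" by (rule less_exp)
    ultimately have "j \<le> card M" by linarith
    then show "j \<in> {..card M}" by simp
  qed
  then have "finite {k. has_cube M \<mu> k}" using finite_subset by blast
  then have "k \<le> finite_rank_of M \<mu>" unfolding finite_rank_of_def using assms(2) by (intro Max_ge) auto
  then have "enat k \<le> enat (finite_rank_of M \<mu>)" by simp
  also have "\<dots> \<le> median_rank X \<mu>" unfolding median_rank_def using assms(1) by (rule SUP_upper)
  finally show ?thesis .
qed

context rectifiable
begin

lemma subalgebra_coordinate:
  assumes rank: "median_rank X \<mu> \<le> enat r" and M: "M \<in> finite_subalgebras X \<mu>" and xy: "x \<in> M" "y \<in> M"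
  shows "\<exists>f :: 'a \<Rightarrow> real. (\<forall>a\<in>M. \<forall>b\<in>M. f b - f a \<le> d_mu_M M \<mu> a b) \<and>
     (\<forall>a\<in>M. \<forall>b\<in>M. \<forall>c\<in>M. \<mu> a b c = c \<longrightarrow> f c \<le> max (f a) (f b) \<and> min (f a) (f b) \<le> f c) \<and>
     d_mu_M M \<mu> x y \<le> real r * (f y - f x)"
proof -
  interpret M: finite_median M \<mu> by (rule finite_median_subalgebra[OF M])
  show ?thesis
  proof (rule M.chain_coordinate[OF xy])
    fix A assume A: "A \<subseteq> sides M \<mu> x y" "\<And>h k. h \<in> A \<Longrightarrow> k \<in> A \<Longrightarrow> h \<noteq> k \<Longrightarrow> \<not> h \<subseteq> k"
    obtain f \<beta> where f: "M.cube_map (card A) f \<beta>" using M.antichain_cube_map[OF xy A] by blast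
    let ?Q = "f ` Pow {..<card A}"
    have "M \<subseteq> X" using M unfolding finite_subalgebras_def subalgebra_def by simp
    then have "subalgebra X \<mu> ?Q" using M.cube_map_has_cube(1)[OF f] unfolding subalgebra_def by (meson order_trans)
    then have "?Q \<in> finite_subalgebras X \<mu>" unfolding finite_subalgebras_def by simp
    from has_cube_le_rank[OF this M.cube_map_has_cube(2)[OF f]] rank
    have "enat (card A) \<le> enat r" by (rule order_trans)
    then show "card A \<le> r" by simp
  qed
qed

lemma long_coordinate:
  assumes rank: "median_rank X \<mu> \<le> enat r" and xy: "x \<in> X" "y \<in> X"
  shows "\<exists>f :: 'a \<Rightarrow> real. (\<forall>a\<in>X. \<forall>b\<in>X. f b - f a \<le> \<rho> a b) \<and>
     (\<forall>a\<in>X. \<forall>b\<in>X. \<forall>c\<in>X. \<mu> a b c = c \<longrightarrow> f c \<le> max (f a) (f b) \<and> min (f a) (f b) \<le> f c) \<and>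
     \<rho> x y \<le> 2 * real r * (f y - f x)"
proof -
  have nn: "0 \<le> \<rho> a b" if "a \<in> X" "b \<in> X" for a b
    using dist_le_\<rho>[OF that] zero_le_dist[of a b] by linarith
  \<comment> \<open>One subalgebra that sees half of the distance is fixed in advance, which
    accounts for the factor 2.\<close>
  obtain M0 where M0: "M0 \<in> finite_subalgebras X \<mu>" "{x, y} \<subseteq> M0" "\<rho> x y \<le> 2 * d_mu_M M0 \<mu> x y"
  proof (cases "\<rho> x y = 0")
    case True
    obtain M where M: "M \<in> finite_subalgebras X \<mu>" "{x, y} \<subseteq> M" using finite_subalgebra_exists[of "{x, y}"] xy by auto
    interpret M: finite_median M \<mu> by (rule finite_median_subalgebra[OF M(1)])
    have "0 \<le> d_mu_M M \<mu> x y" using order_trans[OF zero_le_dist M.dist_le_d_mu_M[of x y]] M(2) by simp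
    then show ?thesis using that[OF M] True by simp
  next
    case False
    then have "\<rho> x y / 2 > 0" using nn[OF xy] by simp
    then obtain M where "M \<in> finite_subalgebras X \<mu>" "{x, y} \<subseteq> M" "\<rho> x y - \<rho> x y / 2 < d_mu_M M \<mu> x y"
      using \<rho>_approx[of "{x, y}" "\<rho> x y / 2"] xy by auto
    then show ?thesis using that[of M] by simp
  qed
  \<comment> \<open>Coordinates are normalised to vanish at \<open>x\<close>, so the Lipschitz bound
    confines each value to a compact interval. The singleton off \<open>X\<close> keeps the product
    over the whole type compact.\<close>
  define J where "J a = (if a \<in> X then {- \<rho> x a .. \<rho> x a} else {0})" for a
  define T where "T N = {f :: 'a \<Rightarrow> real. (\<forall>a\<in>N. \<forall>b\<in>N. f b - f a \<le> \<rho> a b) \<and>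
     (\<forall>a\<in>N. \<forall>b\<in>N. \<forall>c\<in>N. \<mu> a b c = c \<longrightarrow> f c \<le> max (f a) (f b) \<and> min (f a) (f b) \<le> f c) \<and>
     \<rho> x y \<le> 2 * real r * (f y - f x)}" for N
  define \<N> where "\<N> = {N \<in> finite_subalgebras X \<mu>. M0 \<subseteq> N}"
  have "compactin (product_topology (\<lambda>a. euclidean) UNIV) (Pi\<^sub>E UNIV J)"
    unfolding compactin_PiE by (auto simp: J_def)
  then have comp: "compact (Pi\<^sub>E UNIV J)" unfolding euclidean_product_topology by simp
  have co: "continuous_on UNIV (\<lambda>f :: 'a \<Rightarrow> real. f a)" for a by (rule continuous_on_product_coordinates)
  have closed: "closed (T N)" for N
  proof -
    have "T N = (\<Inter>a\<in>N. \<Inter>b\<in>N. {f. f b - f a \<le> \<rho> a b}) \<inter>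
        (\<Inter>a\<in>N. \<Inter>b\<in>N. \<Inter>c\<in>{c \<in> N. \<mu> a b c = c}. {f. f c \<le> max (f a) (f b)} \<inter> {f. min (f a) (f b) \<le> f c}) \<inter>
        {f. \<rho> x y \<le> 2 * real r * (f y - f x)}"
      unfolding T_def by blast
    then show ?thesis
      by (simp only:) (intro closed_Int closed_INT ballI closed_Collect_le continuous_intros co)
  qed
  \<comment> \<open>Finitely many conditions are met by a coordinate of one finite subalgebra
    containing all those involved, extended by 0.\<close>
  have fip: "Pi\<^sub>E UNIV J \<inter> \<Inter>\<F> \<noteq> {}" if F: "finite \<F>" "\<F> \<subseteq> T ` \<N>" for \<F>
  proof -
    obtain \<M> where \<M>: "\<M> \<subseteq> \<N>" "finite \<M>" "\<F> = T ` \<M>" using finite_subset_image[OF F] by blast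
    have "finite (M0 \<union> \<Union>\<M>)" "M0 \<union> \<Union>\<M> \<subseteq> X"
      using M0(1) \<M>(1,2) unfolding \<N>_def finite_subalgebras_def subalgebra_def by auto
    then obtain N where N: "N \<in> finite_subalgebras X \<mu>" "M0 \<union> \<Union>\<M> \<subseteq> N" by (meson finite_subalgebra_exists)
    have NX: "N \<subseteq> X" using N(1) unfolding finite_subalgebras_def subalgebra_def by auto
    have xyN: "x \<in> N" "y \<in> N" using N(2) M0(2) by auto
    obtain \<phi> :: "'a \<Rightarrow> real" where \<phi>': "(\<forall>a\<in>N. \<forall>b\<in>N. \<phi> b - \<phi> a \<le> d_mu_M N \<mu> a b) \<and>
        (\<forall>a\<in>N. \<forall>b\<in>N. \<forall>c\<in>N. \<mu> a b c = c \<longrightarrow> \<phi> c \<le> max (\<phi> a) (\<phi> b) \<and> min (\<phi> a) (\<phi> b) \<le> \<phi> c) \<and>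
        d_mu_M N \<mu> x y \<le> real r * (\<phi> y - \<phi> x)"
      using subalgebra_coordinate[OF rank N(1) xyN] by (rule exE)
    note \<phi> = conjunct1[OF \<phi>', rule_format] conjunct1[OF conjunct2[OF \<phi>'], rule_format]
      conjunct2[OF conjunct2[OF \<phi>']]
    define g where "g a = (if a \<in> N then \<phi> a - \<phi> x else 0)" for a
    have lip: "\<phi> b - \<phi> a \<le> \<rho> a b" if "a \<in> N" "b \<in> N" for a b
      using \<phi>(1)[OF that] \<rho>_ge[OF _ _ N(1), of a b] that NX by (meson order_trans subsetD)
    have "g a \<in> J a" for a
      using lip[OF xyN(1), of a] lip[OF _ xyN(1), of a] \<rho>_sym[OF xy(1), of a] nn[OF xy(1), of a] NX
      unfolding g_def J_def by auto
    then have gK: "g \<in> Pi\<^sub>E UNIV J" by (simp add: PiE_def Pi_def)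
    have "g \<in> T L" if L: "L \<in> \<M>" for L
    proof -
      have LN: "L \<subseteq> N" using L N(2) by blast
      have "g b - g a \<le> \<rho> a b" if "a \<in> L" "b \<in> L" for a b
        using lip[of a b] that LN unfolding g_def by auto
      moreover have "g c \<le> max (g a) (g b) \<and> min (g a) (g b) \<le> g c"
        if abc: "a \<in> L" "b \<in> L" "c \<in> L" "\<mu> a b c = c" for a b c
      proof -
        have "a \<in> N" "b \<in> N" "c \<in> N" using abc LN by auto
        then show ?thesis using \<phi>(2)[OF _ _ _ abc(4)] unfolding g_def by (auto simp: max_def min_def split: if_splits)
      qed
      moreover have "\<rho> x y \<le> 2 * real r * (g y - g x)"
      proof -
        have "d_mu_M M0 \<mu> x y \<le> d_mu_M N \<mu> x y"
          by (rule d_mu_M_subset[OF M0(1) N(1) _ xyN]) (use N(2) in blast)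
        then show ?thesis using M0(3) \<phi>(3) xyN unfolding g_def by simp
      qed
      ultimately show ?thesis unfolding T_def by blast
    qed
    then show ?thesis using gK \<M>(3) by blast
  qed
  have "Pi\<^sub>E UNIV J \<inter> \<Inter>(T ` \<N>) \<noteq> {}"
    by (rule compact_imp_fip[OF comp]) (use closed fip in auto)
  then obtain f where f: "\<And>N. N \<in> \<N> \<Longrightarrow> f \<in> T N" by blast
  have cover: "\<exists>N\<in>\<N>. A \<subseteq> N" if A: "finite A" "A \<subseteq> X" for A
  proof -
    have "finite (M0 \<union> A)" "M0 \<union> A \<subseteq> X" using M0(1) A unfolding finite_subalgebras_def subalgebra_def by auto
    then obtain N where "N \<in> finite_subalgebras X \<mu>" "M0 \<union> A \<subseteq> N" by (meson finite_subalgebra_exists)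
    then show ?thesis unfolding \<N>_def by blast
  qed
  have "f b - f a \<le> \<rho> a b" if ab: "a \<in> X" "b \<in> X" for a b
  proof -
    obtain N where "N \<in> \<N>" "{a, b} \<subseteq> N" using cover[of "{a, b}"] ab by auto
    then show ?thesis using f[of N] unfolding T_def by blast
  qed
  moreover have "f c \<le> max (f a) (f b) \<and> min (f a) (f b) \<le> f c"
    if abc: "a \<in> X" "b \<in> X" "c \<in> X" "\<mu> a b c = c" for a b c
  proof -
    obtain N where "N \<in> \<N>" "{a, b, c} \<subseteq> N" using cover[of "{a, b, c}"] abc by auto
    then show ?thesis using f[of N] abc(4) unfolding T_def by blast
  qed
  moreover have "\<rho> x y \<le> 2 * real r * (f y - f x)"
    using cover[of "{}"] f unfolding T_def by auto
  ultimately show ?thesis by blast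
qed

end

section \<open>Reproducing kernel Hilbert spaces\<close>

definition fadd :: "('i \<Rightarrow> complex) \<Rightarrow> ('i \<Rightarrow> complex) \<Rightarrow> 'i \<Rightarrow> complex" where
  "fadd f g = (\<lambda>x. f x + g x)"

definition fscale :: "complex \<Rightarrow> ('i \<Rightarrow> complex) \<Rightarrow> 'i \<Rightarrow> complex" where
  "fscale a f = (\<lambda>x. a * f x)"

abbreviation fdiff :: "('i \<Rightarrow> complex) \<Rightarrow> ('i \<Rightarrow> complex) \<Rightarrow> 'i \<Rightarrow> complex" where
  "fdiff f g \<equiv> fadd f (fscale (-1) g)"

definition supp :: "('i \<Rightarrow> complex) \<Rightarrow> 'i set" where
  "supp c = {x. c x \<noteq> 0}"

definition finsupp :: "('i \<Rightarrow> complex) set" where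
  "finsupp = {c. finite (supp c)}"

lemma finsupp_add: "c \<in> finsupp \<Longrightarrow> e \<in> finsupp \<Longrightarrow> fadd c e \<in> finsupp"
  unfolding finsupp_def mem_Collect_eq
  by (rule finite_subset[of _ "supp c \<union> supp e"]) (auto simp: supp_def fadd_def)

lemma finsupp_scale: "c \<in> finsupp \<Longrightarrow> fscale a c \<in> finsupp"
  unfolding finsupp_def mem_Collect_eq
  by (rule finite_subset[of _ "supp c"]) (auto simp: supp_def fscale_def)

lemmas finsupp_diff = finsupp_add[OF _ finsupp_scale]

locale kernel =
  fixes K :: "'i \<Rightarrow> 'i \<Rightarrow> real"
  assumes K_sym: "K x y = K y x"
    and K_psd: "finite F \<Longrightarrow> 0 \<le> (\<Sum>x\<in>F. \<Sum>y\<in>F. c x * c y * K x y)"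
begin

text \<open>The combination of kernel functions with coefficients \<open>c\<close>; \<open>B\<close>
  below is the Gram form on coefficients. It may be degenerate, and \<open>T\<close> forgets its
  null vectors.\<close>

definition T :: "('i \<Rightarrow> complex) \<Rightarrow> 'i \<Rightarrow> complex" where
  "T c y = (\<Sum>x\<in>supp c. c x * of_real (K x y))"

definition B :: "('i \<Rightarrow> complex) \<Rightarrow> ('i \<Rightarrow> complex) \<Rightarrow> complex" where
  "B c e = (\<Sum>y\<in>supp e. T c y * cnj (e y))"

lemma T_eq: "\<lbrakk>finite F; supp c \<subseteq> F\<rbrakk> \<Longrightarrow> T c y = (\<Sum>x\<in>F. c x * of_real (K x y))"
  unfolding T_def by (rule sum.mono_neutral_left) (auto simp: supp_def)

lemma T_add:
  assumes "c \<in> finsupp" "e \<in> finsupp"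
  shows "T (fadd c e) = fadd (T c) (T e)"
proof
  fix y
  have F: "finite (supp c \<union> supp e)" "supp c \<subseteq> supp c \<union> supp e" "supp e \<subseteq> supp c \<union> supp e"
    "supp (fadd c e) \<subseteq> supp c \<union> supp e"
    using assms by (auto simp: finsupp_def supp_def fadd_def)
  show "T (fadd c e) y = fadd (T c) (T e) y"
    using T_eq[OF F(1,4), of y] T_eq[OF F(1,2), of y] T_eq[OF F(1,3), of y]
    by (simp add: fadd_def sum.distrib ring_distribs)
qed

lemma T_scale:
  assumes "c \<in> finsupp"
  shows "T (fscale a c) = fscale a (T c)"
proof
  fix y
  have F: "finite (supp c)" "supp c \<subseteq> supp c" "supp (fscale a c) \<subseteq> supp c"
    using assms by (auto simp: finsupp_def supp_def fscale_def)
  show "T (fscale a c) y = fscale a (T c) y"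
    using T_eq[OF F(1,3), of y] T_eq[OF F(1,2), of y]
    by (simp add: fscale_def sum_distrib_left mult.assoc)
qed

lemma T_diff: "\<lbrakk>c \<in> finsupp; e \<in> finsupp\<rbrakk> \<Longrightarrow> T (fdiff c e) = fdiff (T c) (T e)"
  by (simp add: T_add T_scale finsupp_scale)

lemma B_add_left: "\<lbrakk>c \<in> finsupp; c' \<in> finsupp\<rbrakk> \<Longrightarrow> B (fadd c c') e = B c e + B c' e"
  unfolding B_def by (simp add: T_add) (simp add: fadd_def sum.distrib ring_distribs)

lemma B_scale_left: "c \<in> finsupp \<Longrightarrow> B (fscale a c) e = a * B c e"
  unfolding B_def by (simp add: T_scale) (simp add: fscale_def sum_distrib_left mult.assoc)

lemma B_cnj: "B e c = cnj (B c e)"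
proof -
  have "B e c = (\<Sum>y\<in>supp c. \<Sum>x\<in>supp e. e x * of_real (K x y) * cnj (c y))"
    unfolding B_def T_def by (simp add: sum_distrib_right)
  also have "\<dots> = (\<Sum>x\<in>supp e. \<Sum>y\<in>supp c. e x * of_real (K x y) * cnj (c y))" by (rule sum.swap)
  also have "\<dots> = cnj (B c e)"
    unfolding B_def T_def by (simp add: sum_distrib_left sum_distrib_right K_sym mult.commute mult.left_commute)
  finally show ?thesis .
qed

lemma B_add_right: "\<lbrakk>c \<in> finsupp; c' \<in> finsupp\<rbrakk> \<Longrightarrow> B e (fadd c c') = B e c + B e c'"
  using B_cnj[of e] B_add_left[of c c' e] by simp

lemma B_scale_right: "c \<in> finsupp \<Longrightarrow> B e (fscale a c) = cnj a * B e c"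
  using B_cnj[of e] B_scale_left[of c a e] by simp

text \<open>The real part of \<open>c x * cnj (c y)\<close> is a sum of a product of real parts and
  one of imaginary parts, leaving two real quadratic forms.\<close>

lemma B_nonneg:
  assumes "c \<in> finsupp"
  shows "0 \<le> Re (B c c)"
proof -
  let ?F = "supp c"
  have F: "finite ?F" using assms unfolding finsupp_def by simp
  have "Re (B c c) = (\<Sum>y\<in>?F. \<Sum>x\<in>?F. Re (c x) * Re (c y) * K x y) + (\<Sum>y\<in>?F. \<Sum>x\<in>?F. Im (c x) * Im (c y) * K x y)"
    unfolding B_def T_def by (simp add: sum_distrib_left sum_distrib_right sum.distrib[symmetric] algebra_simps)
  also have "\<dots> = (\<Sum>y\<in>?F. \<Sum>x\<in>?F. Re (c y) * Re (c x) * K y x) + (\<Sum>y\<in>?F. \<Sum>x\<in>?F. Im (c y) * Im (c x) * K y x)"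
    by (simp add: K_sym mult.commute)
  also have "\<dots> \<ge> 0" using K_psd[OF F, of "\<lambda>x. Re (c x)"] K_psd[OF F, of "\<lambda>x. Im (c x)"] by simp
  finally show ?thesis .
qed

definition p :: "('i \<Rightarrow> complex) \<Rightarrow> real" where
  "p c = sqrt (Re (B c c))"

lemma p_nonneg: "c \<in> finsupp \<Longrightarrow> 0 \<le> p c"
  unfolding p_def using B_nonneg by simp

lemma p_square: "c \<in> finsupp \<Longrightarrow> (p c)\<^sup>2 = Re (B c c)"
  unfolding p_def using B_nonneg by simp

lemma Cauchy_Schwarz:
  assumes c: "c \<in> finsupp" and e: "e \<in> finsupp"
  shows "cmod (B c e) \<le> p c * p e"
proof -
  define \<alpha> where "\<alpha> = B c e"
  have expand: "0 \<le> (p c)\<^sup>2 - 2 * s * (cmod \<alpha>)\<^sup>2 + s\<^sup>2 * (cmod \<alpha>)\<^sup>2 * (p e)\<^sup>2" for s :: real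
  proof -
    let ?t = "of_real s * \<alpha>"
    let ?d = "fadd c (fscale (- ?t) e)"
    have te: "fscale (- ?t) e \<in> finsupp" by (rule finsupp_scale[OF e])
    have "B ?d ?d = B c c - cnj ?t * B c e - ?t * B e c + ?t * cnj ?t * B e e"
      by (simp add: B_add_left B_add_right B_scale_left B_scale_right c e finsupp_add finsupp_scale algebra_simps)
    also have "B e c = cnj \<alpha>" unfolding \<alpha>_def by (rule B_cnj)
    also have "B c e = \<alpha>" by (simp add: \<alpha>_def)
    also have "B c c - cnj ?t * \<alpha> - ?t * cnj \<alpha> + ?t * cnj ?t * B e e =
        B c c - of_real (2 * s * (cmod \<alpha>)\<^sup>2) + of_real (s\<^sup>2 * (cmod \<alpha>)\<^sup>2) * B e e"
    proof -
      have n: "of_real ((cmod \<alpha>)\<^sup>2) = \<alpha> * cnj \<alpha>" by (rule complex_norm_square)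
      show ?thesis unfolding of_real_mult n by (simp add: algebra_simps power2_eq_square)
    qed
    finally have "Re (B ?d ?d) = Re (B c c) - 2 * s * (cmod \<alpha>)\<^sup>2 + s\<^sup>2 * (cmod \<alpha>)\<^sup>2 * Re (B e e)" by simp
    then show ?thesis using B_nonneg[OF finsupp_add[OF c te]] by (simp add: p_square c e)
  qed
  have "(cmod \<alpha>)\<^sup>2 \<le> (p c)\<^sup>2 * (p e)\<^sup>2"
  proof (cases "p e = 0")
    case True
    have "(cmod \<alpha>)\<^sup>2 = 0"
    proof (rule ccontr)
      assume ne: "(cmod \<alpha>)\<^sup>2 \<noteq> 0"
      \<comment> \<open>If \<open>p e = 0\<close>, the bound is linear in \<open>s\<close>; this
        value of \<open>s\<close> makes it equal to -1.\<close>
      then show False using expand[of "((p c)\<^sup>2 + 1) / (2 * (cmod \<alpha>)\<^sup>2)"] True by (simp add: field_simps)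
    qed
    then show ?thesis using True by simp
  next
    case False
    then have pos: "(p e)\<^sup>2 > 0" by simp
    have "0 \<le> (p c)\<^sup>2 - (cmod \<alpha>)\<^sup>2 / (p e)\<^sup>2"
      using expand[of "1 / (p e)\<^sup>2"] False by (simp add: field_simps power2_eq_square)
    then show ?thesis using pos by (simp add: field_simps)
  qed
  then have "(cmod \<alpha>)\<^sup>2 \<le> (p c * p e)\<^sup>2" by (simp add: power_mult_distrib)
  then show ?thesis unfolding \<alpha>_def using p_nonneg[OF c] p_nonneg[OF e]
    by (meson mult_nonneg_nonneg power2_le_imp_le)
qed

lemma p_triangle:
  assumes c: "c \<in> finsupp" and e: "e \<in> finsupp"
  shows "p (fadd c e) \<le> p c + p e"
proof (rule power2_le_imp_le)
  have "(p (fadd c e))\<^sup>2 = Re (B (fadd c e) (fadd c e))" by (simp add: p_square finsupp_add c e)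
  also have "B (fadd c e) (fadd c e) = B c c + B c e + B e c + B e e"
    by (simp add: B_add_left B_add_right c e finsupp_add)
  also have "Re \<dots> = (p c)\<^sup>2 + 2 * Re (B c e) + (p e)\<^sup>2" using B_cnj[of e c] by (simp add: p_square c e)
  also have "\<dots> \<le> (p c)\<^sup>2 + 2 * (p c * p e) + (p e)\<^sup>2"
    using Cauchy_Schwarz[OF c e] complex_Re_le_cmod[of "B c e"] by linarith
  finally show "(p (fadd c e))\<^sup>2 \<le> (p c + p e)\<^sup>2" by (simp add: power2_sum)
  show "0 \<le> p c + p e" using p_nonneg c e by simp
qed

lemma p_scale: "c \<in> finsupp \<Longrightarrow> p (fscale a c) = cmod a * p c"
proof -
  assume c: "c \<in> finsupp"
  have "B (fscale a c) (fscale a c) = of_real ((cmod a)\<^sup>2) * B c c"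
    using complex_norm_square[of a] by (simp add: B_scale_left B_scale_right c finsupp_scale mult.assoc)
  then show ?thesis unfolding p_def by (simp add: real_sqrt_mult)
qed

lemma fdiff_swap: "fdiff c e = fscale (-1) (fdiff e c)"
  unfolding fadd_def fscale_def by auto

lemma p_diff_commute: "c \<in> finsupp \<Longrightarrow> e \<in> finsupp \<Longrightarrow> p (fdiff c e) = p (fdiff e c)"
  by (subst fdiff_swap) (simp add: p_scale finsupp_diff)

lemma fdiff_split: "fdiff c e = fadd (fdiff c d) (fdiff d e)"
  unfolding fadd_def fscale_def by auto

definition \<delta> :: "'i \<Rightarrow> 'i \<Rightarrow> complex" where
  "\<delta> y = (\<lambda>x. if x = y then 1 else 0)"

lemma supp_\<delta>: "supp (\<delta> y) = {y}"
  unfolding supp_def \<delta>_def by auto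

lemma \<delta>_finsupp: "\<delta> y \<in> finsupp"
  unfolding finsupp_def by (simp add: supp_\<delta>)

text \<open>The reproducing property: pairing with a point mass evaluates \<open>T c\<close>. With
  Cauchy-Schwarz it makes evaluation continuous.\<close>

lemma B_\<delta>: "B c (\<delta> y) = T c y"
  unfolding B_def supp_\<delta> by (simp add: \<delta>_def)

lemma T_bound: "c \<in> finsupp \<Longrightarrow> cmod (T c y) \<le> p c * p (\<delta> y)"
  using Cauchy_Schwarz[OF _ \<delta>_finsupp, of c y] by (simp add: B_\<delta>)

section \<open>Cauchy sequences of coefficients and their limit functions\<close>

definition cauchy :: "(nat \<Rightarrow> 'i \<Rightarrow> complex) \<Rightarrow> bool" where
  "cauchy s \<longleftrightarrow> (\<forall>n. s n \<in> finsupp) \<and>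
     (\<forall>\<epsilon>>0. \<exists>N. \<forall>m\<ge>N. \<forall>n\<ge>N. p (fdiff (s m) (s n)) < \<epsilon>)"

lemma cauchy_finsupp: "cauchy s \<Longrightarrow> s n \<in> finsupp"
  unfolding cauchy_def by blast

lemma cauchyE:
  assumes "cauchy s" "\<epsilon> > 0"
  obtains N where "\<And>m n. m \<ge> N \<Longrightarrow> n \<ge> N \<Longrightarrow> p (fdiff (s m) (s n)) < \<epsilon>"
  using assms unfolding cauchy_def by blast

lemma cauchy_bounded:
  assumes s: "cauchy s"
  obtains C where "C > 0" "\<And>n. p (s n) \<le> C"
proof -
  obtain N where N: "\<And>m n. m \<ge> N \<Longrightarrow> n \<ge> N \<Longrightarrow> p (fdiff (s m) (s n)) < 1" using cauchyE[OF s, of 1] by auto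
  note fs = cauchy_finsupp[OF s]
  define C where "C = p (s N) + 1 + (\<Sum>n\<le>N. p (s n))"
  have sum0: "0 \<le> (\<Sum>n\<le>N. p (s n))" by (intro sum_nonneg p_nonneg fs)
  show thesis
  proof (rule that)
    show "C > 0" unfolding C_def using sum0 p_nonneg[OF fs[of N]] by linarith
    fix n
    show "p (s n) \<le> C"
    proof (cases "n \<le> N")
      case True
      then have "p (s n) \<le> (\<Sum>n\<le>N. p (s n))" by (intro member_le_sum) (auto intro: p_nonneg fs)
      then show ?thesis unfolding C_def using p_nonneg[OF fs[of N]] by linarith
    next
      case False
      have "s n = fadd (fdiff (s n) (s N)) (s N)" unfolding fadd_def fscale_def by auto
      then have "p (s n) \<le> p (fdiff (s n) (s N)) + p (s N)" using p_triangle[OF finsupp_diff[OF fs fs] fs] by metis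
      then show ?thesis unfolding C_def using N[of n N] False sum0 by simp
    qed
  qed
qed

lemma cauchy_add:
  assumes s: "cauchy s" and t: "cauchy t"
  shows "cauchy (\<lambda>n. fadd (s n) (t n))"
  unfolding cauchy_def
proof (intro conjI allI impI)
  note fs = cauchy_finsupp[OF s] and ft = cauchy_finsupp[OF t]
  show "fadd (s n) (t n) \<in> finsupp" for n by (rule finsupp_add[OF fs ft])
  fix \<epsilon> :: real assume "\<epsilon> > 0"
  then have e: "\<epsilon> / 2 > 0" by simp
  obtain N1 where N1: "\<And>m n. m \<ge> N1 \<Longrightarrow> n \<ge> N1 \<Longrightarrow> p (fdiff (s m) (s n)) < \<epsilon> / 2" using cauchyE[OF s e] by blast
  obtain N2 where N2: "\<And>m n. m \<ge> N2 \<Longrightarrow> n \<ge> N2 \<Longrightarrow> p (fdiff (t m) (t n)) < \<epsilon> / 2" using cauchyE[OF t e] by blast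
  have "p (fdiff (fadd (s m) (t m)) (fadd (s n) (t n))) < \<epsilon>" if "m \<ge> max N1 N2" "n \<ge> max N1 N2" for m n
  proof -
    have "fdiff (fadd (s m) (t m)) (fadd (s n) (t n)) = fadd (fdiff (s m) (s n)) (fdiff (t m) (t n))"
      unfolding fadd_def fscale_def by auto
    then have "p (fdiff (fadd (s m) (t m)) (fadd (s n) (t n))) \<le> p (fdiff (s m) (s n)) + p (fdiff (t m) (t n))"
      using p_triangle[OF finsupp_diff[OF fs fs] finsupp_diff[OF ft ft]] by metis
    then show ?thesis using N1[of m n] N2[of m n] that by simp
  qed
  then show "\<exists>N. \<forall>m\<ge>N. \<forall>n\<ge>N. p (fdiff (fadd (s m) (t m)) (fadd (s n) (t n))) < \<epsilon>" by blast
qed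

lemma cauchy_scale:
  assumes s: "cauchy s"
  shows "cauchy (\<lambda>n. fscale a (s n))"
  unfolding cauchy_def
proof (intro conjI allI impI)
  note fs = cauchy_finsupp[OF s]
  show "fscale a (s n) \<in> finsupp" for n by (rule finsupp_scale[OF fs])
  fix \<epsilon> :: real assume "\<epsilon> > 0"
  then have e: "\<epsilon> / (cmod a + 1) > 0" by (simp add: add_nonneg_pos)
  obtain N where N: "\<And>m n. m \<ge> N \<Longrightarrow> n \<ge> N \<Longrightarrow> p (fdiff (s m) (s n)) < \<epsilon> / (cmod a + 1)" using cauchyE[OF s e] by blast
  have "p (fdiff (fscale a (s m)) (fscale a (s n))) < \<epsilon>" if "m \<ge> N" "n \<ge> N" for m n
  proof -
    have "fdiff (fscale a (s m)) (fscale a (s n)) = fscale a (fdiff (s m) (s n))"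
      unfolding fadd_def fscale_def by (auto simp: algebra_simps)
    then have "p (fdiff (fscale a (s m)) (fscale a (s n))) = cmod a * p (fdiff (s m) (s n))"
      by (simp add: p_scale finsupp_diff fs)
    also have "\<dots> \<le> (cmod a + 1) * p (fdiff (s m) (s n))" using p_nonneg[OF finsupp_diff[OF fs fs]] by (simp add: mult_right_mono)
    also have "\<dots> < \<epsilon>" using N[OF that] by (simp add: field_simps add_pos_nonneg pos_less_divide_eq add_nonneg_pos)
    finally show ?thesis .
  qed
  then show "\<exists>N. \<forall>m\<ge>N. \<forall>n\<ge>N. p (fdiff (fscale a (s m)) (fscale a (s n))) < \<epsilon>" by blast
qed

lemma cauchy_const: "c \<in> finsupp \<Longrightarrow> cauchy (\<lambda>n. c)"
proof -
  assume c: "c \<in> finsupp"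
  have "fdiff c c = fscale 0 c" unfolding fadd_def fscale_def by auto
  then have "p (fdiff c c) = 0" using p_scale[OF c, of 0] by simp
  then show ?thesis unfolding cauchy_def using c by simp
qed

text \<open>\<open>f\<close> represents the class of the Cauchy sequence \<open>s\<close> in the
  completion. Evaluation being continuous, the class is recorded by its pointwise limit.\<close>

definition rep :: "('i \<Rightarrow> complex) \<Rightarrow> (nat \<Rightarrow> 'i \<Rightarrow> complex) \<Rightarrow> bool" where
  "rep f s \<longleftrightarrow> cauchy s \<and> (\<forall>y. (\<lambda>n. T (s n) y) \<longlonglongrightarrow> f y)"

lemma rep_cauchy: "rep f s \<Longrightarrow> cauchy s"
  unfolding rep_def by blast

lemma rep_finsupp: "rep f s \<Longrightarrow> s n \<in> finsupp"
  using rep_cauchy cauchy_finsupp by blast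

lemma rep_add: "\<lbrakk>rep f s; rep g t\<rbrakk> \<Longrightarrow> rep (fadd f g) (\<lambda>n. fadd (s n) (t n))"
  unfolding rep_def
  by (auto simp: cauchy_add T_add cauchy_finsupp) (simp add: fadd_def tendsto_add)

lemma rep_scale: "rep f s \<Longrightarrow> rep (fscale a f) (\<lambda>n. fscale a (s n))"
  unfolding rep_def
  by (auto simp: cauchy_scale T_scale cauchy_finsupp) (simp add: fscale_def tendsto_mult_left)

lemma rep_const: "c \<in> finsupp \<Longrightarrow> rep (T c) (\<lambda>n. c)"
  unfolding rep_def by (simp add: cauchy_const)

lemma rep_B_lim:
  assumes "rep f s"
  shows "(\<lambda>n. B (s n) e) \<longlonglongrightarrow> (\<Sum>y\<in>supp e. f y * cnj (e y))"
  unfolding B_def using assms unfolding rep_def by (intro tendsto_intros) blast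

text \<open>The inner product on limits below is well defined because of this.\<close>
lemma rep_zero_null:
  assumes s: "rep (\<lambda>x. 0) s"
  shows "(\<lambda>n. p (s n)) \<longlonglongrightarrow> 0"
proof -
  note fs = rep_finsupp[OF s]
  obtain C where C: "C > 0" "\<And>n. p (s n) \<le> C" using cauchy_bounded[OF rep_cauchy[OF s]] by blast
  have "(\<lambda>n. (p (s n))\<^sup>2) \<longlonglongrightarrow> 0"
  proof (rule LIMSEQ_I)
    fix r :: real assume r: "r > 0"
    then have "r / (2 * C) > 0" using C by simp
    then obtain N where N: "\<And>m n. m \<ge> N \<Longrightarrow> n \<ge> N \<Longrightarrow> p (fdiff (s m) (s n)) < r / (2 * C)"
      using cauchyE[OF rep_cauchy[OF s]] by blast
    have "(\<lambda>n. B (s n) (s N)) \<longlonglongrightarrow> 0" using rep_B_lim[OF s, of "s N"] by simp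
    then obtain N' where N': "\<And>n. n \<ge> N' \<Longrightarrow> cmod (B (s n) (s N)) < r / 2"
      using LIMSEQ_D[of _ 0 "r / 2"] r by auto
    have "norm ((p (s n))\<^sup>2 - 0) < r" if n: "n \<ge> max N N'" for n
    proof -
      have "s n = fadd (fdiff (s n) (s N)) (s N)" unfolding fadd_def fscale_def by auto
      then have "B (s n) (s n) = B (s n) (fadd (fdiff (s n) (s N)) (s N))" by (rule arg_cong)
      also have "\<dots> = B (s n) (fdiff (s n) (s N)) + B (s n) (s N)"
        by (rule B_add_right[OF finsupp_diff[OF fs fs] fs])
      finally have "(p (s n))\<^sup>2 \<le> cmod (B (s n) (fdiff (s n) (s N))) + cmod (B (s n) (s N))"
        using complex_Re_le_cmod[of "B (s n) (s n)"] norm_triangle_ineq[of "B (s n) (fdiff (s n) (s N))" "B (s n) (s N)"]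
        by (simp add: p_square fs)
      also have "cmod (B (s n) (fdiff (s n) (s N))) \<le> p (s n) * p (fdiff (s n) (s N))"
        by (rule Cauchy_Schwarz[OF fs finsupp_diff[OF fs fs]])
      also have "\<dots> \<le> C * (r / (2 * C))"
        using C N[of n N] n p_nonneg[OF fs] p_nonneg[OF finsupp_diff[OF fs fs]]
        by (intro mult_mono) (auto simp: less_imp_le)
      also have "C * (r / (2 * C)) = r / 2" using C by simp
      finally show ?thesis using N'[of n] n by simp
    qed
    then show "\<exists>no. \<forall>n\<ge>no. norm ((p (s n))\<^sup>2 - 0) < r" by blast
  qed
  then have "(\<lambda>n. sqrt ((p (s n))\<^sup>2)) \<longlonglongrightarrow> sqrt 0" by (rule tendsto_real_sqrt)
  then show ?thesis using p_nonneg[OF fs] by simp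
qed

lemma B_null:
  assumes s: "(\<lambda>n. p (s n)) \<longlonglongrightarrow> 0" "\<And>n. s n \<in> finsupp" and t: "cauchy t"
  shows "(\<lambda>n. B (s n) (t n)) \<longlonglongrightarrow> 0" "(\<lambda>n. B (t n) (s n)) \<longlonglongrightarrow> 0"
proof -
  obtain C where C: "C > 0" "\<And>n. p (t n) \<le> C" using cauchy_bounded[OF t] by blast
  show "(\<lambda>n. B (s n) (t n)) \<longlonglongrightarrow> 0"
  proof (rule Lim_null_comparison)
    have "cmod (B (s n) (t n)) \<le> p (s n) * C" for n
      using Cauchy_Schwarz[OF s(2) cauchy_finsupp[OF t], of n n] C(2)[of n] p_nonneg[OF s(2), of n]
      by (meson mult_left_mono order_trans)
    then show "\<forall>\<^sub>F n in sequentially. norm (B (s n) (t n)) \<le> p (s n) * C" by simp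
    show "(\<lambda>n. p (s n) * C) \<longlonglongrightarrow> 0" using s(1) by (rule tendsto_mult_left_zero)
  qed
  then have "(\<lambda>n. cnj (B (s n) (t n))) \<longlonglongrightarrow> cnj 0" by (rule tendsto_cnj)
  moreover have "cnj (B (s n) (t n)) = B (t n) (s n)" for n by (rule B_cnj[symmetric])
  ultimately show "(\<lambda>n. B (t n) (s n)) \<longlonglongrightarrow> 0" by simp
qed

lemma B_convergent:
  assumes s: "cauchy s" and t: "cauchy t"
  shows "convergent (\<lambda>n. B (s n) (t n))"
proof -
  note fs = cauchy_finsupp[OF s] and ft = cauchy_finsupp[OF t]
  obtain C where C: "C > 0" "\<And>n. p (s n) \<le> C" using cauchy_bounded[OF s] by blast
  obtain D where D: "D > 0" "\<And>n. p (t n) \<le> D" using cauchy_bounded[OF t] by blast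
  have "Cauchy (\<lambda>n. B (s n) (t n))"
  proof (rule metric_CauchyI)
    fix r :: real assume r: "r > 0"
    then have "r / (2 * D) > 0" "r / (2 * C) > 0" using C D by simp_all
    then obtain N1 N2 where N1: "\<And>m n. m \<ge> N1 \<Longrightarrow> n \<ge> N1 \<Longrightarrow> p (fdiff (s m) (s n)) < r / (2 * D)"
      and N2: "\<And>m n. m \<ge> N2 \<Longrightarrow> n \<ge> N2 \<Longrightarrow> p (fdiff (t m) (t n)) < r / (2 * C)"
      using cauchyE[OF s, of "r / (2 * D)"] cauchyE[OF t, of "r / (2 * C)"] by metis
    have "dist (B (s m) (t m)) (B (s n) (t n)) < r" if mn: "m \<ge> max N1 N2" "n \<ge> max N1 N2" for m n
    proof -
      have "B (s m) (t m) - B (s n) (t n) = B (fdiff (s m) (s n)) (t m) + B (s n) (fdiff (t m) (t n))"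
        by (simp add: B_add_left B_add_right B_scale_left B_scale_right finsupp_scale fs ft)
      then have "dist (B (s m) (t m)) (B (s n) (t n)) \<le>
          cmod (B (fdiff (s m) (s n)) (t m)) + cmod (B (s n) (fdiff (t m) (t n)))"
        by (simp add: dist_norm norm_triangle_ineq)
      also have "cmod (B (fdiff (s m) (s n)) (t m)) \<le> p (fdiff (s m) (s n)) * p (t m)"
        by (rule Cauchy_Schwarz[OF finsupp_diff[OF fs fs] ft])
      also have "p (fdiff (s m) (s n)) * p (t m) \<le> p (fdiff (s m) (s n)) * D"
        by (intro mult_left_mono D p_nonneg finsupp_diff fs)
      also have "p (fdiff (s m) (s n)) * D < r / (2 * D) * D"
        using N1[of m n] mn D by (intro mult_strict_right_mono) auto
      also have "cmod (B (s n) (fdiff (t m) (t n))) \<le> p (s n) * p (fdiff (t m) (t n))"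
        by (rule Cauchy_Schwarz[OF fs finsupp_diff[OF ft ft]])
      also have "p (s n) * p (fdiff (t m) (t n)) \<le> C * p (fdiff (t m) (t n))"
        by (intro mult_right_mono C p_nonneg finsupp_diff ft)
      also have "C * p (fdiff (t m) (t n)) < C * (r / (2 * C))"
        using N2[of m n] mn C by (intro mult_strict_left_mono) auto
      also have "r / (2 * D) * D + C * (r / (2 * C)) = r" using C D by simp
      finally show ?thesis by simp
    qed
    then show "\<exists>M. \<forall>m\<ge>M. \<forall>n\<ge>M. dist (B (s m) (t m)) (B (s n) (t n)) < r" by blast
  qed
  then show ?thesis by (rule Cauchy_convergent)
qed

section \<open>The completion as a Hilbert space of functions\<close>

definition V :: "('i \<Rightarrow> complex) set" where
  "V = {f. \<exists>s. rep f s}"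

definition ip :: "('i \<Rightarrow> complex) \<Rightarrow> ('i \<Rightarrow> complex) \<Rightarrow> complex" where
  "ip f g = lim (\<lambda>n. B ((SOME s. rep f s) n) ((SOME s. rep g s) n))"

lemma V_obtain:
  assumes "f \<in> V" obtains s where "rep f s"
  using assms unfolding V_def by blast

lemma rep_diff: "\<lbrakk>rep f s; rep g t\<rbrakk> \<Longrightarrow> rep (fdiff f g) (\<lambda>n. fdiff (s n) (t n))"
  by (intro rep_add rep_scale)

text \<open>Two representatives of one function differ by a representative of 0, which is null by
  \<open>rep_zero_null\<close>; so the choice made in \<open>ip\<close> is immaterial.\<close>

lemma ip_lim:
  assumes s: "rep f s" and t: "rep g t"
  shows "(\<lambda>n. B (s n) (t n)) \<longlonglongrightarrow> ip f g"
proof -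
  define s' t' where "s' = (SOME s. rep f s)" and "t' = (SOME s. rep g s)"
  have s': "rep f s'" and t': "rep g t'" 
    unfolding s'_def t'_def using someI[of "rep f", OF s] someI[of "rep g", OF t] by simp_all
  note fs = rep_finsupp[OF s] rep_finsupp[OF s'] and ft = rep_finsupp[OF t] rep_finsupp[OF t']
  have lim: "(\<lambda>n. B (s' n) (t' n)) \<longlonglongrightarrow> ip f g"
    unfolding ip_def s'_def[symmetric] t'_def[symmetric]
    using B_convergent[OF rep_cauchy[OF s'] rep_cauchy[OF t']] by (simp add: convergent_LIMSEQ_iff)
  have zero: "fdiff h h = (\<lambda>x. 0)" for h :: "'i \<Rightarrow> complex" unfolding fadd_def fscale_def by auto
  have 1: "(\<lambda>n. p (fdiff (s n) (s' n))) \<longlonglongrightarrow> 0" "(\<lambda>n. p (fdiff (t n) (t' n))) \<longlonglongrightarrow> 0"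
    using rep_zero_null rep_diff[OF s s'] rep_diff[OF t t'] unfolding zero by auto
  have "(\<lambda>n. B (fdiff (s n) (s' n)) (t n) + B (s' n) (fdiff (t n) (t' n)) + B (s' n) (t' n)) \<longlonglongrightarrow> 0 + 0 + ip f g"
    by (intro tendsto_add lim B_null(1)[OF 1(1)] B_null(2)[OF 1(2)] finsupp_diff fs ft rep_cauchy[OF s'] rep_cauchy[OF t])
  moreover have "B (fdiff (s n) (s' n)) (t n) + B (s' n) (fdiff (t n) (t' n)) + B (s' n) (t' n) = B (s n) (t n)" for n
    by (simp add: B_add_left B_add_right B_scale_left B_scale_right finsupp_scale fs ft)
  ultimately show ?thesis by simp
qed

definition nrm :: "('i \<Rightarrow> complex) \<Rightarrow> real" where
  "nrm f = sqrt (Re (ip f f))"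

lemma nrm_lim: "rep f s \<Longrightarrow> (\<lambda>n. p (s n)) \<longlonglongrightarrow> nrm f"
  unfolding nrm_def p_def by (intro tendsto_real_sqrt tendsto_Re ip_lim)

lemma V_zero: "(\<lambda>x. 0) \<in> V"
proof -
  have "T (\<lambda>x. 0) = (\<lambda>x. 0)" "(\<lambda>x. 0) \<in> finsupp" unfolding T_def finsupp_def supp_def by auto
  then show ?thesis unfolding V_def using rep_const[of "\<lambda>x. 0"] by auto
qed

lemma V_add: "f \<in> V \<Longrightarrow> g \<in> V \<Longrightarrow> fadd f g \<in> V"
  unfolding V_def using rep_add by blast

lemma V_scale: "f \<in> V \<Longrightarrow> fscale a f \<in> V"
  unfolding V_def using rep_scale by blast

lemma V_T: "c \<in> finsupp \<Longrightarrow> T c \<in> V"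
  unfolding V_def using rep_const by blast

lemma nrm_triangle:
  assumes "f \<in> V" "g \<in> V" shows "nrm (fadd f g) \<le> nrm f + nrm g"
proof -
  obtain s t where st: "rep f s" "rep g t" using assms V_obtain by metis
  show ?thesis
    by (rule LIMSEQ_le[OF nrm_lim[OF rep_add[OF st]] tendsto_add[OF nrm_lim[OF st(1)] nrm_lim[OF st(2)]]])
      (use p_triangle rep_finsupp st in blast)
qed

lemma nrm_diff_triangle:
  assumes "f \<in> V" "g \<in> V" "h \<in> V" shows "nrm (fdiff f h) \<le> nrm (fdiff f g) + nrm (fdiff g h)"
  by (subst fdiff_split[of f h g]) (intro nrm_triangle V_add V_scale assms)

lemma nrm_T: "c \<in> finsupp \<Longrightarrow> nrm (T c) = p c"
  using nrm_lim[OF rep_const] LIMSEQ_unique[OF tendsto_const] by metis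

lemma nrm_diff_commute:
  assumes "f \<in> V" "g \<in> V" shows "nrm (fdiff f g) = nrm (fdiff g f)"
proof -
  obtain s t where st: "rep f s" "rep g t" using assms V_obtain by metis
  have "(\<lambda>n. p (fdiff (s n) (t n))) = (\<lambda>n. p (fdiff (t n) (s n)))"
    using p_diff_commute rep_finsupp st by blast
  then show ?thesis using nrm_lim[OF rep_diff[OF st]] nrm_lim[OF rep_diff[OF st(2,1)]] LIMSEQ_unique by metis
qed

lemma nrm_tail:
  assumes s: "rep f s" and N: "\<And>m n. m \<ge> N \<Longrightarrow> n \<ge> N \<Longrightarrow> p (fdiff (s m) (s n)) < e" and k: "k \<ge> N"
  shows "nrm (fdiff f (T (s k))) \<le> e"
proof -
  have "(\<lambda>n. p (fdiff (s n) (s k))) \<longlonglongrightarrow> nrm (fdiff f (T (s k)))"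
    by (rule nrm_lim[OF rep_diff[OF s rep_const[OF rep_finsupp[OF s]]]])
  then show ?thesis by (rule LIMSEQ_le_const2) (use N k less_imp_le in blast)
qed

lemma V_approx:
  assumes "f \<in> V" "e > 0"
  shows "\<exists>c\<in>finsupp. nrm (fdiff f (T c)) < e"
proof -
  obtain s where s: "rep f s" using V_obtain[OF assms(1)] .
  have "e / 2 > 0" using assms(2) by simp
  then obtain N where N: "\<And>m n. m \<ge> N \<Longrightarrow> n \<ge> N \<Longrightarrow> p (fdiff (s m) (s n)) < e / 2"
    using cauchyE[OF rep_cauchy[OF s]] by blast
  have "nrm (fdiff f (T (s N))) \<le> e / 2" by (rule nrm_tail[OF s N]) auto
  then show ?thesis using rep_finsupp[OF s] assms(2) by (intro bexI[of _ "s N"]) auto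
qed

text \<open>Replace the n-th function by some \<open>T (c n)\<close> with error below 1/(n + 1). The
  coefficients are then Cauchy, and pairing with point masses yields their pointwise limit.\<close>

lemma V_complete:
  fixes F :: "nat \<Rightarrow> 'i \<Rightarrow> complex"
  assumes F: "\<And>n. F n \<in> V" and cau: "\<And>\<epsilon>. \<epsilon> > 0 \<Longrightarrow> \<exists>N. \<forall>m\<ge>N. \<forall>n\<ge>N. nrm (fdiff (F m) (F n)) < \<epsilon>"
  shows "\<exists>f\<in>V. \<forall>\<epsilon>>0. \<exists>N. \<forall>n\<ge>N. nrm (fdiff (F n) f) < \<epsilon>"
proof -
  have "\<exists>c\<in>finsupp. nrm (fdiff (F n) (T c)) < 1 / real (Suc n)" for n by (rule V_approx[OF F]) simp
  then obtain c where c: "\<And>n. c n \<in> finsupp" "\<And>n. nrm (fdiff (F n) (T (c n))) < 1 / real (Suc n)" by metis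
  have cV: "T (c n) \<in> V" for n by (rule V_T[OF c(1)])
  have small: "\<exists>N::nat. \<forall>n\<ge>N. 1 / real (Suc n) < e" if e: "e > 0" for e :: real
  proof -
    obtain N where N: "1 / real (Suc N) < e" using nat_approx_posE[OF e] .
    have "1 / real (Suc n) < e" if "n \<ge> N" for n :: nat
      using N frac_le[of 1 1 "real (Suc N)" "real (Suc n)"] that by simp
    then show ?thesis by blast
  qed
  have cc: "cauchy c"
    unfolding cauchy_def
  proof (intro conjI allI impI)
    fix e :: real assume "e > 0"
    then have e3: "e / 3 > 0" by simp
    obtain N1 where N1: "\<And>m n. m \<ge> N1 \<Longrightarrow> n \<ge> N1 \<Longrightarrow> nrm (fdiff (F m) (F n)) < e / 3" using cau[OF e3] by blast
    obtain N2 :: nat where N2: "\<And>n. n \<ge> N2 \<Longrightarrow> 1 / real (Suc n) < e / 3" using small[OF e3] by blast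
    have "p (fdiff (c m) (c n)) < e" if mn: "m \<ge> max N1 N2" "n \<ge> max N1 N2" for m n
    proof -
      have "p (fdiff (c m) (c n)) = nrm (fdiff (T (c m)) (T (c n)))"
        using nrm_T[OF finsupp_diff[OF c(1)[of m] c(1)[of n]], of "-1"] by (simp add: T_diff c(1))
      also have "\<dots> \<le> nrm (fdiff (T (c m)) (F m)) + nrm (fdiff (F m) (T (c n)))"
        by (rule nrm_diff_triangle[OF cV F cV])
      also have "nrm (fdiff (F m) (T (c n))) \<le> nrm (fdiff (F m) (F n)) + nrm (fdiff (F n) (T (c n)))"
        by (rule nrm_diff_triangle[OF F F cV])
      also have "nrm (fdiff (T (c m)) (F m)) = nrm (fdiff (F m) (T (c m)))" by (rule nrm_diff_commute[OF cV F])
      finally show ?thesis using N1[of m n] N2[of m] N2[of n] c(2)[of m] c(2)[of n] mn by simp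
    qed
    then show "\<exists>N. \<forall>m\<ge>N. \<forall>n\<ge>N. p (fdiff (c m) (c n)) < e" by blast
  qed (rule c(1))
  have "\<exists>z. (\<lambda>n. T (c n) y) \<longlonglongrightarrow> z" for y
  proof -
    have "convergent (\<lambda>n. B (c n) (\<delta> y))" by (rule B_convergent[OF cc cauchy_const[OF \<delta>_finsupp]])
    then show ?thesis unfolding B_\<delta> convergent_def .
  qed
  then obtain f where "\<And>y. (\<lambda>n. T (c n) y) \<longlonglongrightarrow> f y" by metis
  then have rep: "rep f c" unfolding rep_def using cc by blast
  then have fV: "f \<in> V" unfolding V_def by blast
  have "\<exists>N. \<forall>n\<ge>N. nrm (fdiff (F n) f) < e" if "e > 0" for e
  proof -
    have e3: "e / 3 > 0" using that by simp
    obtain N1 where N1: "\<And>m n. m \<ge> N1 \<Longrightarrow> n \<ge> N1 \<Longrightarrow> p (fdiff (c m) (c n)) < e / 3" using cauchyE[OF cc e3] by blast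
    obtain N2 :: nat where N2: "\<And>n. n \<ge> N2 \<Longrightarrow> 1 / real (Suc n) < e / 3" using small[OF e3] by blast
    have "nrm (fdiff (F n) f) < e" if n: "n \<ge> max N1 N2" for n
    proof -
      have "nrm (fdiff (F n) f) \<le> nrm (fdiff (F n) (T (c n))) + nrm (fdiff (T (c n)) f)"
        by (rule nrm_diff_triangle[OF F cV fV])
      also have "nrm (fdiff (T (c n)) f) = nrm (fdiff f (T (c n)))" by (rule nrm_diff_commute[OF cV fV])
      also have "\<dots> \<le> e / 3" by (rule nrm_tail[OF rep N1]) (use n in auto)
      finally show ?thesis using c(2)[of n] N2[of n] n \<open>e > 0\<close> by simp
    qed
    then show ?thesis by blast
  qed
  then show ?thesis using fV by blast
qed

definition rkhs :: "('i \<Rightarrow> complex) chilbert" where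
  "rkhs = \<lparr>hcarrier = V, hzero = (\<lambda>x. 0), hadd = fadd, hscale = fscale, hinner = ip\<rparr>"

lemma rkhs_simps [simp]:
  "hcarrier rkhs = V" "hzero rkhs = (\<lambda>x. 0)" "hadd rkhs = fadd" "hscale rkhs = fscale" "hinner rkhs = ip"
  unfolding rkhs_def by simp_all

lemma hnorm_rkhs: "hnorm rkhs f = nrm f"
  unfolding hnorm_def nrm_def by simp

lemma ip_cnj: "f \<in> V \<Longrightarrow> g \<in> V \<Longrightarrow> ip f g = cnj (ip g f)"
proof -
  assume "f \<in> V" "g \<in> V"
  then obtain s t where st: "rep f s" "rep g t" using V_obtain by metis
  have "(\<lambda>n. cnj (B (t n) (s n))) \<longlonglongrightarrow> cnj (ip g f)" by (intro tendsto_cnj ip_lim st)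
  moreover have "cnj (B (t n) (s n)) = B (s n) (t n)" for n by (rule B_cnj[symmetric])
  ultimately have "(\<lambda>n. B (s n) (t n)) \<longlonglongrightarrow> cnj (ip g f)" by simp
  then show ?thesis using ip_lim[OF st] LIMSEQ_unique by blast
qed

lemma ip_add: "f \<in> V \<Longrightarrow> g \<in> V \<Longrightarrow> h \<in> V \<Longrightarrow> ip (fadd f g) h = ip f h + ip g h"
proof -
  assume "f \<in> V" "g \<in> V" "h \<in> V"
  then obtain s t r where st: "rep f s" "rep g t" "rep h r" using V_obtain by metis
  have "(\<lambda>n. B (s n) (r n) + B (t n) (r n)) \<longlonglongrightarrow> ip f h + ip g h" by (intro tendsto_add ip_lim st)
  moreover have "B (s n) (r n) + B (t n) (r n) = B (fadd (s n) (t n)) (r n)" for n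
    by (simp add: B_add_left rep_finsupp[OF st(1)] rep_finsupp[OF st(2)])
  ultimately show ?thesis using ip_lim[OF rep_add[OF st(1,2)] st(3)] LIMSEQ_unique by auto
qed

lemma ip_scale: "f \<in> V \<Longrightarrow> h \<in> V \<Longrightarrow> ip (fscale a f) h = a * ip f h"
proof -
  assume "f \<in> V" "h \<in> V"
  then obtain s r where st: "rep f s" "rep h r" using V_obtain by metis
  have "(\<lambda>n. a * B (s n) (r n)) \<longlonglongrightarrow> a * ip f h" by (intro tendsto_mult_left ip_lim st)
  moreover have "a * B (s n) (r n) = B (fscale a (s n)) (r n)" for n
    by (simp add: B_scale_left rep_finsupp[OF st(1)])
  ultimately have "(\<lambda>n. B (fscale a (s n)) (r n)) \<longlonglongrightarrow> a * ip f h" by simp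
  then show ?thesis using ip_lim[OF rep_scale[OF st(1), of a] st(2)] LIMSEQ_unique by blast
qed

lemma ip_nonneg: "f \<in> V \<Longrightarrow> 0 \<le> Re (ip f f)"
proof -
  assume "f \<in> V"
  then obtain s where s: "rep f s" using V_obtain by blast
  have "(\<lambda>n. Re (B (s n) (s n))) \<longlonglongrightarrow> Re (ip f f)" by (intro tendsto_Re ip_lim s)
  then show ?thesis by (rule LIMSEQ_le_const) (use B_nonneg rep_finsupp[OF s] in blast)
qed

lemma ip_definite: "f \<in> V \<Longrightarrow> ip f f = 0 \<Longrightarrow> f = (\<lambda>x. 0)"
proof
  fix y assume "f \<in> V" "ip f f = 0"
  then obtain s where s: "rep f s" using V_obtain by blast
  have "(\<lambda>n. p (s n)) \<longlonglongrightarrow> 0" using nrm_lim[OF s] \<open>ip f f = 0\<close> unfolding nrm_def by simp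
  then have "(\<lambda>n. p (s n) * p (\<delta> y)) \<longlonglongrightarrow> 0" by (rule tendsto_mult_left_zero)
  then have "(\<lambda>n. T (s n) y) \<longlonglongrightarrow> 0"
    by (rule Lim_null_comparison[rotated]) (simp add: T_bound rep_finsupp[OF s])
  moreover have "(\<lambda>n. T (s n) y) \<longlonglongrightarrow> f y" using s unfolding rep_def by blast
  ultimately show "f y = 0" using LIMSEQ_unique by blast
qed

lemma rkhs_hilbert: "complex_hilbert_space rkhs"
  unfolding complex_hilbert_space_def Let_def rkhs_simps hnorm_rkhs hdiff_def
proof (intro conjI ballI allI impI)
  show "fadd (fadd u v) w = fadd u (fadd v w)" for u v w :: "'i \<Rightarrow> complex"
    unfolding fadd_def by (simp add: add.assoc)
  show "fadd u v = fadd v u" for u v :: "'i \<Rightarrow> complex" unfolding fadd_def by (simp add: add.commute)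
  show "fadd (\<lambda>x. 0) v = v" for v :: "'i \<Rightarrow> complex" unfolding fadd_def by simp
  show "fdiff v v = (\<lambda>x. 0)" for v :: "'i \<Rightarrow> complex" unfolding fadd_def fscale_def by simp
  show "fscale 1 v = v" for v :: "'i \<Rightarrow> complex" unfolding fscale_def by simp
  show "fscale a (fscale b v) = fscale (a * b) v" for a b and v :: "'i \<Rightarrow> complex"
    unfolding fscale_def by (simp add: mult.assoc)
  show "fscale (a + b) v = fadd (fscale a v) (fscale b v)" for a b and v :: "'i \<Rightarrow> complex"
    unfolding fscale_def fadd_def by (simp add: ring_distribs)
  show "fscale a (fadd u v) = fadd (fscale a u) (fscale a v)" for a and u v :: "'i \<Rightarrow> complex"
    unfolding fscale_def fadd_def by (simp add: ring_distribs)
  fix F :: "nat \<Rightarrow> 'i \<Rightarrow> complex" and \<epsilon> :: real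
  assume F: "\<forall>n. F n \<in> V" and c: "\<forall>\<epsilon>>0. \<exists>N. \<forall>m\<ge>N. \<forall>n\<ge>N. nrm (fdiff (F m) (F n)) < \<epsilon>"
  show "\<exists>v\<in>V. \<forall>\<epsilon>>0. \<exists>N. \<forall>n\<ge>N. nrm (fdiff (F n) v) < \<epsilon>"
    by (rule V_complete) (use F c in blast)+
qed (auto intro: V_zero V_add V_scale ip_cnj ip_add ip_scale ip_nonneg ip_definite)

text \<open>The sum is the pairing of \<open>f\<close> with \<open>T e\<close> in the completion, so
  it is bounded by the norm of \<open>e\<close>. It allows \<open>f\<close> to be tested on explicit
  finite sums.\<close>

lemma pairing_bound:
  assumes "f \<in> V"
  obtains C where "C > 0" "\<And>e. e \<in> finsupp \<Longrightarrow> cmod (\<Sum>y\<in>supp e. f y * cnj (e y)) \<le> C * p e"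
proof -
  obtain s where s: "rep f s" using V_obtain[OF assms] .
  obtain C where C: "C > 0" "\<And>n. p (s n) \<le> C" using cauchy_bounded[OF rep_cauchy[OF s]] by blast
  have "cmod (\<Sum>y\<in>supp e. f y * cnj (e y)) \<le> C * p e" if e: "e \<in> finsupp" for e
  proof (rule LIMSEQ_le_const2[OF tendsto_norm[OF rep_B_lim[OF s, of e]]])
    have "cmod (B (s n) e) \<le> C * p e" for n
      using Cauchy_Schwarz[OF rep_finsupp[OF s] e, of n] C(2)[of n] p_nonneg[OF e] by (meson mult_right_mono order_trans)
    then show "\<exists>N. \<forall>n\<ge>N. cmod (B (s n) e) \<le> C * p e" by blast
  qed
  then show ?thesis using that C(1) by blast
qed

section \<open>Symmetries of the kernel, acting by composition\<close>

context
  fixes \<tau> \<tau>' :: "'i \<Rightarrow> 'i"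
  assumes inv: "\<And>x. \<tau> (\<tau>' x) = x" "\<And>x. \<tau>' (\<tau> x) = x" and K_inv: "\<And>x y. K (\<tau> x) (\<tau> y) = K x y"
begin

lemma supp_comp: "supp (c \<circ> \<tau>) = \<tau>' ` supp c"
  unfolding supp_def using inv by (auto simp: image_iff) metis

lemma finsupp_comp: "c \<in> finsupp \<Longrightarrow> c \<circ> \<tau> \<in> finsupp"
  unfolding finsupp_def by (simp add: supp_comp)

lemma sum_comp: "sum h (supp (c \<circ> \<tau>)) = (\<Sum>x\<in>supp c. h (\<tau>' x))"
  unfolding supp_comp by (rule sum.reindex_cong[of \<tau>']) (auto intro: inj_on_inverseI[of _ \<tau>] simp: inv)

lemma T_comp: "T (c \<circ> \<tau>) = T c \<circ> \<tau>"
proof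
  fix y
  have "K (\<tau>' x) y = K x (\<tau> y)" for x using K_inv[of "\<tau>' x" y] inv by simp
  then show "T (c \<circ> \<tau>) y = (T c \<circ> \<tau>) y" unfolding T_def sum_comp by (simp add: inv)
qed

lemma B_comp: "B (c \<circ> \<tau>) (e \<circ> \<tau>) = B c e"
  unfolding B_def sum_comp T_comp by (simp add: inv)

lemma fdiff_comp: "fdiff (c \<circ> \<tau>) (e \<circ> \<tau>) = fdiff c e \<circ> \<tau>"
  unfolding fadd_def fscale_def by auto

lemma p_comp: "p (c \<circ> \<tau>) = p c"
  unfolding p_def by (simp add: B_comp)

lemma rep_comp: "rep f s \<Longrightarrow> rep (f \<circ> \<tau>) (\<lambda>n. s n \<circ> \<tau>)"
  unfolding rep_def cauchy_def fdiff_comp p_comp T_comp by (auto intro: finsupp_comp)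

lemma V_comp: "f \<in> V \<Longrightarrow> f \<circ> \<tau> \<in> V"
  unfolding V_def using rep_comp by blast

lemma ip_comp: "f \<in> V \<Longrightarrow> g \<in> V \<Longrightarrow> ip (f \<circ> \<tau>) (g \<circ> \<tau>) = ip f g"
proof -
  assume "f \<in> V" "g \<in> V"
  then obtain s t where st: "rep f s" "rep g t" using V_obtain by metis
  show ?thesis using ip_lim[OF rep_comp[OF st(1)] rep_comp[OF st(2)]] ip_lim[OF st] LIMSEQ_unique
    unfolding B_comp by blast
qed

end

end

section \<open>Property (T) and bounded orbits\<close>

context kernel
begin

lemma B_\<delta>_\<delta>: "B (\<delta> x) (\<delta> y) = of_real (K x y)"
  unfolding B_\<delta> T_def supp_\<delta> by (simp add: \<delta>_def)

lemma p_\<delta>_diff: "(p (fdiff (\<delta> x) (\<delta> y)))\<^sup>2 = K x x - 2 * K x y + K y y"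
proof -
  have "B (fdiff (\<delta> x) (\<delta> y)) (fdiff (\<delta> x) (\<delta> y)) =
      B (\<delta> x) (\<delta> x) - B (\<delta> x) (\<delta> y) - B (\<delta> y) (\<delta> x) + B (\<delta> y) (\<delta> y)"
    by (simp add: B_add_left B_add_right B_scale_left B_scale_right finsupp_scale finsupp_diff \<delta>_finsupp)
  then show ?thesis by (simp add: p_square finsupp_diff \<delta>_finsupp B_\<delta>_\<delta> K_sym[of y x])
qed

lemma V_zero_outside:
  assumes "f \<in> V" "\<And>x. K x y = 0" shows "f y = 0"
proof -
  obtain s where s: "rep f s" using V_obtain[OF assms(1)] .
  have "T (s n) y = 0" for n unfolding T_def by (simp add: assms(2))
  moreover have "(\<lambda>n. T (s n) y) \<longlonglongrightarrow> f y" using s unfolding rep_def by blast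
  ultimately show ?thesis by (simp add: LIMSEQ_const_iff)
qed

end

text \<open>A kernel \<open>exp (- \<psi>/(n + 1))\<close> on \<open>G\<close> for every \<open>n\<close> gives a kernel on \<open>G \<times> \<nat>\<close>, whose
  reproducing kernel Hilbert space has the carrier type prescribed in the definition of property (T). The
  evaluation functionals at \<open>(1, n)\<close> are almost invariant; an invariant function is constant on each
  \<open>G \<times> {n}\<close>, and testing it against points far apart shows that it vanishes if \<open>\<psi>\<close> is unbounded.\<close>
lemma kazhdan_T_bounded:
  fixes G :: "('g, 'b) monoid_scheme" and \<psi> :: "'g \<Rightarrow> 'g \<Rightarrow> real"
  assumes G: "group G" and KT: "kazhdan_T G"
    and sym: "\<And>g h. g \<in> carrier G \<Longrightarrow> h \<in> carrier G \<Longrightarrow> \<psi> g h = \<psi> h g"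
    and zero: "\<And>g. g \<in> carrier G \<Longrightarrow> \<psi> g g = 0"
    and tri: "\<And>g h k. g \<in> carrier G \<Longrightarrow> h \<in> carrier G \<Longrightarrow> k \<in> carrier G \<Longrightarrow> \<psi> g k \<le> \<psi> g h + \<psi> h k"
    and inv: "\<And>k g h. k \<in> carrier G \<Longrightarrow> g \<in> carrier G \<Longrightarrow> h \<in> carrier G \<Longrightarrow>
      \<psi> (k \<otimes>\<^bsub>G\<^esub> g) (k \<otimes>\<^bsub>G\<^esub> h) = \<psi> g h"
    and psd: "\<And>n A c. finite A \<Longrightarrow> A \<subseteq> carrier G \<Longrightarrow>
      0 \<le> (\<Sum>g\<in>A. \<Sum>h\<in>A. c g * c h * exp (- \<psi> g h / real (Suc n)))"
  shows "\<exists>R. \<forall>g\<in>carrier G. \<psi> \<one>\<^bsub>G\<^esub> g \<le> R"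
proof (rule ccontr)
  assume unb: "\<not> ?thesis"
  interpret group G by (rule G)
  let ?I = "carrier G"
  let ?u = "\<one>\<^bsub>G\<^esub>"
  define E where "E n g h = exp (- \<psi> g h / real (Suc n))" for n g h
  \<comment> \<open>The kernels for different \<open>n\<close> form orthogonal blocks. Indices
    outside the group get a zero row, since the type may be larger than the carrier.\<close>
  define K where "K x y = (if snd x = snd y \<and> fst x \<in> ?I \<and> fst y \<in> ?I then E (snd x) (fst x) (fst y) else 0)"
    for x y :: "'g \<times> nat"
  have K_pair: "K (g, n) (h, n) = E n g h" if "g \<in> ?I" "h \<in> ?I" for g h n
    using that unfolding K_def by simp
  have E_self: "E n g g = 1" if "g \<in> ?I" for n g unfolding E_def using zero[OF that] by simp
  interpret kernel K
  proof
    show "K x y = K y x" for x y unfolding K_def E_def using sym by auto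
    fix F :: "('g \<times> nat) set" and c :: "'g \<times> nat \<Rightarrow> real"
    assume F: "finite F"
    define S where "S n = {g \<in> ?I. (g, n) \<in> F}" for n
    have finS: "finite (S n)" for n
      by (rule finite_subset[of _ "fst ` F"]) (use F in \<open>auto simp: S_def image_iff\<close>, force)
    define \<phi> where "\<phi> x = (\<Sum>y\<in>F. c x * c y * K x y)" for x
    have \<phi>: "\<phi> (g, n) = (\<Sum>h\<in>S n. c (g, n) * c (h, n) * E n g h)" if "g \<in> ?I" for g n
    proof -
      have "\<phi> (g, n) = (\<Sum>y\<in>(\<lambda>h. (h, n)) ` S n. c (g, n) * c y * K (g, n) y)"
        unfolding \<phi>_def
        by (rule sum.mono_neutral_right[OF F]) (auto simp: S_def K_def image_iff)
      also have "\<dots> = (\<Sum>h\<in>S n. c (g, n) * c (h, n) * K (g, n) (h, n))"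
        by (rule sum.reindex_cong[of "\<lambda>h. (h, n)"]) (auto intro: inj_onI)
      also have "\<dots> = (\<Sum>h\<in>S n. c (g, n) * c (h, n) * E n g h)"
        by (rule sum.cong) (use that in \<open>auto simp: S_def K_pair\<close>)
      finally show ?thesis .
    qed
    have \<phi>0: "\<phi> x = 0" if "fst x \<notin> ?I" for x unfolding \<phi>_def using that by (simp add: K_def)
    have "(\<Sum>x\<in>F. \<Sum>y\<in>F. c x * c y * K x y) = (\<Sum>n\<in>snd ` F. \<Sum>x\<in>{x \<in> F. snd x = n}. \<phi> x)"
      unfolding \<phi>_def[symmetric] by (rule sum.group[symmetric]) (use F in auto)
    also have "\<dots> = (\<Sum>n\<in>snd ` F. \<Sum>g\<in>S n. \<Sum>h\<in>S n. c (g, n) * c (h, n) * E n g h)"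
    proof (rule sum.cong[OF refl])
      fix n assume "n \<in> snd ` F"
      have "(\<Sum>x\<in>{x \<in> F. snd x = n}. \<phi> x) = (\<Sum>x\<in>(\<lambda>g. (g, n)) ` S n. \<phi> x)"
        by (rule sum.mono_neutral_right) (use F \<phi>0 in \<open>auto simp: S_def image_iff\<close>)
      also have "\<dots> = (\<Sum>g\<in>S n. \<phi> (g, n))"
        by (rule sum.reindex_cong[of "\<lambda>h. (h, n)"]) (auto intro: inj_onI)
      also have "\<dots> = (\<Sum>g\<in>S n. \<Sum>h\<in>S n. c (g, n) * c (h, n) * E n g h)"
        by (rule sum.cong) (auto simp: S_def \<phi>)
      finally show "(\<Sum>x\<in>{x \<in> F. snd x = n}. \<phi> x) = (\<Sum>g\<in>S n. \<Sum>h\<in>S n. c (g, n) * c (h, n) * E n g h)" .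
    qed
    also have "\<dots> \<ge> 0"
    proof (rule sum_nonneg)
      fix n
      have "S n \<subseteq> ?I" unfolding S_def by blast
      from psd[OF finS this, of "\<lambda>g. c (g, n)" n]
      show "0 \<le> (\<Sum>g\<in>S n. \<Sum>h\<in>S n. c (g, n) * c (h, n) * E n g h)" unfolding E_def .
    qed
    finally show "0 \<le> (\<Sum>x\<in>F. \<Sum>y\<in>F. c x * c y * K x y)" .
  qed
  define \<tau> where "\<tau> k x = (if fst x \<in> ?I then (k \<otimes>\<^bsub>G\<^esub> fst x, snd x) else x)" for k and x :: "'g \<times> nat"
  define \<pi> where "\<pi> g f = f \<circ> \<tau> (inv\<^bsub>G\<^esub> g)" for g and f :: "'g \<times> nat \<Rightarrow> complex"
  have \<tau>mult: "\<tau> (g \<otimes>\<^bsub>G\<^esub> h) x = \<tau> g (\<tau> h x)" if "g \<in> ?I" "h \<in> ?I" for g h x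
    using that unfolding \<tau>_def by (auto simp: m_assoc)
  have \<tau>one: "\<tau> ?u x = x" for x unfolding \<tau>_def by (auto simp: prod_eq_iff)
  have \<tau>inv: "\<tau> g (\<tau> (inv\<^bsub>G\<^esub> g) x) = x" "\<tau> (inv\<^bsub>G\<^esub> g) (\<tau> g x) = x" if "g \<in> ?I" for g x
    using \<tau>mult[of g "inv\<^bsub>G\<^esub> g" x] \<tau>mult[of "inv\<^bsub>G\<^esub> g" g x] that by (simp_all add: \<tau>one)
  have \<tau>K: "K (\<tau> g x) (\<tau> g y) = K x y" if "g \<in> ?I" for g x y
    using that inv unfolding \<tau>_def K_def E_def by auto
  have \<pi>V: "\<pi> g f \<in> V" if "g \<in> ?I" "f \<in> V" for g f
    unfolding \<pi>_def using that(1)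
    by (intro V_comp[of "\<tau> (inv\<^bsub>G\<^esub> g)" "\<tau> g" f] that(2) \<tau>inv \<tau>K) auto
  have \<pi>ip: "ip (\<pi> g u) (\<pi> g v) = ip u v" if "g \<in> ?I" "u \<in> V" "v \<in> V" for g u v
    unfolding \<pi>_def using that(1)
    by (intro ip_comp[of "\<tau> (inv\<^bsub>G\<^esub> g)" "\<tau> g"] that(2,3) \<tau>inv \<tau>K) auto
  have \<pi>inv: "\<pi> g (\<pi> (inv\<^bsub>G\<^esub> g) f) = f" "\<pi> (inv\<^bsub>G\<^esub> g) (\<pi> g f) = f" if "g \<in> ?I" for g f
    using that by (simp_all add: \<pi>_def o_def \<tau>inv)
  have unitary: "unitary_rep G rkhs \<pi>"
    unfolding unitary_rep_def rkhs_simps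
  proof (intro conjI ballI allI)
    fix g assume g: "g \<in> ?I"
    show "bij_betw (\<pi> g) V V"
      by (rule bij_betw_byWitness[where f' = "\<pi> (inv\<^bsub>G\<^esub> g)"]) (use g \<pi>V \<pi>inv in auto)
    show "ip (\<pi> g u) (\<pi> g v) = ip u v" if "u \<in> V" "v \<in> V" for u v by (rule \<pi>ip[OF g that])
    show "\<pi> g (fadd u v) = fadd (\<pi> g u) (\<pi> g v)" for u v unfolding \<pi>_def fadd_def by auto
    show "\<pi> g (fscale a u) = fscale a (\<pi> g u)" for a u unfolding \<pi>_def fscale_def by auto
    show "\<pi> (g \<otimes>\<^bsub>G\<^esub> h) v = \<pi> g (\<pi> h v)" if h: "h \<in> ?I" for h v
      using g h by (simp add: \<pi>_def o_def inv_mult_group \<tau>mult)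
  next
    show "\<pi> ?u v = v" for v unfolding \<pi>_def by (simp add: o_def \<tau>one)
  qed
  have almost: "almost_invariant_vectors G rkhs \<pi>"
    unfolding almost_invariant_vectors_def rkhs_simps hnorm_rkhs hdiff_def
  proof (intro allI impI)
    fix Q and \<epsilon> :: real
    assume Q: "Q \<subseteq> ?I \<and> finite Q" and e: "\<epsilon> > 0"
    \<comment> \<open>This is the squared displacement under \<open>g\<close> of the point mass at
      the identity in block \<open>n\<close>; it tends to 0, uniformly on the finite set
      \<open>Q\<close>.\<close>
    have "(\<lambda>n. 2 - 2 * E n g ?u) \<longlonglongrightarrow> 2 - 2 * exp (- \<psi> g ?u * 0)" for g
      unfolding E_def divide_inverse by (intro tendsto_intros LIMSEQ_inverse_real_of_nat)
    then have "\<forall>\<^sub>F n in sequentially. 2 - 2 * E n g ?u < \<epsilon>\<^sup>2" for g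
      using e by (intro order_tendstoD(2)[of _ 0]) auto
    then have "\<forall>\<^sub>F n in sequentially. \<forall>g\<in>Q. 2 - 2 * E n g ?u < \<epsilon>\<^sup>2"
      using Q by (intro eventually_ball_finite) auto
    then obtain n where n: "\<And>g. g \<in> Q \<Longrightarrow> 2 - 2 * E n g ?u < \<epsilon>\<^sup>2"
      unfolding eventually_sequentially by blast
    define d where "d = \<delta> (?u, n)"
    have d: "d \<in> finsupp" unfolding d_def by (rule \<delta>_finsupp)
    have "p d = 1" unfolding p_def d_def B_\<delta>_\<delta> by (simp add: K_pair E_self)
    moreover have "nrm (fdiff (\<pi> g (T d)) (T d)) < \<epsilon>" if g: "g \<in> Q" for g
    proof -
      have gI: "g \<in> ?I" using g Q by blast
      have "\<pi> g (T d) = T (d \<circ> \<tau> (inv\<^bsub>G\<^esub> g))" unfolding \<pi>_def using gI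
        by (intro T_comp[of "\<tau> (inv\<^bsub>G\<^esub> g)" "\<tau> g", symmetric] \<tau>inv \<tau>K) auto
      also have "d \<circ> \<tau> (inv\<^bsub>G\<^esub> g) = \<delta> (g, n)"
      proof
        fix z
        have "\<tau> (inv\<^bsub>G\<^esub> g) z = (?u, n) \<longleftrightarrow> z = \<tau> g (?u, n)" using \<tau>inv[OF gI] by metis
        moreover have "\<tau> g (?u, n) = (g, n)" unfolding \<tau>_def using gI by simp
        ultimately show "(d \<circ> \<tau> (inv\<^bsub>G\<^esub> g)) z = \<delta> (g, n) z" unfolding d_def \<delta>_def by simp
      qed
      finally have "fdiff (\<pi> g (T d)) (T d) = T (fdiff (\<delta> (g, n)) d)" by (simp add: T_diff d \<delta>_finsupp)
      then have "nrm (fdiff (\<pi> g (T d)) (T d)) = p (fdiff (\<delta> (g, n)) d)"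
        by (simp add: nrm_T finsupp_diff d \<delta>_finsupp)
      moreover have "(p (fdiff (\<delta> (g, n)) d))\<^sup>2 < \<epsilon>\<^sup>2"
        unfolding d_def p_\<delta>_diff using n[OF g] gI by (simp add: K_pair E_self)
      then have "p (fdiff (\<delta> (g, n)) d) < \<epsilon>" using e by (intro power2_less_imp_less[of _ \<epsilon>]) auto
      ultimately show ?thesis by simp
    qed
    ultimately show "\<exists>v\<in>V. nrm v = 1 \<and> (\<forall>g\<in>Q. nrm (fdiff (\<pi> g v) v) < \<epsilon>)"
      using nrm_T[OF d] V_T[OF d] by auto
  qed
  have "\<exists>v\<in>hcarrier rkhs. v \<noteq> hzero rkhs \<and> (\<forall>g\<in>carrier G. \<pi> g v = v)"
    by (rule KT[unfolded kazhdan_T_def, rule_format]) (intro conjI rkhs_hilbert unitary almost)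
  then obtain f where f: "f \<in> V" "f \<noteq> (\<lambda>x. 0)" "\<And>g. g \<in> ?I \<Longrightarrow> \<pi> g f = f" by auto
  have const: "f (g, n) = f (?u, n)" if g: "g \<in> ?I" for g n
  proof -
    have "f (g, n) = \<pi> g f (g, n)" using f(3)[OF g] by simp
    also have "\<dots> = f (?u, n)" unfolding \<pi>_def \<tau>_def using g by simp
    finally show ?thesis .
  qed
  have "\<exists>n. f (?u, n) \<noteq> 0"
  proof (rule ccontr)
    assume *: "\<not> ?thesis"
    have "f x = 0" for x
    proof (cases "fst x \<in> ?I")
      case True
      then show ?thesis using const[of "fst x" "snd x"] * by simp
    next
      case False
      then show ?thesis by (intro V_zero_outside[OF f(1)]) (simp add: K_def)
    qed
    then show False using f(2) by blast
  qed
  then obtain n where n: "f (?u, n) \<noteq> 0" by blast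
  define z where "z = cmod (f (?u, n))"
  have z: "z > 0" unfolding z_def using n by simp
  obtain C where C: "C > 0" "\<And>e. e \<in> finsupp \<Longrightarrow> cmod (\<Sum>y\<in>supp e. f y * cnj (e y)) \<le> C * p e"
    using pairing_bound[OF f(1)] by blast
  \<comment> \<open>Greedy choice: a point sufficiently far from the identity is far from all points
    chosen before, by the triangle inequality.\<close>
  have far: "\<exists>A. finite A \<and> A \<subseteq> ?I \<and> card A = N \<and> (\<forall>g\<in>A. \<forall>h\<in>A. g \<noteq> h \<longrightarrow> R \<le> \<psi> g h)"
    if R: "R > 0" for N and R :: real
  proof (induction N)
    case 0
    show ?case by (intro exI[of _ "{}"]) simp
  next
    case (Suc N)
    then obtain A where A: "finite A" "A \<subseteq> ?I" "card A = N" "\<And>g h. g \<in> A \<Longrightarrow> h \<in> A \<Longrightarrow> g \<noteq> h \<Longrightarrow> R \<le> \<psi> g h" by blast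
    obtain g where g: "g \<in> ?I" "\<psi> ?u g > R + (\<Sum>a\<in>A. \<bar>\<psi> ?u a\<bar>)" using unb by (meson not_le)
    have ag: "R \<le> \<psi> a g" if a: "a \<in> A" for a
    proof -
      have "\<bar>\<psi> ?u a\<bar> \<le> (\<Sum>a\<in>A. \<bar>\<psi> ?u a\<bar>)" using A(1) a by (intro member_le_sum) auto
      moreover have "\<psi> ?u g \<le> \<psi> ?u a + \<psi> a g" using a A(2) g(1) by (intro tri) auto
      ultimately show ?thesis using g(2) by linarith
    qed
    have "g \<notin> A" using ag[of g] zero[OF g(1)] R by auto
    moreover have "R \<le> \<psi> g a" if "a \<in> A" for a using ag[OF that] sym[of a g] that A(2) g(1) by auto
    ultimately show ?case using A ag g(1) by (intro exI[of _ "insert g A"]) auto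
  qed
  have key: "real N * z\<^sup>2 \<le> 2 * C\<^sup>2" if N: "N \<ge> 1" for N
  proof -
    \<comment> \<open>Pairs at distance \<open>R\<close> have kernel value at most
      \<open>1 / real N\<close>. The added 1 keeps \<open>R\<close> positive when
      \<open>N = 1\<close>.\<close>
    define R where "R = real (Suc n) * ln (real N) + 1"
    have R: "R > 0" unfolding R_def using N by (intro add_nonneg_pos mult_nonneg_nonneg ln_ge_zero) auto
    obtain A where A: "finite A" "A \<subseteq> ?I" "card A = N" "\<And>g h. g \<in> A \<Longrightarrow> h \<in> A \<Longrightarrow> g \<noteq> h \<Longrightarrow> R \<le> \<psi> g h"
      using far[OF R, of N] by blast
    have small: "E n g h \<le> 1 / real N" if "g \<in> A" "h \<in> A" "g \<noteq> h" for g h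
    proof -
      have "ln (real N) \<le> R / real (Suc n)" unfolding R_def by (simp add: field_simps)
      also have "\<dots> \<le> \<psi> g h / real (Suc n)" using A(4)[OF that] by (simp add: divide_right_mono)
      finally have "- \<psi> g h / real (Suc n) \<le> - ln (real N)" by simp
      then have "E n g h \<le> exp (- ln (real N))" unfolding E_def by simp
      then show ?thesis using N by (simp add: exp_minus inverse_eq_divide)
    qed
    \<comment> \<open>On \<open>N\<close> mutually distant points the indicator pairs with
      \<open>f\<close> to modulus \<open>N * z\<close>, whereas its squared norm is at most
      \<open>2 * N\<close>: N from the diagonal and at most N from all other pairs. For large
      \<open>N\<close> this contradicts boundedness of the pairing.\<close>
    define e where "e x = (if x \<in> (\<lambda>g. (g, n)) ` A then 1 else 0 :: complex)" for x
    have se: "supp e = (\<lambda>g. (g, n)) ` A" unfolding supp_def e_def by auto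
    have fe: "e \<in> finsupp" unfolding finsupp_def using A(1) by (simp add: se)
    have ssum: "sum F (supp e) = (\<Sum>g\<in>A. F (g, n))" for F :: "'g \<times> nat \<Rightarrow> complex"
      unfolding se by (rule sum.reindex_cong[of "\<lambda>g. (g, n)"]) (auto intro: inj_onI)
    have e1: "e (g, n) = 1" if "g \<in> A" for g using that unfolding e_def by simp
    have "(\<Sum>y\<in>supp e. f y * cnj (e y)) = (\<Sum>g\<in>A. f (?u, n))"
      unfolding ssum
    proof (rule sum.cong[OF refl])
      fix g assume g: "g \<in> A"
      then have "g \<in> ?I" using A(2) by blast
      from const[OF this] show "f (g, n) * cnj (e (g, n)) = f (?u, n)" using e1[OF g] by simp
    qed
    then have lhs: "cmod (\<Sum>y\<in>supp e. f y * cnj (e y)) = real N * z" by (simp add: A(3) z_def norm_mult)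
    have "B e e = (\<Sum>g\<in>A. \<Sum>h\<in>A. of_real (K (h, n) (g, n)))"
      unfolding B_def T_def ssum by (intro sum.cong) (auto simp: e1)
    then have "Re (B e e) = (\<Sum>g\<in>A. \<Sum>h\<in>A. E n h g)"
      using A(2) by (simp add: K_pair subset_iff)
    also have "\<dots> \<le> (\<Sum>g\<in>A. \<Sum>h\<in>A. (if h = g then 1 else 0) + 1 / real N)"
      using A(2) small by (intro sum_mono) (auto simp: E_self subset_iff)
    also have "\<dots> = (\<Sum>g\<in>A. 2)"
      using A(1,3) N by (intro sum.cong) (auto simp: sum.distrib)
    finally have pe: "(p e)\<^sup>2 \<le> 2 * real N" using A(3) by (simp add: p_square[OF fe])
    have "(real N * z)\<^sup>2 \<le> (C * p e)\<^sup>2" using C(2)[OF fe] lhs z by (intro power_mono) auto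
    also have "\<dots> = C\<^sup>2 * (p e)\<^sup>2" by (rule power_mult_distrib)
    also have "\<dots> \<le> C\<^sup>2 * (2 * real N)" by (rule mult_left_mono[OF pe]) simp
    finally have "(real N * z)\<^sup>2 \<le> C\<^sup>2 * (2 * real N)" .
    then have "real N * (real N * z\<^sup>2) \<le> real N * (2 * C\<^sup>2)" by (simp add: power2_eq_square mult_ac)
    then show ?thesis using N by simp
  qed
  obtain N where N: "real N > 2 * C\<^sup>2 / z\<^sup>2" using reals_Archimedean2 by blast
  have "real N > 0" using N C(1) z by (smt (verit) divide_pos_pos zero_less_power)
  then have "N \<ge> 1" by simp
  then show False using key[of N] N z by (simp add: field_simps)
qed

section \<open>Positive definiteness of the exponential kernels\<close>

context finite_median
begin

text \<open>Summing over all halfspaces counts each wall twice, hence the half. The index set no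
  longer depends on the two points.\<close>

lemma d_mu_M_eq_halfspaces:
  assumes "x \<in> M" "y \<in> M"
  shows "d_mu_M M \<mu> x y = (\<Sum>h\<in>halfspaces M \<mu>. if x \<in> h \<longleftrightarrow> y \<in> h then 0 else weight M \<mu> h / 2)"
proof -
  let ?w = "\<lambda>h. weight M \<mu> h / 2"
  have split: "(if x \<in> h \<longleftrightarrow> y \<in> h then 0 else ?w h) =
      (if x \<notin> h \<and> y \<in> h then ?w h else 0) + (if y \<notin> h \<and> x \<in> h then ?w h else 0)" for h by auto
  have 1: "(\<Sum>h\<in>halfspaces M \<mu>. if a \<notin> h \<and> b \<in> h then ?w h else 0) = d_mu_M M \<mu> a b / 2"
    if "a \<in> M" "b \<in> M" for a b
    unfolding d_mu_M_eq[OF that] sides_def sum.inter_filter[OF finite_halfspaces] sum_divide_distrib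
    by (intro sum.cong) auto
  show ?thesis unfolding split sum.distrib 1[OF assms] 1[OF assms(2,1)] d_mu_M_sym[OF assms] by simp
qed

text \<open>The exponential is a product of kernels, one per halfspace, each with the value 1 on
  pairs on the same side and \<kappa> on the others. Writing such a factor as a nonnegative
  combination of 1 and a product of signs, the signs can be absorbed into the coefficients
  \<open>c\<close>; this is why the induction is over all \<open>c\<close>.\<close>

lemma exp_d_mu_M_psd:
  fixes u :: "'b \<Rightarrow> 'a" and c :: "'b \<Rightarrow> real"
  assumes u: "\<And>i. i \<in> A \<Longrightarrow> u i \<in> M" and t: "0 \<le> t"
  shows "0 \<le> (\<Sum>i\<in>A. \<Sum>j\<in>A. c i * c j * exp (- (t * d_mu_M M \<mu> (u i) (u j))))"
proof -
  define \<kappa> where "\<kappa> h = exp (- (t * weight M \<mu> h / 2))" for h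
  define F where "F h i j = (if u i \<in> h \<longleftrightarrow> u j \<in> h then 1 else \<kappa> h)" for h i j
  have \<kappa>: "\<kappa> h \<le> 1" "0 \<le> \<kappa> h" if "h \<in> halfspaces M \<mu>" for h
    using weight_nonneg[OF that] t unfolding \<kappa>_def by auto
  define s where "s h i = (if u i \<in> h then 1 else - 1 :: real)" for h i
  have F: "F h i j = (1 + \<kappa> h) / 2 + (1 - \<kappa> h) / 2 * (s h i * s h j)" for h i j
    unfolding F_def s_def by (auto simp: field_simps)
  have psd: "0 \<le> (\<Sum>i\<in>A. \<Sum>j\<in>A. c i * c j * (\<Prod>h\<in>S. F h i j))" if "finite S" "S \<subseteq> halfspaces M \<mu>" for S c
    using that
  proof (induction S arbitrary: c rule: finite_induct)
    case empty
    have "(\<Sum>i\<in>A. \<Sum>j\<in>A. c i * c j) = (\<Sum>i\<in>A. c i) * (\<Sum>j\<in>A. c j)" by (simp add: sum_product)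
    then show ?case by simp
  next
    case (insert k S)
    let ?P = "\<lambda>i j. \<Prod>h\<in>S. F h i j"
    have "(\<Sum>i\<in>A. \<Sum>j\<in>A. c i * c j * (\<Prod>h\<in>insert k S. F h i j)) =
        (1 + \<kappa> k) / 2 * (\<Sum>i\<in>A. \<Sum>j\<in>A. c i * c j * ?P i j) +
        (1 - \<kappa> k) / 2 * (\<Sum>i\<in>A. \<Sum>j\<in>A. (c i * s k i) * (c j * s k j) * ?P i j)"
      unfolding sum_distrib_left sum.distrib[symmetric]
      by (intro sum.cong refl) (use insert.hyps in \<open>simp add: F[of k] algebra_simps\<close>)
    moreover have "0 \<le> (\<Sum>i\<in>A. \<Sum>j\<in>A. c i * c j * ?P i j)"
      "0 \<le> (\<Sum>i\<in>A. \<Sum>j\<in>A. (c i * s k i) * (c j * s k j) * ?P i j)"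
      using insert.IH[of c] insert.IH[of "\<lambda>i. c i * s k i"] insert.prems by auto
    moreover have "\<kappa> k \<le> 1" "0 \<le> \<kappa> k" using \<kappa> insert.prems by auto
    ultimately show ?case by simp
  qed
  have "exp (- (t * d_mu_M M \<mu> (u i) (u j))) = (\<Prod>h\<in>halfspaces M \<mu>. F h i j)" if "i \<in> A" "j \<in> A" for i j
  proof -
    have "- (t * d_mu_M M \<mu> (u i) (u j)) =
        (\<Sum>h\<in>halfspaces M \<mu>. if u i \<in> h \<longleftrightarrow> u j \<in> h then 0 else - (t * weight M \<mu> h / 2))"
      unfolding d_mu_M_eq_halfspaces[OF u[OF that(1)] u[OF that(2)]] sum_distrib_left sum_negf[symmetric]
      by (intro sum.cong) auto
    then show ?thesis unfolding F_def \<kappa>_def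
      by (simp add: exp_sum finite_halfspaces if_distrib[of exp] cong: if_cong)
  qed
  then have "(\<Sum>i\<in>A. \<Sum>j\<in>A. c i * c j * exp (- (t * d_mu_M M \<mu> (u i) (u j)))) =
      (\<Sum>i\<in>A. \<Sum>j\<in>A. c i * c j * (\<Prod>h\<in>halfspaces M \<mu>. F h i j))"
    by (intro sum.cong refl) simp
  then show ?thesis using psd[OF finite_halfspaces order_refl] by simp
qed

end

lemma (in rectifiable) exp_\<rho>_psd:
  fixes u :: "'b \<Rightarrow> 'a" and c :: "'b \<Rightarrow> real"
  assumes A: "finite A" and u: "\<And>i. i \<in> A \<Longrightarrow> u i \<in> X" and t: "0 \<le> t"
  shows "0 \<le> (\<Sum>i\<in>A. \<Sum>j\<in>A. c i * c j * exp (- (t * \<rho> (u i) (u j))))"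
proof -
  have uA: "finite (u ` A)" "u ` A \<subseteq> X" using A u by auto
  have "\<exists>M\<in>finite_subalgebras X \<mu>. u ` A \<subseteq> M \<and>
      (\<forall>x\<in>u ` A. \<forall>y\<in>u ` A. \<rho> x y - 1 / real (Suc n) < d_mu_M M \<mu> x y)" for n
    by (rule \<rho>_approx[OF uA]) simp
  then obtain M where M: "\<And>n. M n \<in> finite_subalgebras X \<mu>" "\<And>n. u ` A \<subseteq> M n"
    "\<And>n. \<forall>x\<in>u ` A. \<forall>y\<in>u ` A. \<rho> x y - 1 / real (Suc n) < d_mu_M (M n) \<mu> x y" by metis
  have lim: "(\<lambda>n. d_mu_M (M n) \<mu> (u i) (u j)) \<longlonglongrightarrow> \<rho> (u i) (u j)" if ij: "i \<in> A" "j \<in> A" for i j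
  proof (rule tendsto_sandwich)
    have "(\<lambda>n. \<rho> (u i) (u j) - inverse (real (Suc n))) \<longlonglongrightarrow> \<rho> (u i) (u j) - 0"
      by (intro tendsto_intros LIMSEQ_inverse_real_of_nat)
    then show "(\<lambda>n. \<rho> (u i) (u j) - 1 / real (Suc n)) \<longlonglongrightarrow> \<rho> (u i) (u j)" by (simp add: inverse_eq_divide)
    show "\<forall>\<^sub>F n in sequentially. \<rho> (u i) (u j) - 1 / real (Suc n) \<le> d_mu_M (M n) \<mu> (u i) (u j)"
      using M(3) ij by (intro always_eventually allI less_imp_le) blast
    show "\<forall>\<^sub>F n in sequentially. d_mu_M (M n) \<mu> (u i) (u j) \<le> \<rho> (u i) (u j)"
      by (intro always_eventually allI \<rho>_ge[OF u[OF ij(1)] u[OF ij(2)] M(1)])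
  qed (rule tendsto_const)
  have "(\<lambda>n. \<Sum>i\<in>A. \<Sum>j\<in>A. c i * c j * exp (- (t * d_mu_M (M n) \<mu> (u i) (u j)))) \<longlonglongrightarrow>
      (\<Sum>i\<in>A. \<Sum>j\<in>A. c i * c j * exp (- (t * \<rho> (u i) (u j))))"
    by (intro tendsto_sum tendsto_mult tendsto_const tendsto_exp tendsto_minus lim)
  moreover have "0 \<le> (\<Sum>i\<in>A. \<Sum>j\<in>A. c i * c j * exp (- (t * d_mu_M (M n) \<mu> (u i) (u j))))" for n
    using finite_median.exp_d_mu_M_psd[OF finite_median_subalgebra[OF M(1)[of n]], of A u t c] M(2)[of n] t by auto
  ultimately show ?thesis by (intro LIMSEQ_le_const) auto
qed

theorem theorem3p7:
  fixes G :: "('g, 'b) monoid_scheme"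
    and X :: "'a::metric_space set"
    and \<mu> :: "'a \<Rightarrow> 'a \<Rightarrow> 'a \<Rightarrow> 'a"
    and \<phi> :: "'g \<Rightarrow> 'a \<Rightarrow> 'a"
  assumes "group G"
    and "kazhdan_T G"
    and "metric_median_algebra X \<mu>"
    and "group_action G X \<phi>"
    and "\<And>g. g \<in> carrier G \<Longrightarrow> isometric_automorphism X \<mu> (\<phi> g)"
    and "uniformly_rectifiable X \<mu>"
    and "median_rank X \<mu> < \<infinity>"
    and "complete X"
    and "connected X"
    and "X \<noteq> {}"
  shows "\<exists>x\<in>X. \<forall>g\<in>carrier G. \<phi> g x = x"
proof -
  interpret group G by fact
  interpret act: group_action G X \<phi> by fact
  obtain L where L: "\<forall>x\<in>X. \<forall>y\<in>X. d_mu X \<mu> x y \<le> ereal (L * dist x y)"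
    using assms(6) unfolding uniformly_rectifiable_def by blast
  interpret rectifiable X \<mu> L
    using assms(3) L by unfold_locales (auto simp: metric_median_algebra_def)
  interpret complete_median X \<mu> \<rho> L
    using assms(3,8,9)
    by unfold_locales
      (auto simp: metric_median_algebra_def \<rho>_le_dist dist_le_\<rho> intro: \<rho>_sym \<rho>_triangle \<rho>_between)
  obtain r where r: "median_rank X \<mu> = enat r" using assms(7) by (cases "median_rank X \<mu>") auto
  obtain x0 where x0: "x0 \<in> X" using assms(10) by blast
  have maps: "\<phi> g x \<in> X" if "g \<in> carrier G" "x \<in> X" for g x
    using act.element_image[OF that(1,2) HOL.refl] .
  have comp: "\<phi> (g \<otimes>\<^bsub>G\<^esub> h) x = \<phi> g (\<phi> h x)" if "g \<in> carrier G" "h \<in> carrier G" "x \<in> X" for g h x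
    by (rule act.composition_rule[OF that(3,1,2)])
  have one: "\<phi> \<one>\<^bsub>G\<^esub> x = x" if "x \<in> X" for x using act.id_eq_one that by (metis restrict_apply')
  have iso: "\<rho> (\<phi> g x) (\<phi> g y) = \<rho> x y" if "g \<in> carrier G" "x \<in> X" "y \<in> X" for g x y
    by (rule \<rho>_automorphism[OF assms(5)[OF that(1)] that(2,3)])
  \<comment> \<open>The orbit map pulls \<rho> back to a left-invariant pseudometric on the group,
    to which property (T) is applied.\<close>
  have "\<exists>R. \<forall>g\<in>carrier G. \<rho> (\<phi> \<one>\<^bsub>G\<^esub> x0) (\<phi> g x0) \<le> R"
  proof (rule kazhdan_T_bounded[OF assms(1,2)])
    fix n :: nat and A and c :: "'g \<Rightarrow> real"
    assume A: "finite A" "A \<subseteq> carrier G"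
    have "0 \<le> (\<Sum>g\<in>A. \<Sum>h\<in>A. c g * c h * exp (- (1 / real (Suc n) * \<rho> (\<phi> g x0) (\<phi> h x0))))"
      by (rule exp_\<rho>_psd[OF A(1)]) (use A(2) maps x0 in auto)
    then show "0 \<le> (\<Sum>g\<in>A. \<Sum>h\<in>A. c g * c h * exp (- \<rho> (\<phi> g x0) (\<phi> h x0) / real (Suc n)))" by simp
  qed (use maps x0 sym triangle iso comp in auto)
  then obtain R where R: "\<And>g. g \<in> carrier G \<Longrightarrow> \<rho> x0 (\<phi> g x0) \<le> R" using one[OF x0] by auto
  have "\<exists>x\<in>X. \<forall>g\<in>\<phi> ` carrier G. g x = x"
  proof (rule fixed_point[OF _ _ _ _ _ x0, where C = "2 * real r" and R = R])
    fix x y assume xy: "x \<in> X" "y \<in> X"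
    show "\<exists>f\<in>coords. \<rho> x y \<le> 2 * real r * (f y - f x)"
      using long_coordinate[OF _ xy, of r] r unfolding coords_def by auto
  next
    fix g assume "g \<in> \<phi> ` carrier G"
    then obtain k where k: "k \<in> carrier G" "g = \<phi> k" by blast
    have "\<phi> k (\<phi> (inv\<^bsub>G\<^esub> k) x) = x" if "x \<in> X" for x
      using comp[OF k(1) inv_closed[OF k(1)] that] one[OF that] k(1) by simp
    then show "\<exists>h\<in>\<phi> ` carrier G. \<forall>x\<in>X. g (h x) = x" using k by blast
    show "\<rho> (g x0) x0 \<le> R" using R[OF k(1)] sym[OF maps[OF k(1) x0] x0] k(2) by simp
    fix h assume "h \<in> \<phi> ` carrier G"
    then obtain l where l: "l \<in> carrier G" "h = \<phi> l" by blast
    have "\<forall>x\<in>X. \<phi> (k \<otimes>\<^bsub>G\<^esub> l) x = g (h x)" using comp[OF k(1) l(1)] k(2) l(2) by simp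
    then show "\<exists>m\<in>\<phi> ` carrier G. \<forall>x\<in>X. m x = g (h x)" using k(1) l(1) by blast
  next
    fix g x y z assume "g \<in> \<phi> ` carrier G" "x \<in> X" "y \<in> X" "z \<in> X"
    then show "g (\<mu> x y z) = \<mu> (g x) (g y) (g z)"
      using assms(5) unfolding isometric_automorphism_def by blast
  qed (use maps iso in auto)
  then show ?thesis by blast
qed

end
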